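(* Let $E$ be a graph, and let $\iota_E : L_{\mathbb{C}}(E) \to C^*(E)$ be the injective algebra $*$-homomorphism with $\iota_E(v) = p_v$ for $v \in E^0$ and $\iota_E(e) = s_e$ for $e \in E^1$. The following are equivalent: (1) $\iota_E : L_{\mathbb{C}}(E) \to C^*(E)$ is surjective; (2) $L_{\mathbb{C}}(E) \cong C^*(E)$ (as $*$-algebras); (3) $L_{\mathbb{C}}(E) \cong C^*(E)$ (as $*$-rings); (4) $E$ is a finite graph with no cycles; (5) $L_{\mathbb{C}}(E)$ is finite dimensional; (6) $C^*(E)$ is finite dimensional. Moreover, when these hold, $L_{\mathbb{C}}(E)$ and $C^*(E)$ are both isomorphic to $M_{n(v_1)}(\mathbb{C}) \oplus \cdots \oplus M_{n(v_k)}(\mathbb{C})$, where $v_1, \ldots, v_k$ are the sinks of $E$ and $n(v_i)$ is the number of directed paths in $E$ ending at $v_i$ (including the trivial path $v_i$ itself) for each $1 \le i \le k$.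
   Context: A graph $E=(E^0,E^1,r,s)$ consists of a countable set $E^0$ of vertices, a countable set $E^1$ of edges, and maps $r,s:E^1\to E^0$ (range and source). A vertex $v$ is a sink if $s^{-1}(v)=\emptyset$, and is regular if $0<|s^{-1}(v)|<\infty$. $E$ is finite if $E^0$ and $E^1$ are finite. A path of length $n\ge 1$ is a sequence of edges $e_1\cdots e_n$ with $r(e_i)=s(e_{i+1})$; vertices are paths of length $0$. A cycle is a path $e_1\cdots e_n$ ($n\ge1$) with $r(e_n)=s(e_1)$ and $s(e_i)\ne s(e_j)$ for $i\neq j$. $C^*(E)$ is the universal $C^*$-algebra generated by mutually orthogonal projections $\{p_v:v\in E^0\}$ and partial isometries $\{s_e:e\in E^1\}$ with mutually orthogonal ranges ($s_e^*s_f=0$ for $e\ne f$) satisfying $s_e^*s_e=p_{r(e)}$ and $s_es_e^*\le p_{s(e)}$ for all $e\in E^1$, and $p_v=\sum_{s(e)=v}s_es_e^*$ for every regular vertex $v$. $L_{\mathbb{C}}(E)$ (the Leavitt path algebra) is the (not necessarily unital) associative $\mathbb{C}$-algebra generated by pairwise orthogonal idempotents $\{v:v\in E^0\}$ and elements $\{e,e^*:e\in E^1\}$ subject to $s(e)e=er(e)=e$, $r(e)e^*=e^*s(e)=e^*$, $e^*f=\delta_{e,f}\,r(e)$ for $e,f\in E^1$, and $v=\sum_{s(e)=v}ee^*$ for every regular vertex $v$. It is a $*$-algebra under the conjugate-linear, product-reversing involution with $v^*=v$ and $e\mapsto e^*$. Isomorphic "as $*$-algebras" means via a $\mathbb{C}$-linear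 multiplicative $*$-preserving bijection; "as $*$-rings" means via an additive, multiplicative, $*$-preserving bijection (not necessarily $\mathbb{C}$-linear). *)

theory Defs
  imports
    Complex_Main
    "HOL-Library.Countable_Set"
    "HOL-Library.FuncSet"
    "HOL-Library.Poly_Mapping"
    "Graph_Theory.Arc_Walk"
    "Jordan_Normal_Form.Schur_Decomposition"
begin

section \<open>Graphs\<close>

text \<open>
  The maps s and r are \<^const>\<open>tail\<close> and \<^const>\<open>head\<close>, the set of edges emitted by v is
  \<^const>\<open>out_arcs\<close>, and paths and cycles are \<^const>\<open>pre_digraph.awalk\<close> and
  \<^const>\<open>pre_digraph.cycle\<close>. Loops and parallel edges are allowed. The latter constant asks the
  ranges of the edges of a closed walk to be distinct; the walk being closed, these are the same
  vertices as the sources.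
\<close>

definition countable_graph :: "('v, 'e) pre_digraph \<Rightarrow> bool" where
  "countable_graph E \<longleftrightarrow> wf_digraph E \<and> countable (verts E) \<and> countable (arcs E)"

definition finite_graph :: "('v, 'e) pre_digraph \<Rightarrow> bool" where
  "finite_graph E \<longleftrightarrow> finite (verts E) \<and> finite (arcs E)"

definition acyclic_graph :: "('v, 'e) pre_digraph \<Rightarrow> bool" where
  "acyclic_graph E \<longleftrightarrow> (\<nexists>p. pre_digraph.cycle E p)"

definition sinks :: "('v, 'e) pre_digraph \<Rightarrow> 'v set" where
  "sinks E = {v \<in> verts E. out_arcs E v = {}}"

definition regular_verts :: "('v, 'e) pre_digraph \<Rightarrow> 'v set" where
  "regular_verts E = {v \<in> verts E. out_arcs E v \<noteq> {} \<and> finite (out_arcs E v)}"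

text \<open>The source is recorded along with the list of edges; the trivial path at v is (v, []).\<close>

definition paths_to :: "('v, 'e) pre_digraph \<Rightarrow> 'v \<Rightarrow> ('v \<times> 'e list) set" where
  "paths_to E v = {(u, p). pre_digraph.awalk E u p v}"


section \<open>Complex star-algebras\<close>

text \<open>Algebras are not assumed to have a unit.\<close>

record 'a star_algebra = "'a partial_object" +
  sa_zero :: 'a
  sa_add :: "'a \<Rightarrow> 'a \<Rightarrow> 'a"
  sa_scale :: "complex \<Rightarrow> 'a \<Rightarrow> 'a"
  sa_mult :: "'a \<Rightarrow> 'a \<Rightarrow> 'a"
  sa_star :: "'a \<Rightarrow> 'a"

definition star_ring_hom :: "'a star_algebra \<Rightarrow> 'b star_algebra \<Rightarrow> ('a \<Rightarrow> 'b) \<Rightarrow> bool" where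
  "star_ring_hom A B \<phi> \<longleftrightarrow>
     (\<forall>x\<in>carrier A. \<phi> x \<in> carrier B) \<and>
     (\<forall>x\<in>carrier A. \<forall>y\<in>carrier A. \<phi> (sa_add A x y) = sa_add B (\<phi> x) (\<phi> y)) \<and>
     (\<forall>x\<in>carrier A. \<forall>y\<in>carrier A. \<phi> (sa_mult A x y) = sa_mult B (\<phi> x) (\<phi> y)) \<and>
     (\<forall>x\<in>carrier A. \<phi> (sa_star A x) = sa_star B (\<phi> x))"

definition star_algebra_hom :: "'a star_algebra \<Rightarrow> 'b star_algebra \<Rightarrow> ('a \<Rightarrow> 'b) \<Rightarrow> bool" where
  "star_algebra_hom A B \<phi> \<longleftrightarrow>
     star_ring_hom A B \<phi> \<and>
     (\<forall>c. \<forall>x\<in>carrier A. \<phi> (sa_scale A c x) = sa_scale B c (\<phi> x))"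

definition star_ring_isomorphic :: "'a star_algebra \<Rightarrow> 'b star_algebra \<Rightarrow> bool" where
  "star_ring_isomorphic A B \<longleftrightarrow>
     (\<exists>\<phi>. star_ring_hom A B \<phi> \<and> bij_betw \<phi> (carrier A) (carrier B))"

definition star_algebra_isomorphic :: "'a star_algebra \<Rightarrow> 'b star_algebra \<Rightarrow> bool" where
  "star_algebra_isomorphic A B \<longleftrightarrow>
     (\<exists>\<phi>. star_algebra_hom A B \<phi> \<and> bij_betw \<phi> (carrier A) (carrier B))"

inductive_set linear_span :: "'a star_algebra \<Rightarrow> 'a set \<Rightarrow> 'a set"
  for A :: "'a star_algebra" and S :: "'a set" where
  zero: "sa_zero A \<in> linear_span A S"
| base: "x \<in> S \<Longrightarrow> x \<in> linear_span A S"
| add: "x \<in> linear_span A S \<Longrightarrow> y \<in> linear_span A S \<Longrightarrow> sa_add A x y \<in> linear_span A S"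
| scale: "x \<in> linear_span A S \<Longrightarrow> sa_scale A c x \<in> linear_span A S"

definition finite_dimensional :: "'a star_algebra \<Rightarrow> bool" where
  "finite_dimensional A \<longleftrightarrow>
     (\<exists>S. finite S \<and> S \<subseteq> carrier A \<and> linear_span A S = carrier A)"

text \<open>
  The quotient by a congruence r. The operations follow the usual pattern for functions on
  equivalence classes (\<^const>\<open>congruent2\<close>): all sets in the union coincide.
\<close>

definition quotient_star_algebra ::
    "'a star_algebra \<Rightarrow> ('a \<times> 'a) set \<Rightarrow> 'a set star_algebra" where
  "quotient_star_algebra A r =
     \<lparr> carrier = carrier A // r,
       sa_zero = r `` {sa_zero A},
       sa_add = (\<lambda>X Y. \<Union>x\<in>X. \<Union>y\<in>Y. r `` {sa_add A x y}),
       sa_scale = (\<lambda>c X. \<Union>x\<in>X. r `` {sa_scale A c x}),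
       sa_mult = (\<lambda>X Y. \<Union>x\<in>X. \<Union>y\<in>Y. r `` {sa_mult A x y}),
       sa_star = (\<lambda>X. \<Union>x\<in>X. r `` {sa_star A x}) \<rparr>"

definition matrix_direct_sum :: "'k set \<Rightarrow> ('k \<Rightarrow> nat) \<Rightarrow> ('k \<Rightarrow> complex mat) star_algebra" where
  "matrix_direct_sum K n =
     \<lparr> carrier = (\<Pi>\<^sub>E k\<in>K. carrier_mat (n k) (n k)),
       sa_zero = (\<lambda>k\<in>K. 0\<^sub>m (n k) (n k)),
       sa_add = (\<lambda>A B. \<lambda>k\<in>K. A k + B k),
       sa_scale = (\<lambda>c A. \<lambda>k\<in>K. c \<cdot>\<^sub>m A k),
       sa_mult = (\<lambda>A B. \<lambda>k\<in>K. A k * B k),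
       sa_star = (\<lambda>A. \<lambda>k\<in>K. mat_adjoint (A k)) \<rparr>"


section \<open>The free star-algebra on the vertices and edges\<close>

text \<open>
  Noncommutative polynomials: finitely supported functions on words, with the convolution product
  of \<^theory>\<open>HOL-Library.Poly_Mapping\<close>.
\<close>

datatype 'a word = Word (letters: "'a list")

instantiation word :: (type) monoid_add
begin

definition zero_word :: "'a word" where
  "0 = Word []"

definition plus_word :: "'a word \<Rightarrow> 'a word \<Rightarrow> 'a word" where
  "u + w = Word (letters u @ letters w)"

instance
  by standard (simp_all add: zero_word_def plus_word_def)

end

text \<open>\<open>Gst e\<close> is the letter for the adjoint of \<open>e\<close>; the letters \<open>Vtx v\<close> are self-adjoint.\<close>

datatype ('v, 'e) letter = Vtx 'v | Edg 'e | Gst 'e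

type_synonym ('v, 'e) ncpoly = "('v, 'e) letter word \<Rightarrow>\<^sub>0 complex"

primrec letter_star :: "('v, 'e) letter \<Rightarrow> ('v, 'e) letter" where
  "letter_star (Vtx v) = Vtx v"
| "letter_star (Edg e) = Gst e"
| "letter_star (Gst e) = Edg e"

definition word_star :: "('v, 'e) letter word \<Rightarrow> ('v, 'e) letter word" where
  "word_star w = Word (rev (map letter_star (letters w)))"

definition poly_star :: "('v, 'e) ncpoly \<Rightarrow> ('v, 'e) ncpoly" where
  "poly_star f = (\<Sum>w\<in>Poly_Mapping.keys f.
     Poly_Mapping.single (word_star w) (cnj (Poly_Mapping.lookup f w)))"

definition poly_scale :: "complex \<Rightarrow> ('v, 'e) ncpoly \<Rightarrow> ('v, 'e) ncpoly" where
  "poly_scale c f = Poly_Mapping.map ((*) c) f"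

definition vtx :: "'v \<Rightarrow> ('v, 'e) ncpoly" where
  "vtx v = Poly_Mapping.single (Word [Vtx v]) 1"

definition edg :: "'e \<Rightarrow> ('v, 'e) ncpoly" where
  "edg e = Poly_Mapping.single (Word [Edg e]) 1"

definition gst :: "'e \<Rightarrow> ('v, 'e) ncpoly" where
  "gst e = Poly_Mapping.single (Word [Gst e]) 1"

definition graph_letters :: "('v, 'e) pre_digraph \<Rightarrow> ('v, 'e) letter set" where
  "graph_letters E = Vtx ` verts E \<union> Edg ` arcs E \<union> Gst ` arcs E"

text \<open>The empty word is excluded, since the free algebra is the non-unital one.\<close>

definition free_carrier :: "('v, 'e) pre_digraph \<Rightarrow> ('v, 'e) ncpoly set" where
  "free_carrier E =
     {f. \<forall>w\<in>Poly_Mapping.keys f. letters w \<noteq> [] \<and> set (letters w) \<subseteq> graph_letters E}"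

definition free_star_algebra :: "('v, 'e) pre_digraph \<Rightarrow> ('v, 'e) ncpoly star_algebra" where
  "free_star_algebra E =
     \<lparr> carrier = free_carrier E, sa_zero = 0, sa_add = (+), sa_scale = poly_scale,
       sa_mult = (*), sa_star = poly_star \<rparr>"


section \<open>The Leavitt path algebra\<close>

definition leavitt_relators :: "('v, 'e) pre_digraph \<Rightarrow> ('v, 'e) ncpoly set" where
  "leavitt_relators E =
     {vtx v * vtx v - vtx v |v. v \<in> verts E} \<union>
     {vtx v * vtx w |v w. v \<in> verts E \<and> w \<in> verts E \<and> v \<noteq> w} \<union>
     {vtx (tail E e) * edg e - edg e |e. e \<in> arcs E} \<union>
     {edg e * vtx (head E e) - edg e |e. e \<in> arcs E} \<union>
     {vtx (head E e) * gst e - gst e |e. e \<in> arcs E} \<union>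
     {gst e * vtx (tail E e) - gst e |e. e \<in> arcs E} \<union>
     {gst e * edg e - vtx (head E e) |e. e \<in> arcs E} \<union>
     {gst e * edg f |e f. e \<in> arcs E \<and> f \<in> arcs E \<and> e \<noteq> f} \<union>
     {vtx v - (\<Sum>e\<in>out_arcs E v. edg e * gst e) |v. v \<in> regular_verts E}"

inductive_set leavitt_ideal :: "('v, 'e) pre_digraph \<Rightarrow> ('v, 'e) ncpoly set"
  for E :: "('v, 'e) pre_digraph" where
  zero: "0 \<in> leavitt_ideal E"
| base: "x \<in> leavitt_relators E \<Longrightarrow> x \<in> leavitt_ideal E"
| add: "x \<in> leavitt_ideal E \<Longrightarrow> y \<in> leavitt_ideal E \<Longrightarrow> x + y \<in> leavitt_ideal E"
| scale: "x \<in> leavitt_ideal E \<Longrightarrow> poly_scale c x \<in> leavitt_ideal E"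
| left: "a \<in> free_carrier E \<Longrightarrow> x \<in> leavitt_ideal E \<Longrightarrow> a * x \<in> leavitt_ideal E"
| right: "x \<in> leavitt_ideal E \<Longrightarrow> a \<in> free_carrier E \<Longrightarrow> x * a \<in> leavitt_ideal E"

definition leavitt_cong ::
    "('v, 'e) pre_digraph \<Rightarrow> (('v, 'e) ncpoly \<times> ('v, 'e) ncpoly) set" where
  "leavitt_cong E = {(x, y). x \<in> free_carrier E \<and> y \<in> free_carrier E \<and> x - y \<in> leavitt_ideal E}"

definition leavitt_path_algebra ::
    "('v, 'e) pre_digraph \<Rightarrow> ('v, 'e) ncpoly set star_algebra" where
  "leavitt_path_algebra E = quotient_star_algebra (free_star_algebra E) (leavitt_cong E)"

definition leavitt_vertex :: "('v, 'e) pre_digraph \<Rightarrow> 'v \<Rightarrow> ('v, 'e) ncpoly set" where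
  "leavitt_vertex E v = leavitt_cong E `` {vtx v}"

definition leavitt_edge :: "('v, 'e) pre_digraph \<Rightarrow> 'e \<Rightarrow> ('v, 'e) ncpoly set" where
  "leavitt_edge E e = leavitt_cong E `` {edg e}"


section \<open>The graph C*-algebra\<close>

definition cstar_seminorm :: "'a star_algebra \<Rightarrow> ('a \<Rightarrow> real) \<Rightarrow> bool" where
  "cstar_seminorm A N \<longleftrightarrow>
     (\<forall>x\<in>carrier A. 0 \<le> N x) \<and>
     (\<forall>x\<in>carrier A. \<forall>y\<in>carrier A. N (sa_add A x y) \<le> N x + N y) \<and>
     (\<forall>c. \<forall>x\<in>carrier A. N (sa_scale A c x) = cmod c * N x) \<and>
     (\<forall>x\<in>carrier A. \<forall>y\<in>carrier A. N (sa_mult A x y) \<le> N x * N y) \<and>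
     (\<forall>x\<in>carrier A. N (sa_mult A (sa_star A x) x) = (N x)\<^sup>2)"

text \<open>
  The relations: mutually orthogonal projections, partial isometries with mutually orthogonal
  ranges, \<open>s\<^sub>e\<^sup>* s\<^sub>e = p\<close> at the range of e, \<open>s\<^sub>e s\<^sub>e\<^sup>* \<le> p\<close> at the source of e (for projections
  \<open>q \<le> p\<close> means \<open>p q = q\<close>), and the relation at regular vertices. Self-adjointness of the
  projections is built into \<^const>\<open>letter_star\<close>.
\<close>

definition cuntz_krieger_relators :: "('v, 'e) pre_digraph \<Rightarrow> ('v, 'e) ncpoly set" where
  "cuntz_krieger_relators E =
     {vtx v * vtx v - vtx v |v. v \<in> verts E} \<union>
     {vtx v * vtx w |v w. v \<in> verts E \<and> w \<in> verts E \<and> v \<noteq> w} \<union>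
     {edg e * gst e * edg e - edg e |e. e \<in> arcs E} \<union>
     {gst e * edg f |e f. e \<in> arcs E \<and> f \<in> arcs E \<and> e \<noteq> f} \<union>
     {gst e * edg e - vtx (head E e) |e. e \<in> arcs E} \<union>
     {vtx (tail E e) * (edg e * gst e) - edg e * gst e |e. e \<in> arcs E} \<union>
     {vtx v - (\<Sum>e\<in>out_arcs E v. edg e * gst e) |v. v \<in> regular_verts E}"

text \<open>
  The universal C*-algebra of a set of generators and relations is the separated completion of the
  free star-algebra on the generators in the largest C*-seminorm for which the relations hold.
  A C*-seminorm on the free star-algebra that vanishes on the relators is the same as a family
  satisfying the relations in (and generating) a C*-algebra, namely the separated completion for
  that seminorm. The supremum below is over a nonempty set, bounded because every such seminorm is
  at most 1 on each generator.
\<close>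

definition cuntz_krieger_seminorms ::
    "('v, 'e) pre_digraph \<Rightarrow> (('v, 'e) ncpoly \<Rightarrow> real) set" where
  "cuntz_krieger_seminorms E =
     {N. cstar_seminorm (free_star_algebra E) N \<and> (\<forall>x\<in>cuntz_krieger_relators E. N x = 0)}"

definition universal_seminorm :: "('v, 'e) pre_digraph \<Rightarrow> ('v, 'e) ncpoly \<Rightarrow> real" where
  "universal_seminorm E x = (SUP N\<in>cuntz_krieger_seminorms E. N x)"

definition cauchy_sequences :: "('v, 'e) pre_digraph \<Rightarrow> (nat \<Rightarrow> ('v, 'e) ncpoly) set" where
  "cauchy_sequences E =
     {X. (\<forall>n. X n \<in> free_carrier E) \<and>
         (\<forall>\<epsilon>>0. \<exists>M. \<forall>m\<ge>M. \<forall>n\<ge>M. universal_seminorm E (X m - X n) < \<epsilon>)}"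

definition cauchy_star_algebra ::
    "('v, 'e) pre_digraph \<Rightarrow> (nat \<Rightarrow> ('v, 'e) ncpoly) star_algebra" where
  "cauchy_star_algebra E =
     \<lparr> carrier = cauchy_sequences E,
       sa_zero = (\<lambda>n. 0),
       sa_add = (\<lambda>X Y n. X n + Y n),
       sa_scale = (\<lambda>c X n. poly_scale c (X n)),
       sa_mult = (\<lambda>X Y n. X n * Y n),
       sa_star = (\<lambda>X n. poly_star (X n)) \<rparr>"

definition null_cong ::
    "('v, 'e) pre_digraph \<Rightarrow> ((nat \<Rightarrow> ('v, 'e) ncpoly) \<times> (nat \<Rightarrow> ('v, 'e) ncpoly)) set" where
  "null_cong E =
     {(X, Y). X \<in> cauchy_sequences E \<and> Y \<in> cauchy_sequences E \<and>
              (\<lambda>n. universal_seminorm E (X n - Y n)) \<longlonglongrightarrow> 0}"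

definition graph_cstar_algebra ::
    "('v, 'e) pre_digraph \<Rightarrow> (nat \<Rightarrow> ('v, 'e) ncpoly) set star_algebra" where
  "graph_cstar_algebra E = quotient_star_algebra (cauchy_star_algebra E) (null_cong E)"

definition cstar_vertex :: "('v, 'e) pre_digraph \<Rightarrow> 'v \<Rightarrow> (nat \<Rightarrow> ('v, 'e) ncpoly) set" where
  "cstar_vertex E v = null_cong E `` {\<lambda>n. vtx v}"

definition cstar_edge :: "('v, 'e) pre_digraph \<Rightarrow> 'e \<Rightarrow> (nat \<Rightarrow> ('v, 'e) ncpoly) set" where
  "cstar_edge E e = null_cong E `` {\<lambda>n. edg e}"

end

theory Submission
  imports Defs "HOL-Library.Function_Algebras"
begin

text \<open>
  All computations take place in the free algebra, modulo the Leavitt ideal on one side and for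
  Cauchy sequences modulo null sequences on the other. If \<open>\<iota>\<close> is onto, it is an
  isomorphism of star-algebras and in particular of star-rings; the work lies in showing that an
  isomorphism of star-rings, or finite dimension of either algebra, forces the graph to be finite
  and acyclic, and that a finite acyclic graph yields everything else.

  Isomorphisms of star-rings: a C*-algebra is complete, and this can be expressed in the language of rings,
  whereas elements of the Leavitt path algebra are finite sums of words. Let \<open>\<phi>\<close> be an
  isomorphism of star-rings. If the graph is infinite, there are infinitely many nonzero mutually
  orthogonal projections \<open>p\<^sub>k\<close>, namely vertices or the \<open>e e\<^sup>*\<close>. Their images have norm at
  most 1, so \<open>\<Sum> 2\<^sup>-\<^sup>k \<phi>(p\<^sub>k)\<close> converges; pulled back along \<open>\<phi>\<close> it gives an element b with
  \<open>2\<^sup>k b p\<^sub>k = p\<^sub>k\<close>, an equation without complex scalars. If there is a cycle c at v, then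
  \<open>b = \<Sum> 2\<^sup>-\<^sup>n \<phi>(c\<^sup>*)\<^sup>n\<close>, with leading term \<open>\<phi>(v)\<close>, pulls back to a solution of
  \<open>2 b = b c\<^sup>* + 2 v\<close>. Both are impossible, as one sees in an explicit representation of the
  Leavitt path algebra on complex functions (lemma \<open>act_ideal\<close>), which depends on a parameter
  \<open>\<mu> \<noteq> 0\<close>. For \<open>\<mu> = 1\<close> every word maps functions with values 0 and 1 to such functions, so b
  takes only finitely many values on them (lemma \<open>act_finite_values\<close>), which excludes
  eigenvalues \<open>2\<^sup>-\<^sup>k\<close> for all k. For general \<open>\<mu>\<close> the indicator function of v is an eigenvector of
  \<open>c\<^sup>*\<close> with eigenvalue \<open>\<mu>\<close> to the length of c (lemma \<open>act_adjoint_path\<close>); choosing this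
  eigenvalue to be 2 contradicts the second equation.

  Finite dimension: the same orthogonal projections, or the powers of \<open>c\<^sup>*\<close>, are linearly
  independent if the graph is infinite or has a cycle. Linear dependence in the C*-algebra is inherited by the Leavitt path algebra because
  \<open>\<iota>\<close> is injective, which says that the universal seminorm vanishes exactly on the Leavitt ideal.

  Finite acyclic graphs: for paths \<open>\<alpha>\<close> and \<open>\<beta>\<close> ending at the same sink, the elements
  \<open>\<alpha> \<beta>\<^sup>*\<close> are matrix units that span the Leavitt path algebra (lemma \<open>spanned_free\<close>). They have
  norm 1, so the coefficients of an element are bounded by its norm (lemma \<open>coefficient_bound\<close>),
  Cauchy sequences converge coefficientwise, and \<open>\<iota>\<close> is onto.
\<close>

section \<open>The free star-algebra\<close>

abbreviation scalar :: "complex \<Rightarrow> ('v, 'e) ncpoly" where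
  "scalar c \<equiv> Poly_Mapping.single 0 c"

lemma poly_scale_eq: "poly_scale c f = scalar c * f"
  by (simp add: poly_scale_def mult_map_scale_conv_mult)

lemma poly_mapping_sum_single:
  "(f :: 'a \<Rightarrow>\<^sub>0 'b::comm_monoid_add) =
    (\<Sum>w\<in>Poly_Mapping.keys f. Poly_Mapping.single w (Poly_Mapping.lookup f w))"
  by (rule poly_mapping_eqI)
    (simp add: lookup_sum lookup_single when_def in_keys_iff)

lemma poly_mapping_additive_induct [case_names zero single add]:
  fixes f :: "'a \<Rightarrow>\<^sub>0 'b::comm_monoid_add"
  assumes "P 0" and "\<And>w c. P (Poly_Mapping.single w c)" and "\<And>f g. P f \<Longrightarrow> P g \<Longrightarrow> P (f + g)"
  shows "P f"
proof -
  have "P (\<Sum>w\<in>W. Poly_Mapping.single w (Poly_Mapping.lookup f w))" if "finite W" for W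
    using that by induction (auto intro: assms)
  from this[OF finite_keys[of f]] show ?thesis
    using poly_mapping_sum_single[of f] by simp
qed

text \<open>
  Scalars are constant polynomials. Being central, they let scalar multiplication be handled by
  the ring laws.
\<close>

lemma scalar_central: "f * scalar c = scalar c * (f :: ('v, 'e) ncpoly)"
  by (induction f rule: poly_mapping_additive_induct)
    (simp_all add: mult_single mult.commute distrib_left distrib_right)

lemma scalar_mult: "scalar (c * d) = scalar c * (scalar d :: ('v, 'e) ncpoly)"
  by (simp add: mult_single)

lemma poly_star_superset:
  assumes "finite W" "Poly_Mapping.keys f \<subseteq> W"
  shows "poly_star f = (\<Sum>w\<in>W. Poly_Mapping.single (word_star w) (cnj (Poly_Mapping.lookup f w)))"
  unfolding poly_star_def
  by (rule sum.mono_neutral_left) (use assms in \<open>auto simp: in_keys_iff\<close>)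

lemma poly_star_zero [simp]: "poly_star 0 = 0"
  by (simp add: poly_star_def)

lemma poly_star_single [simp]:
  "poly_star (Poly_Mapping.single w c) = Poly_Mapping.single (word_star w) (cnj c)"
  by (subst poly_star_superset[of "{w}"]) (auto split: if_splits)

lemma poly_star_add [simp]: "poly_star (f + g) = poly_star f + poly_star g"
proof -
  let ?W = "Poly_Mapping.keys f \<union> Poly_Mapping.keys g"
  have "Poly_Mapping.keys (f + g) \<subseteq> ?W"
    by (rule keys_add)
  then show ?thesis
    by (simp add: poly_star_superset[of ?W] lookup_add single_add sum.distrib)
qed

lemma poly_star_uminus [simp]: "poly_star (- f) = - poly_star f"
proof -
  have "poly_star (- f) + poly_star f = 0"
    by (simp flip: poly_star_add)
  then show ?thesis
    by (simp add: eq_neg_iff_add_eq_0)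
qed

lemma poly_star_diff [simp]: "poly_star (f - g) = poly_star f - poly_star g"
  using poly_star_add[of f "- g"] by simp

lemma poly_star_sum [simp]: "poly_star (sum f S) = (\<Sum>x\<in>S. poly_star (f x))"
  by (induction S rule: infinite_finite_induct) simp_all

lemma word_star_add: "word_star (u + w) = word_star w + word_star u"
  by (simp add: word_star_def plus_word_def)

lemma word_star_zero [simp]: "word_star 0 = 0"
  by (simp add: word_star_def zero_word_def)

lemma word_star_invol [simp]: "word_star (word_star w) = w"
proof -
  have "letter_star (letter_star l) = l" for l :: "('a, 'b) letter"
    by (cases l) simp_all
  then show ?thesis
    by (cases w) (simp add: word_star_def rev_map comp_def)
qed

lemma poly_star_mult [simp]: "poly_star (f * g) = poly_star g * poly_star f"
proof (induction f rule: poly_mapping_additive_induct)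
  case (single w c)
  show ?case
    by (induction g rule: poly_mapping_additive_induct)
      (simp_all add: mult_single word_star_add distrib_left distrib_right mult.commute)
qed (simp_all add: distrib_left distrib_right)

lemma poly_star_invol [simp]: "poly_star (poly_star f) = f"
  by (induction f rule: poly_mapping_additive_induct) simp_all

lemma poly_star_generators [simp]:
  "poly_star (vtx v) = vtx v" "poly_star (edg e) = gst e" "poly_star (gst e) = edg e"
  by (simp_all add: vtx_def edg_def gst_def word_star_def)

lemma free_carrier_zero [simp]: "0 \<in> free_carrier E"
  by (simp add: free_carrier_def)

lemma free_carrier_single:
  "letters w \<noteq> [] \<Longrightarrow> set (letters w) \<subseteq> graph_letters E \<Longrightarrow> Poly_Mapping.single w c \<in> free_carrier E"
  by (simp add: free_carrier_def)

lemma free_carrier_add [intro, simp]: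
  "f \<in> free_carrier E \<Longrightarrow> g \<in> free_carrier E \<Longrightarrow> f + g \<in> free_carrier E"
  using keys_add[of f g] by (auto simp: free_carrier_def)

lemma keys_uminus: "Poly_Mapping.keys (- f) = Poly_Mapping.keys (f :: ('v, 'e) ncpoly)"
  by (auto simp: in_keys_iff)

lemma free_carrier_uminus [intro, simp]: "f \<in> free_carrier E \<Longrightarrow> - f \<in> free_carrier E"
  by (simp add: free_carrier_def keys_uminus)

lemma free_carrier_diff [intro, simp]:
  "f \<in> free_carrier E \<Longrightarrow> g \<in> free_carrier E \<Longrightarrow> f - g \<in> free_carrier E"
  using free_carrier_add[of f E "- g"] by simp

lemma free_carrier_sum [intro, simp]:
  "(\<And>x. x \<in> S \<Longrightarrow> f x \<in> free_carrier E) \<Longrightarrow> sum f S \<in> free_carrier E"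
  by (induction S rule: infinite_finite_induct) auto

lemma free_carrier_mult [intro, simp]:
  assumes "f \<in> free_carrier E" "g \<in> free_carrier E"
  shows "f * g \<in> free_carrier E"
  using keys_mult[of f g] assms
  by (fastforce simp: free_carrier_def plus_word_def)

lemma free_carrier_scalar [intro, simp]:
  assumes "f \<in> free_carrier E"
  shows "scalar c * f \<in> free_carrier E"
  using keys_mult[of "scalar c" f] assms
  by (fastforce simp: free_carrier_def zero_word_def plus_word_def split: if_splits)

lemma free_carrier_generators [intro, simp]:
  "v \<in> verts E \<Longrightarrow> vtx v \<in> free_carrier E"
  "e \<in> arcs E \<Longrightarrow> edg e \<in> free_carrier E"
  "e \<in> arcs E \<Longrightarrow> gst e \<in> free_carrier E"
  by (auto simp: vtx_def edg_def gst_def graph_letters_def intro!: free_carrier_single)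

lemma free_carrier_induct [consumes 1, case_names vtx edg gst mult scalar zero add]:
  assumes "f \<in> free_carrier E"
    and gen: "\<And>v. v \<in> verts E \<Longrightarrow> P (vtx v)" "\<And>e. e \<in> arcs E \<Longrightarrow> P (edg e)"
      "\<And>e. e \<in> arcs E \<Longrightarrow> P (gst e)"
    and mult: "\<And>f g. f \<in> free_carrier E \<Longrightarrow> g \<in> free_carrier E \<Longrightarrow> P f \<Longrightarrow> P g \<Longrightarrow> P (f * g)"
    and scalar: "\<And>c f. f \<in> free_carrier E \<Longrightarrow> P f \<Longrightarrow> P (scalar c * f)"
    and zero: "P 0"
    and add: "\<And>f g. f \<in> free_carrier E \<Longrightarrow> g \<in> free_carrier E \<Longrightarrow> P f \<Longrightarrow> P g \<Longrightarrow> P (f + g)"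
  shows "P f"
proof -
  have letter: "P (Poly_Mapping.single (Word [l]) 1)" if "l \<in> graph_letters E" for l
    using that gen by (auto simp: graph_letters_def vtx_def edg_def gst_def)
  have letter_in: "Poly_Mapping.single (Word [l]) 1 \<in> free_carrier E" if "l \<in> graph_letters E" for l
    using that by (intro free_carrier_single) auto
  have word: "P (Poly_Mapping.single (Word ls) 1)" if "ls \<noteq> []" "set ls \<subseteq> graph_letters E" for ls
    using that
  proof (induction ls rule: list_nonempty_induct)
    case (single l)
    then show ?case by (simp add: letter)
  next
    case (cons l ls)
    have *: "Poly_Mapping.single (Word (l # ls)) 1 =
        Poly_Mapping.single (Word [l]) 1 * Poly_Mapping.single (Word ls) (1::complex)"
      by (simp add: mult_single plus_word_def)
    show ?case
      unfolding * using cons by (intro mult letter letter_in free_carrier_single) auto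
  qed
  have monomial: "P (Poly_Mapping.single w c)"
    if "letters w \<noteq> []" "set (letters w) \<subseteq> graph_letters E" for w c
  proof -
    have *: "Poly_Mapping.single w c = scalar c * Poly_Mapping.single w 1"
      by (simp add: mult_single)
    show ?thesis
      unfolding * using word[of "letters w"] that
      by (intro scalar free_carrier_single) auto
  qed
  have keys: "letters w \<noteq> []" "set (letters w) \<subseteq> graph_letters E"
    if "w \<in> Poly_Mapping.keys f" for w
    using that assms(1) by (auto simp: free_carrier_def)
  have "P (\<Sum>w\<in>W. Poly_Mapping.single w (Poly_Mapping.lookup f w)) \<and>
      (\<Sum>w\<in>W. Poly_Mapping.single w (Poly_Mapping.lookup f w)) \<in> free_carrier E"
    if "finite W" "W \<subseteq> Poly_Mapping.keys f" for W
    using that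
  proof induction
    case (insert w W)
    then show ?case
      using keys[of w] by (auto intro!: add monomial free_carrier_single)
  qed (simp add: zero)
  from this[OF finite_keys[of f]] show ?thesis
    using poly_mapping_sum_single[of f] by simp
qed

lemma free_carrier_star [intro, simp]:
  "f \<in> free_carrier E \<Longrightarrow> poly_star f \<in> free_carrier E"
  by (induction rule: free_carrier_induct) (auto simp: scalar_central)

section \<open>Linear dependence\<close>

text \<open>
  One unknown more than there are equations: adding a zero row to the matrix of coefficients makes
  it square and singular.
\<close>

lemma underdetermined_system:
  fixes a :: "nat \<Rightarrow> 't \<Rightarrow> complex"
  assumes "finite T"
  shows "\<exists>c. (\<exists>k\<le>card T. c k \<noteq> 0) \<and> (\<forall>t\<in>T. (\<Sum>k\<le>card T. c k * a k t) = 0)"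
proof -
  define n where "n = Suc (card T)"
  obtain h where h: "bij_betw h {0..<card T} T"
    using ex_bij_betw_nat_finite[OF assms] by blast
  define r where "r = (\<lambda>i. vec n (\<lambda>k. a k (h i)))"
  \<comment> \<open>The last row, with index card T, is the extra zero row.\<close>
  define A where "A = mat\<^sub>r n n (\<lambda>i. if i = card T then 0\<^sub>v n else r i)"
  have A: "A \<in> carrier_mat n n"
    by (simp add: A_def)
  have "det A = 0"
    unfolding A_def by (rule det_row_0) (auto simp: n_def r_def)
  then obtain v where v: "v \<in> carrier_vec n" "v \<noteq> 0\<^sub>v n" "A *\<^sub>v v = 0\<^sub>v n"
    using det_0_iff_vec_prod_zero[OF A] by blast
  have nz: "\<exists>k\<le>card T. v $ k \<noteq> 0"
  proof (rule ccontr)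
    assume "\<not> ?thesis"
    then have "v = 0\<^sub>v n" using v(1) by (intro eq_vecI) (auto simp: n_def)
    with v(2) show False by simp
  qed
  have "(\<Sum>k\<le>card T. v $ k * a k t) = 0" if "t \<in> T" for t
  proof -
    have "t \<in> h ` {0..<card T}"
      using h that by (simp add: bij_betw_def)
    then obtain i where i: "i < card T" "t = h i" by auto
    have "0 = (A *\<^sub>v v) $ i" using v(3) i by (simp add: n_def)
    also have "\<dots> = r i \<bullet> v" using i by (simp add: A_def n_def r_def)
    also have "\<dots> = (\<Sum>k\<in>{0..<n}. v $ k * a k t)"
      using v(1) i by (auto simp: scalar_prod_def r_def mult.commute intro!: sum.cong)
    also have "{0..<n} = {..card T}" by (auto simp: n_def)
    finally show ?thesis by simp
  qed
  then show ?thesis using nz by (intro exI[of _ "\<lambda>k. v $ k"]) blast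
qed

section \<open>Quotients of star-algebras by ideals\<close>

text \<open>
  The Leavitt path algebra and the graph C*-algebra are both quotients of a star-subalgebra of a
  unital ring by a star-ideal: of the free algebra in the first case, of the ring of sequences in
  the free algebra in the second. The scalars act through a ring homomorphism \<open>\<kappa>\<close> into the
  ambient ring; it need not take values in the carrier, which may lack a unit.
\<close>

locale star_ideal =
  fixes B :: "'r::ring_1 star_algebra" and \<kappa> :: "complex \<Rightarrow> 'r" and J :: "'r set"
  assumes zero_B: "sa_zero B = 0" and add_B: "sa_add B = (+)" and mult_B: "sa_mult B = (*)"
    and scale_B: "sa_scale B = (\<lambda>c x. \<kappa> c * x)"
    and star_B: "\<And>x y. sa_star B (x - y) = sa_star B x - sa_star B y"
    and carrier_closed: "0 \<in> carrier B"
      "\<And>x y. x \<in> carrier B \<Longrightarrow> y \<in> carrier B \<Longrightarrow> x + y \<in> carrier B"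
      "\<And>c x. x \<in> carrier B \<Longrightarrow> \<kappa> c * x \<in> carrier B"
      "\<And>x y. x \<in> carrier B \<Longrightarrow> y \<in> carrier B \<Longrightarrow> x * y \<in> carrier B"
      "\<And>x. x \<in> carrier B \<Longrightarrow> sa_star B x \<in> carrier B"
    and kappa: "\<kappa> 1 = 1" "\<And>c d. \<kappa> (c + d) = \<kappa> c + \<kappa> d" "\<And>c d. \<kappa> (c * d) = \<kappa> c * \<kappa> d"
    and ideal: "J \<subseteq> carrier B" "0 \<in> J" "\<And>x y. x \<in> J \<Longrightarrow> y \<in> J \<Longrightarrow> x + y \<in> J"
      "\<And>c x. x \<in> J \<Longrightarrow> \<kappa> c * x \<in> J"
      "\<And>a x. a \<in> carrier B \<Longrightarrow> x \<in> J \<Longrightarrow> a * x \<in> J"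
      "\<And>a x. a \<in> carrier B \<Longrightarrow> x \<in> J \<Longrightarrow> x * a \<in> J"
      "\<And>x. x \<in> J \<Longrightarrow> sa_star B x \<in> J"
begin

definition cong :: "('r \<times> 'r) set" where
  "cong = {(x, y). x \<in> carrier B \<and> y \<in> carrier B \<and> x - y \<in> J}"

definition cl :: "'r \<Rightarrow> 'r set" where
  "cl x = cong `` {x}"

lemma kappa_zero: "\<kappa> 0 = 0"
  using kappa(2)[of 0 0] by simp

lemma kappa_sum: "\<kappa> (sum f I) = (\<Sum>i\<in>I. \<kappa> (f i))"
  by (induction I rule: infinite_finite_induct) (simp_all add: kappa kappa_zero)

lemma minus_one: "\<kappa> (- 1) = - 1"
  using kappa(2)[of "-1" 1] by (simp add: kappa_zero kappa(1) eq_neg_iff_add_eq_0)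

lemma ideal_uminus: "x \<in> J \<Longrightarrow> - x \<in> J"
  using ideal(4)[of x "-1"] by (simp add: minus_one)

lemma ideal_diff: "x \<in> J \<Longrightarrow> y \<in> J \<Longrightarrow> x - y \<in> J"
  using ideal(3)[of x "- y"] ideal_uminus[of y] by simp

lemma ideal_minus_commute: "x - y \<in> J \<longleftrightarrow> y - x \<in> J"
  using ideal_uminus[of "x - y"] ideal_uminus[of "y - x"] by auto

lemma equiv_cong: "equiv (carrier B) cong"
proof (rule equivI)
  show "cong \<subseteq> carrier B \<times> carrier B" "refl_on (carrier B) cong"
    by (auto simp: cong_def refl_on_def ideal)
  show "sym cong"
    by (auto simp: sym_def cong_def ideal_minus_commute)
  show "trans cong"
  proof (rule transI)
    fix x y z assume "(x, y) \<in> cong" "(y, z) \<in> cong"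
    then show "(x, z) \<in> cong"
      using ideal(3)[of "x - y" "y - z"] by (auto simp: cong_def)
  qed
qed

lemma cl_eq_iff:
  "x \<in> carrier B \<Longrightarrow> y \<in> carrier B \<Longrightarrow> cl x = cl y \<longleftrightarrow> x - y \<in> J"
  using eq_equiv_class_iff[OF equiv_cong, of x y] by (simp add: cl_def cong_def)

lemma cong_class_eq: "(x, y) \<in> cong \<Longrightarrow> cong `` {x} = cong `` {y}"
  using equiv_class_eq[OF equiv_cong] .

abbreviation "Q \<equiv> quotient_star_algebra B cong"

lemma carrier_Q: "carrier Q = cl ` carrier B"
  by (auto simp: quotient_star_algebra_def quotient_def cl_def)

lemma zero_Q: "sa_zero Q = cl 0"
  by (simp add: quotient_star_algebra_def cl_def zero_B)

lemma star_Q: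
  assumes "x \<in> carrier B"
  shows "sa_star Q (cl x) = cl (sa_star B x)"
proof -
  have "(\<lambda>x. cong `` {sa_star B x}) respects cong"
    by (rule congruentI, rule cong_class_eq) (auto simp: cong_def carrier_closed ideal simp flip: star_B)
  from UN_equiv_class[OF equiv_cong this assms] show ?thesis
    by (simp add: quotient_star_algebra_def cl_def)
qed

lemma scale_Q:
  assumes "x \<in> carrier B"
  shows "sa_scale Q c (cl x) = cl (\<kappa> c * x)"
proof -
  have "(\<lambda>x. cong `` {\<kappa> c * x}) respects cong"
    by (rule congruentI, rule cong_class_eq)
      (auto simp: cong_def carrier_closed ideal simp flip: right_diff_distrib)
  from UN_equiv_class[OF equiv_cong this assms] show ?thesis
    by (simp add: quotient_star_algebra_def cl_def scale_B)
qed

lemma add_Q: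
  assumes "x \<in> carrier B" "y \<in> carrier B"
  shows "sa_add Q (cl x) (cl y) = cl (x + y)"
proof -
  have "(\<lambda>x y. cong `` {x + y}) respects2 cong"
    by (rule congruent2I[OF equiv_cong equiv_cong]; rule cong_class_eq)
      (auto simp: cong_def carrier_closed)
  from UN_equiv_class2[OF equiv_cong equiv_cong this assms] show ?thesis
    by (simp add: quotient_star_algebra_def cl_def add_B)
qed

lemma mult_Q:
  assumes "x \<in> carrier B" "y \<in> carrier B"
  shows "sa_mult Q (cl x) (cl y) = cl (x * y)"
proof -
  have "(\<lambda>x y. cong `` {x * y}) respects2 cong"
    by (rule congruent2I[OF equiv_cong equiv_cong]; rule cong_class_eq)
      (auto simp: cong_def carrier_closed ideal simp flip: right_diff_distrib left_diff_distrib)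
  from UN_equiv_class2[OF equiv_cong equiv_cong this assms] show ?thesis
    by (simp add: quotient_star_algebra_def cl_def mult_B)
qed

lemma ideal_sum: "(\<And>i. i \<in> I \<Longrightarrow> f i \<in> J) \<Longrightarrow> sum f I \<in> J"
  by (induction I rule: infinite_finite_induct) (auto simp: ideal)

lemma carrier_sum: "(\<And>i. i \<in> I \<Longrightarrow> f i \<in> carrier B) \<Longrightarrow> sum f I \<in> carrier B"
  by (induction I rule: infinite_finite_induct) (auto simp: carrier_closed)

text \<open>
  The coordinates of finitely many elements with respect to a spanning set of t elements form an
  underdetermined system as soon as there are more than t of them.
\<close>

lemma finite_dimensional_dependent:
  assumes "finite_dimensional Q" and x: "\<And>k::nat. x k \<in> carrier B"
  shows "\<exists>m c. (\<exists>k\<le>m. c k \<noteq> 0) \<and> (\<Sum>k\<le>m. \<kappa> (c k) * x k) \<in> J"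
proof -
  obtain S where S: "finite S" "S \<subseteq> cl ` carrier B" "linear_span Q S = cl ` carrier B"
    using assms(1) by (auto simp: finite_dimensional_def carrier_Q)
  then obtain T where T: "finite T" "T \<subseteq> carrier B" "S = cl ` T"
    using finite_subset_image by metis
  let ?combination = "\<lambda>a. \<Sum>t\<in>T. \<kappa> (a t) * t"
  have combination_in: "?combination a \<in> carrier B" for a
    using T by (auto intro: carrier_sum carrier_closed)
  have "\<exists>a. s = cl (?combination a)" if "s \<in> linear_span Q S" for s
    using that
  proof induction
    case zero
    show ?case by (rule exI[of _ "\<lambda>_. 0"]) (simp add: zero_Q kappa_zero)
  next
    case (base s)
    then obtain t where t: "t \<in> T" "s = cl t" using T by auto
    have "?combination (\<lambda>u. if u = t then 1 else 0) = (\<Sum>u\<in>T. if u = t then u else 0)"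
      by (intro sum.cong) (auto simp: kappa kappa_zero)
    also have "\<dots> = t" using t T by simp
    finally show ?case using t by metis
  next
    case (add s s')
    then obtain a a' where "s = cl (?combination a)" "s' = cl (?combination a')" by auto
    then have "sa_add Q s s' = cl (?combination a + ?combination a')" by (simp add: add_Q combination_in)
    also have "?combination a + ?combination a' = ?combination (\<lambda>t. a t + a' t)"
      by (simp add: kappa distrib_right sum.distrib)
    finally show ?case by (intro exI[of _ "\<lambda>t. a t + a' t"])
  next
    case (scale s c)
    then obtain a where "s = cl (?combination a)" by auto
    then have "sa_scale Q c s = cl (\<kappa> c * ?combination a)" by (simp add: scale_Q combination_in)
    also have "\<kappa> c * ?combination a = ?combination (\<lambda>t. c * a t)"
      by (simp add: kappa sum_distrib_left mult.assoc)
    finally show ?case by (intro exI[of _ "\<lambda>t. c * a t"])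
  qed
  then have "\<exists>a. cl (x k) = cl (?combination a)" for k
    using S x by blast
  then obtain a where a: "\<And>k. x k - ?combination (a k) \<in> J"
    using cl_eq_iff[OF x combination_in] by metis
  obtain c where c: "\<exists>k\<le>card T. c k \<noteq> 0" "\<And>t. t \<in> T \<Longrightarrow> (\<Sum>k\<le>card T. c k * a k t) = 0"
    using underdetermined_system[OF T(1), of a] by blast
  have "(\<Sum>k\<le>card T. \<kappa> (c k) * ?combination (a k)) = (\<Sum>t\<in>T. \<kappa> (\<Sum>k\<le>card T. c k * a k t) * t)"
    unfolding kappa_sum sum_distrib_left sum_distrib_right kappa mult.assoc by (rule sum.swap)
  also have "\<dots> = 0" using c(2) by (simp add: kappa_zero)
  finally have "(\<Sum>k\<le>card T. \<kappa> (c k) * x k) = (\<Sum>k\<le>card T. \<kappa> (c k) * (x k - ?combination (a k)))"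
    by (simp add: right_diff_distrib sum_subtractf)
  also have "\<dots> \<in> J" by (intro ideal_sum ideal a)
  finally show ?thesis using c(1) by blast
qed

end

section \<open>The Leavitt ideal\<close>

lemma leavitt_relators_free:
  assumes "wf_digraph E" "x \<in> leavitt_relators E"
  shows "x \<in> free_carrier E"
proof -
  interpret wf_digraph E by fact
  have "vtx v - (\<Sum>e\<in>out_arcs E v. edg e * gst e) \<in> free_carrier E" if "v \<in> regular_verts E" for v
    using that
    by (intro free_carrier_diff free_carrier_sum free_carrier_mult free_carrier_generators)
      (auto simp: regular_verts_def)
  then show ?thesis
    using assms(2) unfolding leavitt_relators_def
    by (elim UnE CollectE exE conjE) simp_all
qed

lemma leavitt_ideal_free:
  assumes "wf_digraph E"
  shows "x \<in> leavitt_ideal E \<Longrightarrow> x \<in> free_carrier E"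
  by (induction rule: leavitt_ideal.induct) (auto simp: poly_scale_eq leavitt_relators_free[OF assms])

lemma leavitt_relatorsI:
  "v \<in> verts E \<Longrightarrow> vtx v * vtx v - vtx v \<in> leavitt_relators E"
  "v \<in> verts E \<Longrightarrow> w \<in> verts E \<Longrightarrow> v \<noteq> w \<Longrightarrow> vtx v * vtx w \<in> leavitt_relators E"
  "e \<in> arcs E \<Longrightarrow> vtx (tail E e) * edg e - edg e \<in> leavitt_relators E"
  "e \<in> arcs E \<Longrightarrow> edg e * vtx (head E e) - edg e \<in> leavitt_relators E"
  "e \<in> arcs E \<Longrightarrow> vtx (head E e) * gst e - gst e \<in> leavitt_relators E"
  "e \<in> arcs E \<Longrightarrow> gst e * vtx (tail E e) - gst e \<in> leavitt_relators E"
  "e \<in> arcs E \<Longrightarrow> gst e * edg e - vtx (head E e) \<in> leavitt_relators E"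
  "e \<in> arcs E \<Longrightarrow> f \<in> arcs E \<Longrightarrow> e \<noteq> f \<Longrightarrow> gst e * edg f \<in> leavitt_relators E"
  "v \<in> regular_verts E \<Longrightarrow> vtx v - (\<Sum>e\<in>out_arcs E v. edg e * gst e) \<in> leavitt_relators E"
  unfolding leavitt_relators_def by (simp_all only: Un_iff mem_Collect_eq) metis+

text \<open>
  The relators come in adjoint pairs or are self-adjoint.
\<close>

lemma leavitt_relators_star:
  assumes "x \<in> leavitt_relators E"
  shows "poly_star x \<in> leavitt_relators E"
  using assms
  by (subst (asm) leavitt_relators_def, elim UnE CollectE exE conjE)
    (simp_all add: leavitt_relatorsI)

lemma leavitt_ideal_star: "x \<in> leavitt_ideal E \<Longrightarrow> poly_star x \<in> leavitt_ideal E"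
proof (induction rule: leavitt_ideal.induct)
  case (scale x c)
  then show ?case
    using leavitt_ideal.scale[of "poly_star x" E "cnj c"] 
    by (simp add: poly_scale_eq scalar_central)
qed (auto intro: leavitt_ideal.intros leavitt_relators_star)

lemma leavitt_ideal_scalar: "x \<in> leavitt_ideal E \<Longrightarrow> scalar c * x \<in> leavitt_ideal E"
  using leavitt_ideal.scale[of x E c] by (simp add: poly_scale_eq)

lemma star_ideal_leavitt:
  assumes "wf_digraph E"
  shows "star_ideal (free_star_algebra E) scalar (leavitt_ideal E)"
  by standard
    (auto simp: free_star_algebra_def poly_scale_eq fun_eq_iff leavitt_ideal_star single_add mult_single
      leavitt_ideal_free[OF assms] leavitt_ideal_scalar intro: leavitt_ideal.intros)

section \<open>A representation of the Leavitt path algebra\<close>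

locale graph_rep = wf_digraph E for E :: "('v, 'e) pre_digraph" +
  assumes countable_arcs: "countable (arcs E)"
begin

text \<open>
  The representation lives on the functions on \<open>verts \<times> nat\<close>. The edge e maps the copy of the
  natural numbers at its range injectively, by \<open>embed e\<close>, into the copy at its source. The edges
  leaving a vertex must have disjoint images, and these must cover everything when the vertex is
  regular: residue classes achieve this for finitely many edges, and a pairing function gives
  disjointness for infinitely many.
\<close>

definition embed :: "'e \<Rightarrow> nat \<Rightarrow> nat" where
  "embed e m =
    (let F = out_arcs E (tail E e); i = to_nat_on F e
     in if finite F then card F * m + i else prod_encode (i, m))"

lemma countable_out_arcs: "countable (out_arcs E v)"
  by (rule countable_subset[OF _ countable_arcs]) auto

lemma embed_eq_iff:
  assumes "e \<in> arcs E" "f \<in> arcs E" "tail E e = tail E f"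
  shows "embed e m = embed f n \<longleftrightarrow> e = f \<and> m = n"
proof -
  define F where "F = out_arcs E (tail E e)"
  have F: "F = out_arcs E (tail E f)" "e \<in> F" "f \<in> F" "countable F"
    using assms countable_out_arcs by (auto simp: F_def)
  have inj: "to_nat_on F e = to_nat_on F f \<longleftrightarrow> e = f"
    using F by simp
  show ?thesis
  proof (cases "finite F")
    case True
    have lt: "to_nat_on F e < card F" "to_nat_on F f < card F"
      using to_nat_on_finite[OF True] F by (auto simp: bij_betw_def)
    have "card F * m + to_nat_on F e = card F * n + to_nat_on F f \<longleftrightarrow>
        m = n \<and> to_nat_on F e = to_nat_on F f"
    proof
      assume eq: "card F * m + to_nat_on F e = card F * n + to_nat_on F f"
      have "(card F * m + to_nat_on F e) div card F = m" "(card F * n + to_nat_on F f) div card F = n"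
        using lt by (auto simp: div_mult_self4)
      with eq show "m = n \<and> to_nat_on F e = to_nat_on F f" by auto
    qed auto
    then show ?thesis
      using True inj F by (auto simp: embed_def Let_def simp flip: F_def)
  next
    case False
    then show ?thesis
      using inj F by (auto simp: embed_def Let_def simp flip: F_def)
  qed
qed

lemma embed_cover:
  assumes "v \<in> regular_verts E"
  shows "\<exists>e\<in>out_arcs E v. n \<in> range (embed e)"
proof -
  define F where "F = out_arcs E v"
  have F: "finite F" "card F > 0"
    using assms by (auto simp: F_def regular_verts_def card_gt_0_iff)
  then have "n mod card F \<in> to_nat_on F ` F"
    using to_nat_on_finite[of F] by (auto simp: bij_betw_def)
  then obtain e where e: "e \<in> F" "to_nat_on F e = n mod card F"
    by auto
  then have "tail E e = v" by (auto simp: F_def)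
  then have "n = embed e (n div card F)"
    using e F by (simp add: embed_def flip: F_def)
  then have "n \<in> range (embed e)" by (rule range_eqI)
  then show ?thesis using e by (auto simp only: F_def)
qed

lemma inj_embed: "e \<in> arcs E \<Longrightarrow> inj (embed e)"
  by (auto simp: inj_def embed_eq_iff)

text \<open>
  An edge pushes functions forward along its embedding and its adjoint pulls them back. Pulling
  back also multiplies by \<open>\<mu>\<close>, and pushing forward divides by it; this twist by the gauge action
  preserves the relations.
\<close>

primrec letter_act ::
    "complex \<Rightarrow> ('v, 'e) letter \<Rightarrow> ('v \<times> nat \<Rightarrow> complex) \<Rightarrow> 'v \<times> nat \<Rightarrow> complex" where
  "letter_act \<mu> (Vtx v) h = (\<lambda>(u, m). if u = v then h (u, m) else 0)"
| "letter_act \<mu> (Edg e) h = (\<lambda>(u, m). if u = tail E e \<and> m \<in> range (embed e)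
     then h (head E e, inv_into UNIV (embed e) m) / \<mu> else 0)"
| "letter_act \<mu> (Gst e) h = (\<lambda>(u, m). if u = head E e then \<mu> * h (tail E e, embed e m) else 0)"

definition word_act ::
    "complex \<Rightarrow> ('v, 'e) letter word \<Rightarrow> ('v \<times> nat \<Rightarrow> complex) \<Rightarrow> 'v \<times> nat \<Rightarrow> complex" where
  "word_act \<mu> w = foldr (letter_act \<mu>) (letters w)"

definition act ::
    "complex \<Rightarrow> ('v, 'e) ncpoly \<Rightarrow> ('v \<times> nat \<Rightarrow> complex) \<Rightarrow> 'v \<times> nat \<Rightarrow> complex" where
  "act \<mu> f h = (\<lambda>x. \<Sum>w\<in>Poly_Mapping.keys f. Poly_Mapping.lookup f w * word_act \<mu> w h x)"

lemma letter_act_linear: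
  "letter_act \<mu> l (\<lambda>x. c * h x + d * k x) = (\<lambda>x. c * letter_act \<mu> l h x + d * letter_act \<mu> l k x)"
  by (cases l) (auto simp: fun_eq_iff algebra_simps add_divide_distrib)

lemma word_act_linear:
  "word_act \<mu> w (\<lambda>x. c * h x + d * k x) = (\<lambda>x. c * word_act \<mu> w h x + d * word_act \<mu> w k x)"
proof -
  have "foldr (letter_act \<mu>) ls (\<lambda>x. c * h x + d * k x) =
      (\<lambda>x. c * foldr (letter_act \<mu>) ls h x + d * foldr (letter_act \<mu>) ls k x)" for ls
    by (induction ls) (simp_all add: letter_act_linear)
  then show ?thesis by (simp add: word_act_def)
qed

lemma word_act_add: "word_act \<mu> (u + w) h = word_act \<mu> u (word_act \<mu> w h)"
  by (simp add: word_act_def plus_word_def)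

lemma act_superset:
  assumes "finite W" "Poly_Mapping.keys f \<subseteq> W"
  shows "act \<mu> f h = (\<lambda>x. \<Sum>w\<in>W. Poly_Mapping.lookup f w * word_act \<mu> w h x)"
  unfolding act_def
  by (rule ext, rule sum.mono_neutral_left) (use assms in \<open>auto simp: in_keys_iff\<close>)

lemma act_zero [simp]: "act \<mu> 0 h = (\<lambda>x. 0)"
  by (simp add: act_def)

lemma act_single: "act \<mu> (Poly_Mapping.single w c) h = (\<lambda>x. c * word_act \<mu> w h x)"
  by (subst act_superset[of "{w}"]) (auto split: if_splits)

lemma act_add: "act \<mu> (f + g) h = (\<lambda>x. act \<mu> f h x + act \<mu> g h x)"
proof -
  let ?W = "Poly_Mapping.keys f \<union> Poly_Mapping.keys g"
  have "Poly_Mapping.keys (f + g) \<subseteq> ?W"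
    by (rule keys_add)
  then show ?thesis
    by (simp add: act_superset[of ?W] lookup_add distrib_right sum.distrib)
qed

lemma act_linear:
  "act \<mu> f (\<lambda>x. c * h x + d * k x) = (\<lambda>x. c * act \<mu> f h x + d * act \<mu> f k x)"
  by (auto simp: act_def word_act_linear algebra_simps sum_distrib_left sum.distrib)

lemma act_zero_right [simp]: "act \<mu> f (\<lambda>x. 0) = (\<lambda>x. 0)"
  using act_linear[of \<mu> f 0 "\<lambda>x. 0" 0 "\<lambda>x. 0"] by simp

lemma act_mult: "act \<mu> (f * g) h = act \<mu> f (act \<mu> g h)"
proof (induction f rule: poly_mapping_additive_induct)
  case (single w c)
  show ?case
  proof (induction g rule: poly_mapping_additive_induct)
    case (single u d)
    show ?case
      using word_act_linear[of \<mu> w d "word_act \<mu> u h" 0 "\<lambda>x. 0"]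
      by (simp add: mult_single act_single word_act_add mult.assoc)
  next
    case (add g g')
    then show ?case
      using act_linear[of \<mu> "Poly_Mapping.single w c" 1 "act \<mu> g h" 1 "act \<mu> g' h"]
      by (simp add: distrib_left act_add)
  qed simp
qed (simp_all add: distrib_right act_add)

lemma act_scalar: "act \<mu> (scalar c) h = (\<lambda>x. c * h x)"
  by (simp add: act_single word_act_def zero_word_def)

lemma act_uminus: "act \<mu> (- f) h = (\<lambda>x. - act \<mu> f h x)"
  using act_add[of \<mu> f "- f" h] by (auto simp: fun_eq_iff eq_neg_iff_add_eq_0 add.commute)

lemma act_diff: "act \<mu> (f - g) h = (\<lambda>x. act \<mu> f h x - act \<mu> g h x)"
  using act_add[of \<mu> f "- g" h] by (simp add: act_uminus)

lemma act_sum: "act \<mu> (sum f S) h = (\<lambda>x. \<Sum>s\<in>S. act \<mu> (f s) h x)"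
  by (induction S rule: infinite_finite_induct) (simp_all add: act_add)

lemma act_generators:
  "act \<mu> (vtx v) h = letter_act \<mu> (Vtx v) h" "act \<mu> (edg e) h = letter_act \<mu> (Edg e) h"
  "act \<mu> (gst e) h = letter_act \<mu> (Gst e) h"
  by (simp_all add: vtx_def edg_def gst_def act_single word_act_def)

lemma letter_act_edg_gst:
  assumes "\<mu> \<noteq> 0"
  shows "letter_act \<mu> (Edg e) (letter_act \<mu> (Gst e) h) =
    (\<lambda>(u, m). if u = tail E e \<and> m \<in> range (embed e) then h (u, m) else 0)"
proof
  fix y :: "'v \<times> nat"
  show "letter_act \<mu> (Edg e) (letter_act \<mu> (Gst e) h) y =
      (case y of (u, m) \<Rightarrow> if u = tail E e \<and> m \<in> range (embed e) then h (u, m) else 0)"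
    using assms f_inv_into_f[of "snd y" "embed e" UNIV]
    by (cases y) (simp del: image_iff)
qed

text \<open>
  The relation at a regular vertex holds because every point over the vertex lies in the image of
  exactly one edge; the orthogonality relations hold because those images are disjoint.
\<close>

lemma act_relators:
  assumes "\<mu> \<noteq> 0" "x \<in> leavitt_relators E"
  shows "act \<mu> x h = (\<lambda>y. 0)"
proof -
  have ck: "act \<mu> (vtx v - (\<Sum>e\<in>out_arcs E v. edg e * gst e)) h = (\<lambda>y. 0)"
    if v: "v \<in> regular_verts E" for v
  proof
    fix y :: "'v \<times> nat"
    obtain u n where y: "y = (u, n)" by (cases y)
    have fin: "finite (out_arcs E v)" using v by (simp add: regular_verts_def)
    obtain e where e: "e \<in> out_arcs E v" "n \<in> range (embed e)"
      using embed_cover[OF v] by blast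
    have other: "f = e" if "f \<in> out_arcs E v" "n \<in> range (embed f)" for f
    proof -
      from that e obtain m m' where "embed f m = embed e m'"
        by (metis imageE)
      then show ?thesis
        using that e by (simp add: embed_eq_iff)
    qed
    have "(\<Sum>f\<in>out_arcs E v. act \<mu> (edg f * gst f) h y) =
        (\<Sum>f\<in>out_arcs E v. if f = e then (if u = v then h y else 0) else 0)"
    proof (rule sum.cong[OF refl])
      fix f assume f: "f \<in> out_arcs E v"
      have "act \<mu> (edg f * gst f) h y =
          (if u = tail E f \<and> n \<in> range (embed f) then h y else 0)"
        unfolding act_mult act_generators letter_act_edg_gst[OF assms(1)] by (simp add: y)
      then show "act \<mu> (edg f * gst f) h y = (if f = e then (if u = v then h y else 0) else 0)"
      proof (cases "f = e")
        case True
        then have "tail E f = v" using e by simp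
        with True e(2) show ?thesis
          unfolding \<open>act \<mu> (edg f * gst f) h y = _\<close> by (simp only: simp_thms if_True)
      next
        case False
        then have "n \<notin> range (embed f)" using other[OF f] by blast
        with False show ?thesis
          unfolding \<open>act \<mu> (edg f * gst f) h y = _\<close> by (simp only: simp_thms if_False)
      qed
    qed
    then show "act \<mu> (vtx v - (\<Sum>e\<in>out_arcs E v. edg e * gst e)) h y = 0"
      using fin e by (simp add: act_diff act_sum act_generators y)
  qed
  have gst_edg: "letter_act \<mu> (Gst e) (letter_act \<mu> (Edg f) h) =
      (\<lambda>(u, m). if e = f \<and> u = head E e then h (u, m) else 0)"
    if "e \<in> arcs E" "f \<in> arcs E" for e f
  proof
    fix y :: "'v \<times> nat"
    obtain u m where y: "y = (u, m)" by (cases y)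
    have range: "embed e m \<in> range (embed f) \<longleftrightarrow> e = f" if "tail E e = tail E f"
      using that \<open>e \<in> arcs E\<close> \<open>f \<in> arcs E\<close> by (auto simp: embed_eq_iff)
    have inv: "inv_into UNIV (embed f) (embed f m) = m"
      using inj_embed[OF \<open>f \<in> arcs E\<close>] by (rule inv_f_f)
    show "letter_act \<mu> (Gst e) (letter_act \<mu> (Edg f) h) y =
        (case y of (u, m) \<Rightarrow> if e = f \<and> u = head E e then h (u, m) else 0)"
      using assms(1) range inv by (cases "e = f"; cases "u = head E e"; cases "tail E e = tail E f")
        (simp_all add: y del: image_iff)
  qed
  show ?thesis
    using assms(2) unfolding leavitt_relators_def
    by (elim UnE CollectE exE conjE; hypsubst)
      (use ck in \<open>simp_all add: act_diff act_mult act_generators gst_edg fun_eq_iff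
        del: letter_act.simps(2,3)\<close>, auto)
qed

text \<open>
  Hence the action factors through the Leavitt path algebra. This is the only source of
  nonvanishing results about that algebra.
\<close>

lemma act_ideal:
  assumes "\<mu> \<noteq> 0" "x \<in> leavitt_ideal E"
  shows "act \<mu> x h = (\<lambda>y. 0)"
  using assms(2)
  by (induction arbitrary: h rule: leavitt_ideal.induct)
    (simp_all add: act_relators[OF assms(1)] act_add act_mult poly_scale_eq act_scalar)

lemma act_cong:
  assumes "\<mu> \<noteq> 0" "x - y \<in> leavitt_ideal E"
  shows "act \<mu> x h = act \<mu> y h"
  using act_ideal[OF assms, of h] by (simp add: act_diff fun_eq_iff)

lemma vtx_notin_ideal: "vtx v \<notin> leavitt_ideal E"
proof
  assume "vtx v \<in> leavitt_ideal E"
  from fun_cong[OF act_ideal[OF _ this, of 1 "\<lambda>x. 1"], of "(v, 0)"] show False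
    by (simp add: act_generators)
qed

text \<open>
  For \<open>\<mu> = 1\<close> each letter restricts or transports a function without changing its values, apart
  from filling in zeros. A word therefore preserves the functions with values 0 and 1, and the
  values of a polynomial on such a function are sums over subsets of its coefficients.
\<close>

lemma act_finite_values:
  obtains S where "finite S" "\<And>h. range h \<subseteq> {0, 1} \<Longrightarrow> range (act 1 f h) \<subseteq> S"
proof
  let ?S = "(\<lambda>W. \<Sum>w\<in>W. Poly_Mapping.lookup f w) ` Pow (Poly_Mapping.keys f)"
  show "finite ?S" by simp
  have step: "range (letter_act 1 l k) \<subseteq> {0, 1}" if "range k \<subseteq> {0, 1}" for l k
  proof -
    have "k y = 0 \<or> k y = 1" for y
      using that by auto
    then have "letter_act 1 l k y \<in> {0, 1}" for y
      by (cases l; cases y) simp_all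
    then show ?thesis by blast
  qed
  fix h :: "'v \<times> nat \<Rightarrow> complex"
  assume h: "range h \<subseteq> {0, 1}"
  have word: "range (word_act 1 w h) \<subseteq> {0, 1}" for w
  proof -
    have "range (foldr (letter_act 1) ls h) \<subseteq> {0, 1}" for ls
      by (induction ls) (simp_all add: h step)
    then show ?thesis by (simp add: word_act_def)
  qed
  have "act 1 f h y \<in> ?S" for y
  proof -
    let ?W = "{w \<in> Poly_Mapping.keys f. word_act 1 w h y = 1}"
    have "word_act 1 w h y = 0 \<or> word_act 1 w h y = 1" for w
      using word[of w] by auto
    then have "act 1 f h y = (\<Sum>w\<in>Poly_Mapping.keys f. if w \<in> ?W then Poly_Mapping.lookup f w else 0)"
      unfolding act_def by (intro sum.cong) auto
    also have "\<dots> = (\<Sum>w\<in>?W. Poly_Mapping.lookup f w)"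
      by (simp add: sum.If_cases Int_def)
    finally show ?thesis by blast
  qed
  then show "range (act 1 f h) \<subseteq> ?S" by blast
qed

definition indicator_at :: "'v \<Rightarrow> 'v \<times> nat \<Rightarrow> complex" where
  "indicator_at v = (\<lambda>(u, m). if u = v then 1 else 0)"

end

section \<open>C*-seminorms\<close>

text \<open>
  The same facts about C*-seminorms are needed for each Cuntz-Krieger seminorm, for their supremum
  on the free algebra, and for the limit seminorm on Cauchy sequences.
\<close>

locale cstar_seminormed =
  fixes K :: "'r::ring_1 set" and \<kappa> :: "complex \<Rightarrow> 'r" and star :: "'r \<Rightarrow> 'r" and N :: "'r \<Rightarrow> real"
  assumes closed: "0 \<in> K" "\<And>x y. x \<in> K \<Longrightarrow> y \<in> K \<Longrightarrow> x + y \<in> K"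
      "\<And>x y. x \<in> K \<Longrightarrow> y \<in> K \<Longrightarrow> x * y \<in> K" "\<And>c x. x \<in> K \<Longrightarrow> \<kappa> c * x \<in> K"
      "\<And>x. x \<in> K \<Longrightarrow> star x \<in> K"
    and minus_one: "\<kappa> (- 1) = - 1"
    and star_star: "\<And>x. star (star x) = x"
    and nonneg: "\<And>x. x \<in> K \<Longrightarrow> 0 \<le> N x"
    and triangle: "\<And>x y. x \<in> K \<Longrightarrow> y \<in> K \<Longrightarrow> N (x + y) \<le> N x + N y"
    and scale: "\<And>c x. x \<in> K \<Longrightarrow> N (\<kappa> c * x) = cmod c * N x"
    and submult: "\<And>x y. x \<in> K \<Longrightarrow> y \<in> K \<Longrightarrow> N (x * y) \<le> N x * N y"
    and cstar: "\<And>x. x \<in> K \<Longrightarrow> N (star x * x) = (N x)\<^sup>2"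
begin

lemma uminus_closed: "x \<in> K \<Longrightarrow> - x \<in> K"
  using closed(4)[of x "-1"] by (simp add: minus_one)

lemma diff_closed: "x \<in> K \<Longrightarrow> y \<in> K \<Longrightarrow> x - y \<in> K"
  using closed(2)[of x "- y"] uminus_closed[of y] by simp

lemma sum_closed: "(\<And>i. i \<in> I \<Longrightarrow> f i \<in> K) \<Longrightarrow> sum f I \<in> K"
  by (induction I rule: infinite_finite_induct) (auto simp: closed)

lemmas all_closed = closed uminus_closed diff_closed sum_closed

lemma norm_zero: "N 0 = 0"
  using scale[of 0 0] closed(1) by simp

lemma norm_uminus: "x \<in> K \<Longrightarrow> N (- x) = N x"
  using scale[of x "-1"] by (simp add: minus_one)

lemma norm_minus_commute: "x \<in> K \<Longrightarrow> y \<in> K \<Longrightarrow> N (x - y) = N (y - x)"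
  using norm_uminus[of "x - y"] diff_closed[of x y] by simp

lemma norm_diff: "x \<in> K \<Longrightarrow> y \<in> K \<Longrightarrow> N (x - y) \<le> N x + N y"
  using triangle[of x "- y"] norm_uminus[of y] uminus_closed[of y] by simp

lemma norm_sum: "(\<And>i. i \<in> I \<Longrightarrow> f i \<in> K) \<Longrightarrow> N (sum f I) \<le> (\<Sum>i\<in>I. N (f i))"
proof (induction I rule: infinite_finite_induct)
  case (insert i I)
  then show ?case
    using triangle[of "f i" "sum f I"] sum_closed[of I f] by auto
qed (simp_all add: norm_zero)

lemma norm_abs_diff:
  assumes "x \<in> K" "y \<in> K"
  shows "\<bar>N x - N y\<bar> \<le> N (x - y)"
  using triangle[of "x - y" y] triangle[of "y - x" x] norm_minus_commute[OF assms] assms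
  by (auto simp: diff_closed)

lemma norm_cong: "x \<in> K \<Longrightarrow> y \<in> K \<Longrightarrow> N (x - y) = 0 \<Longrightarrow> N x = N y"
  using norm_abs_diff[of x y] by simp

text \<open>
  The inequality in one direction is the C*-identity divided by the norm of x; exchanging x and its
  adjoint gives the other.
\<close>

lemma norm_star: 
  assumes "x \<in> K"
  shows "N (star x) = N x"
proof -
  have le: "N x \<le> N (star x)" if "x \<in> K" for x
  proof (cases "N x = 0")
    case False
    then have pos: "0 < N x" using nonneg[OF that] by simp
    have "(N x)\<^sup>2 \<le> N (star x) * N x"
      using submult[of "star x" x] that by (simp add: closed flip: cstar)
    then show ?thesis using pos by (simp add: power2_eq_square)
  qed (use that in \<open>simp add: nonneg closed\<close>)
  show ?thesis
    using le[OF assms] le[of "star x"] assms by (simp add: closed star_star)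
qed

lemma projection_norm:
  assumes "p \<in> K" "N (star p * p - p) = 0"
  shows "N p = 0 \<or> N p = 1"
proof -
  have "(N p)\<^sup>2 = N p"
    using norm_cong[of "star p * p" p] assms by (simp add: closed cstar)
  then show ?thesis by (simp add: power2_eq_square)
qed

lemma partial_isometry_norm:
  assumes "x \<in> K" "p \<in> K" "N (star x * x - p) = 0" "N (star p * p - p) = 0"
  shows "N x \<le> 1"
proof -
  have "(N x)\<^sup>2 = N p"
    using norm_cong[of "star x * x" p] assms by (simp add: closed cstar)
  then show ?thesis
    using projection_norm[OF assms(2,4)] power2_le_imp_le[of "N x" 1] by auto
qed

lemma null_mult:
  assumes "x \<in> K" "y \<in> K" "N x = 0 \<or> N y = 0"
  shows "N (x * y) = 0"
  using submult[OF assms(1,2)] nonneg[of "x * y"] assms by (auto simp: closed)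

lemma null_add:
  assumes "x \<in> K" "y \<in> K" "N x = 0" "N y = 0"
  shows "N (x + y) = 0"
  using triangle[OF assms(1,2)] nonneg[of "x + y"] assms by (auto simp: closed)

end

lemma cstar_seminormed_free:
  assumes "cstar_seminorm (free_star_algebra E) N"
  shows "cstar_seminormed (free_carrier E) scalar poly_star N"
  using assms
  by unfold_locales
    (auto simp: cstar_seminorm_def free_star_algebra_def poly_scale_eq single_uminus)

lemma cuntz_krieger_generators:
  assumes "wf_digraph E" and N: "N \<in> cuntz_krieger_seminorms E"
  shows "v \<in> verts E \<Longrightarrow> N (vtx v) \<le> 1" "e \<in> arcs E \<Longrightarrow> N (edg e) \<le> 1" "e \<in> arcs E \<Longrightarrow> N (gst e) \<le> 1"
proof -
  interpret wf_digraph E by fact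
  interpret N: cstar_seminormed "free_carrier E" scalar poly_star N
    using N by (intro cstar_seminormed_free) (simp add: cuntz_krieger_seminorms_def)
  have null: "N x = 0" if "x \<in> cuntz_krieger_relators E" for x
    using that N by (auto simp: cuntz_krieger_seminorms_def)
  have vtx: "N (vtx v * vtx v - vtx v) = 0" if "v \<in> verts E" for v
    by (rule null) (use that in \<open>auto simp: cuntz_krieger_relators_def\<close>)
  show "N (vtx v) \<le> 1" if "v \<in> verts E"
    using N.projection_norm[of "vtx v"] vtx that by auto
  assume e: "e \<in> arcs E"
  have "N (gst e * edg e - vtx (head E e)) = 0"
    by (rule null) (use e in \<open>auto simp: cuntz_krieger_relators_def\<close>)
  then show "N (edg e) \<le> 1"
    using N.partial_isometry_norm[of "edg e" "vtx (head E e)"] vtx[of "head E e"] e by auto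
  then show "N (gst e) \<le> 1"
    using N.norm_star[of "edg e"] e by simp
qed

text \<open>
  This makes the supremum that defines the universal seminorm a real number: the generators have
  norm at most 1, and the bound propagates through sums and products.
\<close>

lemma cuntz_krieger_bounded:
  assumes "wf_digraph E" "x \<in> free_carrier E"
  shows "\<exists>b. \<forall>N\<in>cuntz_krieger_seminorms E. N x \<le> b"
  using assms(2)
proof (induction rule: free_carrier_induct)
  case (vtx v)
  then show ?case using cuntz_krieger_generators(1)[OF assms(1)] by blast
next
  case (edg e)
  then show ?case using cuntz_krieger_generators(2)[OF assms(1)] by blast
next
  case (gst e)
  then show ?case using cuntz_krieger_generators(3)[OF assms(1)] by blast
next
  case (mult f g)
  then obtain b c where bc: "\<forall>N\<in>cuntz_krieger_seminorms E. N f \<le> b"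
      "\<forall>N\<in>cuntz_krieger_seminorms E. N g \<le> c" by blast
  have "N (f * g) \<le> b * c" if "N \<in> cuntz_krieger_seminorms E" for N
  proof -
    interpret N: cstar_seminormed "free_carrier E" scalar poly_star N
      using that by (intro cstar_seminormed_free) (simp add: cuntz_krieger_seminorms_def)
    have "N (f * g) \<le> N f * N g" by (rule N.submult) fact+
    also have "\<dots> \<le> b * c"
      using bc that N.nonneg[of f] N.nonneg[of g] mult.hyps
      by (intro mult_mono) (auto intro: order_trans[OF N.nonneg])
    finally show ?thesis .
  qed
  then show ?case by blast
next
  case (scalar c f)
  then obtain b where b: "\<forall>N\<in>cuntz_krieger_seminorms E. N f \<le> b" by blast
  have "N (scalar c * f) \<le> cmod c * b" if "N \<in> cuntz_krieger_seminorms E" for N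
  proof -
    interpret N: cstar_seminormed "free_carrier E" scalar poly_star N
      using that by (intro cstar_seminormed_free) (simp add: cuntz_krieger_seminorms_def)
    show ?thesis
      using b that scalar.hyps by (simp add: N.scale mult_left_mono)
  qed
  then show ?case by blast
next
  case zero
  have "N 0 \<le> 0" if "N \<in> cuntz_krieger_seminorms E" for N
  proof -
    interpret N: cstar_seminormed "free_carrier E" scalar poly_star N
      using that by (intro cstar_seminormed_free) (simp add: cuntz_krieger_seminorms_def)
    show ?thesis by (simp add: N.norm_zero)
  qed
  then show ?case by blast
next
  case (add f g)
  then obtain b c where bc: "\<forall>N\<in>cuntz_krieger_seminorms E. N f \<le> b"
      "\<forall>N\<in>cuntz_krieger_seminorms E. N g \<le> c" by blast
  have "N (f + g) \<le> b + c" if "N \<in> cuntz_krieger_seminorms E" for N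
  proof -
    interpret N: cstar_seminormed "free_carrier E" scalar poly_star N
      using that by (intro cstar_seminormed_free) (simp add: cuntz_krieger_seminorms_def)
    have "N (f + g) \<le> N f + N g" by (rule N.triangle) fact+
    also have "\<dots> \<le> b + c" using bc that by (intro add_mono) auto
    finally show ?thesis .
  qed
  then show ?case by blast
qed

lemma zero_seminorm: "(\<lambda>x. 0) \<in> cuntz_krieger_seminorms E"
  by (simp add: cuntz_krieger_seminorms_def cstar_seminorm_def)

lemma cstar_seminormed_universal:
  assumes "wf_digraph E"
  shows "cstar_seminormed (free_carrier E) scalar poly_star (universal_seminorm E)"
proof -
  let ?S = "cuntz_krieger_seminorms E" and ?U = "universal_seminorm E"
  have N: "cstar_seminormed (free_carrier E) scalar poly_star N" if "N \<in> ?S" for N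
    using that by (intro cstar_seminormed_free) (simp add: cuntz_krieger_seminorms_def)
  have upper: "N x \<le> ?U x" if "N \<in> ?S" "x \<in> free_carrier E" for N x
    unfolding universal_seminorm_def
    using cuntz_krieger_bounded[OF assms that(2)] that(1)
    by (intro cSUP_upper) (auto simp: bdd_above_def)
  have least: "?U x \<le> b" if "\<And>N. N \<in> ?S \<Longrightarrow> N x \<le> b" for x b
    unfolding universal_seminorm_def using that zero_seminorm by (intro cSUP_least) auto
  have nonneg: "0 \<le> ?U x" if "x \<in> free_carrier E" for x
    using upper[OF zero_seminorm that] .
  show ?thesis
  proof unfold_locales
    fix x y :: "('a, 'b) ncpoly"
    assume xy: "x \<in> free_carrier E" "y \<in> free_carrier E"
    show "?U (x + y) \<le> ?U x + ?U y"
    proof (rule least)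
      fix N assume S: "N \<in> ?S"
      show "N (x + y) \<le> ?U x + ?U y"
        using cstar_seminormed.triangle[OF N[OF S] xy] upper[OF S xy(1)] upper[OF S xy(2)] by linarith
    qed
    show "?U (x * y) \<le> ?U x * ?U y"
    proof (rule least)
      fix N assume S: "N \<in> ?S"
      have "N (x * y) \<le> N x * N y"
        using cstar_seminormed.submult[OF N xy] S .
      also have "\<dots> \<le> ?U x * ?U y"
        using upper[OF S] xy nonneg cstar_seminormed.nonneg[OF N[OF S]] by (intro mult_mono) auto
      finally show "N (x * y) \<le> ?U x * ?U y" .
    qed
  next
    fix c and x :: "('a, 'b) ncpoly"
    assume x: "x \<in> free_carrier E"
    have le: "?U (scalar c * x) \<le> cmod c * ?U x" if "x \<in> free_carrier E" for c x
      using that upper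
      by (intro least) (simp add: cstar_seminormed.scale[OF N] mult_left_mono)
    show "?U (scalar c * x) = cmod c * ?U x"
    proof (cases "c = 0")
      case True
      have "?U 0 \<le> 0" by (rule least) (simp add: cstar_seminormed.norm_zero[OF N])
      then have "?U 0 = 0" using nonneg[of 0] by simp
      then show ?thesis using True by simp
    next
      case False
      have "?U (scalar (1 / c) * (scalar c * x)) \<le> cmod (1 / c) * ?U (scalar c * x)"
        using x by (intro le) auto
      also have "scalar (1 / c) * (scalar c * x) = x"
        using False by (simp add: mult_single flip: mult.assoc)
      finally have "cmod c * ?U x \<le> ?U (scalar c * x)"
        using False by (simp add: norm_divide field_simps)
      then show ?thesis using le[OF x, of c] by simp
    qed
  next
    fix x :: "('a, 'b) ncpoly"
    assume x: "x \<in> free_carrier E"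
    show "?U (poly_star x * x) = (?U x)\<^sup>2"
    proof (rule antisym)
      show "?U (poly_star x * x) \<le> (?U x)\<^sup>2"
        using x upper cstar_seminormed.nonneg[OF N]
        by (intro least) (simp add: cstar_seminormed.cstar[OF N] power_mono)
      have "N x \<le> sqrt (?U (poly_star x * x))" if "N \<in> ?S" for N
        using x upper[OF that, of "poly_star x * x"] 
        by (intro real_le_rsqrt) (simp add: cstar_seminormed.cstar[OF N[OF that]])
      then have "?U x \<le> sqrt (?U (poly_star x * x))" by (rule least)
      then have "(?U x)\<^sup>2 \<le> (sqrt (?U (poly_star x * x)))\<^sup>2"
        using nonneg[OF x] by (intro power_mono)
      then show "(?U x)\<^sup>2 \<le> ?U (poly_star x * x)"
        using nonneg[of "poly_star x * x"] x by simp
    qed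
  qed (use nonneg in \<open>auto simp: single_uminus\<close>)
qed

section \<open>Cauchy sequences\<close>

abbreviation seq_scalar :: "complex \<Rightarrow> nat \<Rightarrow> ('v, 'e) ncpoly" where
  "seq_scalar c \<equiv> (\<lambda>n. scalar c)"

abbreviation seq_star :: "(nat \<Rightarrow> ('v, 'e) ncpoly) \<Rightarrow> nat \<Rightarrow> ('v, 'e) ncpoly" where
  "seq_star X \<equiv> (\<lambda>n. poly_star (X n))"

definition seq_norm :: "('v, 'e) pre_digraph \<Rightarrow> (nat \<Rightarrow> ('v, 'e) ncpoly) \<Rightarrow> real" where
  "seq_norm E X = lim (\<lambda>n. universal_seminorm E (X n))"

definition null_sequences :: "('v, 'e) pre_digraph \<Rightarrow> (nat \<Rightarrow> ('v, 'e) ncpoly) set" where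
  "null_sequences E = {X \<in> cauchy_sequences E. seq_norm E X = 0}"

context wf_digraph
begin

abbreviation "U \<equiv> universal_seminorm G"

sublocale U: cstar_seminormed "free_carrier G" scalar poly_star "universal_seminorm G"
  by (rule cstar_seminormed_universal) unfold_locales

lemma cauchy_free: "X \<in> cauchy_sequences G \<Longrightarrow> X n \<in> free_carrier G"
  by (simp add: cauchy_sequences_def)

lemma cauchy_sequencesD:
  "X \<in> cauchy_sequences G \<Longrightarrow> 0 < e \<Longrightarrow> \<exists>M. \<forall>m\<ge>M. \<forall>n\<ge>M. U (X m - X n) < e"
  by (simp add: cauchy_sequences_def)

lemma seq_norm_limit:
  assumes "X \<in> cauchy_sequences G"
  shows "(\<lambda>n. U (X n)) \<longlonglongrightarrow> seq_norm G X"
proof -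
  have "Cauchy (\<lambda>n. U (X n))"
  proof (rule metric_CauchyI)
    fix e :: real assume "0 < e"
    from cauchy_sequencesD[OF assms this] obtain M
      where M: "\<forall>m\<ge>M. \<forall>n\<ge>M. U (X m - X n) < e" ..
    have "dist (U (X m)) (U (X n)) < e" if "m \<ge> M" "n \<ge> M" for m n
      using M[rule_format, OF that] U.norm_abs_diff[of "X m" "X n"] cauchy_free[OF assms]
      by (simp add: dist_real_def)
    then show "\<exists>M. \<forall>m\<ge>M. \<forall>n\<ge>M. dist (U (X m)) (U (X n)) < e" by blast
  qed
  then show ?thesis
    by (simp add: seq_norm_def Cauchy_convergent_iff convergent_LIMSEQ_iff)
qed

lemma seq_norm_eqI:
  "X \<in> cauchy_sequences G \<Longrightarrow> (\<lambda>n. U (X n)) \<longlonglongrightarrow> a \<Longrightarrow> seq_norm G X = a"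
  using seq_norm_limit LIMSEQ_unique by blast

lemma cauchy_sequencesI:
  assumes "\<And>n. X n \<in> free_carrier G"
    and "\<And>e. 0 < e \<Longrightarrow> \<exists>M. \<forall>m\<ge>M. \<forall>n\<ge>M. U (X m - X n) < e"
  shows "X \<in> cauchy_sequences G"
  using assms by (simp add: cauchy_sequences_def)

lemma cauchy_const: "x \<in> free_carrier G \<Longrightarrow> (\<lambda>n. x) \<in> cauchy_sequences G"
  by (rule cauchy_sequencesI) (simp_all add: U.norm_zero)

lemma seq_norm_const: "x \<in> free_carrier G \<Longrightarrow> seq_norm G (\<lambda>n. x) = U x"
  by (rule seq_norm_eqI) (simp_all add: cauchy_const)

lemma cauchy_add:
  assumes "X \<in> cauchy_sequences G" "Y \<in> cauchy_sequences G"
  shows "X + Y \<in> cauchy_sequences G"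
proof (rule cauchy_sequencesI)
  fix e :: real assume "0 < e"
  then have "0 < e / 2" by simp
  from cauchy_sequencesD[OF assms(1) this] obtain M
      where M: "\<forall>m\<ge>M. \<forall>n\<ge>M. U (X m - X n) < e / 2" ..
  from cauchy_sequencesD[OF assms(2) \<open>0 < e / 2\<close>] obtain M'
      where M': "\<forall>m\<ge>M'. \<forall>n\<ge>M'. U (Y m - Y n) < e / 2" ..
  have "U ((X + Y) m - (X + Y) n) < e" if "m \<ge> max M M'" "n \<ge> max M M'" for m n
  proof -
    have "U ((X m - X n) + (Y m - Y n)) \<le> U (X m - X n) + U (Y m - Y n)"
      using assms by (intro U.triangle) (auto simp: cauchy_free)
    also have "\<dots> < e" using M[rule_format, of m n] M'[rule_format, of m n] that by simp
    finally show ?thesis by (simp add: algebra_simps)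
  qed
  then show "\<exists>M. \<forall>m\<ge>M. \<forall>n\<ge>M. U ((X + Y) m - (X + Y) n) < e" by blast
qed (use assms in \<open>simp add: cauchy_free\<close>)

lemma cauchy_bounded:
  assumes "X \<in> cauchy_sequences G"
  obtains b where "b > 0" "\<And>n. U (X n) \<le> b"
proof -
  have "Bseq (\<lambda>n. U (X n))"
    using seq_norm_limit[OF assms] convergentI convergent_imp_Bseq by blast
  then obtain b where "b > 0" "\<forall>n. norm (U (X n)) \<le> b" by (rule BseqE)
  then show ?thesis
    by (intro that[of b]) (auto simp: abs_le_iff)
qed

lemma cauchy_mult:
  assumes "X \<in> cauchy_sequences G" "Y \<in> cauchy_sequences G"
  shows "X * Y \<in> cauchy_sequences G"
proof (rule cauchy_sequencesI)
  fix e :: real assume e: "0 < e"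
  obtain a where a: "a > 0" "\<And>n. U (X n) \<le> a" by (rule cauchy_bounded[OF assms(1)]) blast
  obtain b where b: "b > 0" "\<And>n. U (Y n) \<le> b" by (rule cauchy_bounded[OF assms(2)]) blast
  have pos: "0 < e / (2 * b)" "0 < e / (2 * a)" using e a b by simp_all
  from cauchy_sequencesD[OF assms(1) pos(1)] obtain M
      where M: "\<forall>m\<ge>M. \<forall>n\<ge>M. U (X m - X n) < e / (2 * b)" ..
  from cauchy_sequencesD[OF assms(2) pos(2)] obtain M'
      where M': "\<forall>m\<ge>M'. \<forall>n\<ge>M'. U (Y m - Y n) < e / (2 * a)" ..
  have "U ((X * Y) m - (X * Y) n) < e" if "m \<ge> max M M'" "n \<ge> max M M'" for m n
  proof -
    note [simp] = cauchy_free[OF assms(1)] cauchy_free[OF assms(2)]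
    have "(X * Y) m - (X * Y) n = X m * (Y m - Y n) + (X m - X n) * Y n"
      by (simp add: algebra_simps)
    also have "U \<dots> \<le> U (X m * (Y m - Y n)) + U ((X m - X n) * Y n)"
      by (intro U.triangle) auto
    also have "\<dots> \<le> U (X m) * U (Y m - Y n) + U (X m - X n) * U (Y n)"
      by (intro add_mono U.submult) auto
    also have "\<dots> \<le> a * U (Y m - Y n) + U (X m - X n) * b"
      using a b by (intro add_mono mult_mono) (auto simp: U.nonneg)
    also have "\<dots> < a * (e / (2 * a)) + e / (2 * b) * b"
      using a b M M' that by (intro add_strict_mono mult_strict_left_mono mult_strict_right_mono) auto
    also have "\<dots> = e" using a b by simp
    finally show ?thesis .
  qed
  then show "\<exists>M. \<forall>m\<ge>M. \<forall>n\<ge>M. U ((X * Y) m - (X * Y) n) < e" by blast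
qed (use assms in \<open>simp add: cauchy_free\<close>)

lemma cauchy_scalar:
  assumes "X \<in> cauchy_sequences G"
  shows "seq_scalar c * X \<in> cauchy_sequences G"
proof (rule cauchy_sequencesI)
  fix e :: real assume e: "0 < e"
  have pos: "e / (cmod c + 1) > 0" using e by (simp add: add_nonneg_pos)
  from cauchy_sequencesD[OF assms pos] obtain M
      where M: "\<forall>m\<ge>M. \<forall>n\<ge>M. U (X m - X n) < e / (cmod c + 1)" ..
  have "U ((seq_scalar c * X) m - (seq_scalar c * X) n) < e" if "m \<ge> M" "n \<ge> M" for m n
  proof -
    have "U (scalar c * (X m - X n)) = cmod c * U (X m - X n)"
      using assms by (intro U.scale) (auto simp: cauchy_free)
    also have "\<dots> \<le> (cmod c + 1) * U (X m - X n)"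
      using assms by (intro mult_right_mono U.nonneg) (auto simp: cauchy_free)
    also have "\<dots> < (cmod c + 1) * (e / (cmod c + 1))"
      using M[rule_format, OF that] by (intro mult_strict_left_mono) (auto simp: add_nonneg_pos)
    also have "\<dots> = e"
      using pos e by (metis div_by_0 less_irrefl nonzero_mult_div_cancel_left times_divide_eq_right)
    finally show ?thesis by (simp add: algebra_simps)
  qed
  then show "\<exists>M. \<forall>m\<ge>M. \<forall>n\<ge>M. U ((seq_scalar c * X) m - (seq_scalar c * X) n) < e" by blast
qed (use assms in \<open>simp add: cauchy_free\<close>)

lemma cauchy_star:
  assumes "X \<in> cauchy_sequences G"
  shows "seq_star X \<in> cauchy_sequences G"
proof -
  have "U (poly_star (X m) - poly_star (X n)) = U (X m - X n)" for m n
    using U.norm_star[of "X m - X n"] assms by (simp add: cauchy_free)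
  then show ?thesis
    using assms by (simp add: cauchy_sequences_def)
qed

sublocale C: cstar_seminormed "cauchy_sequences G" seq_scalar seq_star "seq_norm G"
proof
  fix X Y assume X: "X \<in> cauchy_sequences G" and Y: "Y \<in> cauchy_sequences G"
  note [simp] = cauchy_free[OF X] cauchy_free[OF Y]
  show "X + Y \<in> cauchy_sequences G" "X * Y \<in> cauchy_sequences G"
    using X Y by (simp_all add: cauchy_add cauchy_mult)
  show "seq_norm G (X + Y) \<le> seq_norm G X + seq_norm G Y"
    by (rule LIMSEQ_le[OF seq_norm_limit tendsto_add[OF seq_norm_limit[OF X] seq_norm_limit[OF Y]]])
      (auto simp: cauchy_add X Y U.triangle)
  show "seq_norm G (X * Y) \<le> seq_norm G X * seq_norm G Y"
    by (rule LIMSEQ_le[OF seq_norm_limit tendsto_mult[OF seq_norm_limit[OF X] seq_norm_limit[OF Y]]])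
      (auto simp: cauchy_mult X Y U.submult)
next
  fix c and X assume X: "X \<in> cauchy_sequences G"
  note [simp] = cauchy_free[OF X]
  show "seq_norm G (seq_scalar c * X) = cmod c * seq_norm G X"
    using tendsto_mult_left[OF seq_norm_limit[OF X], of "cmod c"]
    by (intro seq_norm_eqI cauchy_scalar X) (simp add: U.scale)
next
  fix X assume X: "X \<in> cauchy_sequences G"
  note [simp] = cauchy_free[OF X]
  show "0 \<le> seq_norm G X"
    by (rule LIMSEQ_le_const[OF seq_norm_limit[OF X]]) (auto simp: U.nonneg)
  show "seq_norm G (seq_star X * X) = (seq_norm G X)\<^sup>2"
    using tendsto_power[OF seq_norm_limit[OF X], of 2]
    by (intro seq_norm_eqI cauchy_mult cauchy_star X) (simp add: U.cstar)
qed (simp_all add: cauchy_scalar cauchy_star cauchy_const fun_eq_iff single_uminus zero_fun_def)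

lemma null_limit_iff:
  "X \<in> cauchy_sequences G \<Longrightarrow> (\<lambda>n. U (X n)) \<longlonglongrightarrow> 0 \<longleftrightarrow> seq_norm G X = 0"
  using seq_norm_limit[of X] seq_norm_eqI[of X 0] by auto

text \<open>
  A diagonal argument: replacing each \<open>Z N\<close> by one of its own late entries changes it by less than
  \<open>1 / (N + 1)\<close>, and the sequence of these entries is the limit.
\<close>

lemma cauchy_complete:
  assumes Z: "\<And>N. Z N \<in> cauchy_sequences G"
    and cauchy: "\<And>e. 0 < e \<Longrightarrow> \<exists>K. \<forall>M\<ge>K. \<forall>N\<ge>K. seq_norm G (Z M - Z N) < e"
  obtains B where "B \<in> cauchy_sequences G" "(\<lambda>N. seq_norm G (B - Z N)) \<longlonglongrightarrow> 0"
proof -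
  have "\<exists>k. \<forall>i\<ge>k. U (Z N i - Z N k) < 1 / real (Suc N)" for N
    using cauchy_sequencesD[OF Z, of "1 / real (Suc N)" N] by auto
  then obtain k where k: "\<And>N i. i \<ge> k N \<Longrightarrow> U (Z N i - Z N (k N)) < 1 / real (Suc N)"
    by metis
  define B where "B = (\<lambda>N. Z N (k N))"
  have B_free [simp]: "B N \<in> free_carrier G" for N
    using cauchy_free[OF Z] by (simp add: B_def)
  have closed: "Z N \<in> cauchy_sequences G" "(\<lambda>n. B N) \<in> cauchy_sequences G" for N
    using Z by (auto simp: cauchy_const)
  have near: "seq_norm G (Z N - (\<lambda>n. B N)) \<le> 1 / real (Suc N)" for N
  proof (rule LIMSEQ_le_const2[OF seq_norm_limit])
    show "\<exists>K. \<forall>i\<ge>K. U ((Z N - (\<lambda>n. B N)) i) \<le> 1 / real (Suc N)"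
      using k[of N] by (intro exI[of _ "k N"]) (auto simp: B_def fun_diff_def intro: less_imp_le)
  qed (simp add: C.diff_closed closed)
  have B_diff: "U (B M - B N) \<le> 1 / real (Suc M) + seq_norm G (Z M - Z N) + 1 / real (Suc N)"
    for M N
  proof -
    let ?b = "\<lambda>N n :: nat. B N"
    have "U (B M - B N) = seq_norm G (?b M - ?b N)"
      by (simp add: fun_diff_def seq_norm_const)
    also have "?b M - ?b N = (?b M - Z M) + ((Z M - Z N) + (Z N - ?b N))"
      by (simp add: algebra_simps)
    also have "seq_norm G \<dots> \<le> seq_norm G (?b M - Z M) +
        (seq_norm G (Z M - Z N) + seq_norm G (Z N - ?b N))"
      by (intro order_trans[OF C.triangle] add_mono order_refl C.triangle C.all_closed closed)
    also have "seq_norm G (?b M - Z M) = seq_norm G (Z M - ?b M)"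
      by (intro C.norm_minus_commute closed)
    finally show ?thesis using near[of M] near[of N] by linarith
  qed
  have B: "B \<in> cauchy_sequences G"
  proof (rule cauchy_sequencesI)
    fix e :: real assume e: "0 < e"
    obtain K where K: "\<And>M N. M \<ge> K \<Longrightarrow> N \<ge> K \<Longrightarrow> seq_norm G (Z M - Z N) < e / 3"
      using cauchy[of "e / 3"] e by auto
    obtain K' where K': "1 / real (Suc K') < e / 3"
      using e nat_approx_posE[of "e / 3"] by auto
    have small: "1 / real (Suc M) < e / 3" if "M \<ge> K'" for M
      using that by (intro le_less_trans[OF _ K'] divide_left_mono) auto
    have "U (B M - B N) < e" if "M \<ge> max K K'" "N \<ge> max K K'" for M N
      using B_diff[of M N] K[of M N] small[of M] small[of N] that by simp
    then show "\<exists>K. \<forall>M\<ge>K. \<forall>N\<ge>K. U (B M - B N) < e" by blast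
  qed simp
  have "(\<lambda>N. seq_norm G (B - Z N)) \<longlonglongrightarrow> 0"
  proof (rule LIMSEQ_I)
    fix e :: real assume e: "0 < e"
    from e have "0 < e / 3" by simp
    from cauchy_sequencesD[OF B this] obtain K
      where K: "\<forall>M\<ge>K. \<forall>N\<ge>K. U (B M - B N) < e / 3" ..
    obtain K' where K': "1 / real (Suc K') < e / 3"
      using e nat_approx_posE[of "e / 3"] by auto
    have "norm (seq_norm G (B - Z N) - 0) < e" if "N \<ge> max K K'" for N
    proof -
      have BN: "B - (\<lambda>n. B N) \<in> cauchy_sequences G"
        by (intro C.diff_closed B closed)
      have "seq_norm G (B - (\<lambda>n. B N)) \<le> e / 3"
      proof (rule LIMSEQ_le_const2[OF seq_norm_limit[OF BN]])
        have "U ((B - (\<lambda>n. B N)) M) \<le> e / 3" if "M \<ge> K" for M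
          using K[rule_format, of M N] that \<open>N \<ge> max K K'\<close> by simp
        then show "\<exists>K. \<forall>M\<ge>K. U ((B - (\<lambda>n. B N)) M) \<le> e / 3" by blast
      qed
      moreover have "seq_norm G ((\<lambda>n. B N) - Z N) < e / 3"
      proof -
        have "1 / real (Suc N) \<le> 1 / real (Suc K')"
          using that by (intro divide_left_mono) auto
        then show ?thesis
          using near[of N] C.norm_minus_commute[OF closed(2)[of N] closed(1)[of N]] K' by linarith
      qed
      moreover have "seq_norm G ((B - (\<lambda>n. B N)) + ((\<lambda>n. B N) - Z N)) \<le>
          seq_norm G (B - (\<lambda>n. B N)) + seq_norm G ((\<lambda>n. B N) - Z N)"
        by (intro C.triangle C.all_closed B closed)
      moreover have "0 \<le> seq_norm G (B - Z N)"
        by (intro C.nonneg C.all_closed B closed)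
      ultimately show ?thesis using e by simp
    qed
    then show "\<exists>K. \<forall>N\<ge>K. norm (seq_norm G (B - Z N) - 0) < e" by blast
  qed
  with B show ?thesis by (rule that)
qed

lemma star_ideal_null: "star_ideal (cauchy_star_algebra G) seq_scalar (null_sequences G)"
  by unfold_locales
    (auto simp: cauchy_star_algebra_def null_sequences_def fun_eq_iff poly_scale_eq
      C.all_closed C.norm_zero C.null_add C.null_mult C.scale C.norm_star single_add mult_single)

end

section \<open>Paths modulo the Leavitt ideal\<close>

context wf_digraph
begin

sublocale L: star_ideal "free_star_algebra G" scalar "leavitt_ideal G"
  by (rule star_ideal_leavitt) unfold_locales

sublocale A: star_ideal "cauchy_star_algebra G" seq_scalar "null_sequences G"
  by (rule star_ideal_null)

lemma free_star_algebra_simps [simp]: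
  "carrier (free_star_algebra G) = free_carrier G" "sa_star (free_star_algebra G) = poly_star"
  by (simp_all add: free_star_algebra_def)

lemma cauchy_star_algebra_simps [simp]:
  "carrier (cauchy_star_algebra G) = cauchy_sequences G" "sa_star (cauchy_star_algebra G) = seq_star"
  by (simp_all add: cauchy_star_algebra_def)

lemma leavitt_cong_eq: "leavitt_cong G = L.cong"
  by (simp add: leavitt_cong_def L.cong_def)

lemma leavitt_path_algebra_eq: "leavitt_path_algebra G = L.Q"
  by (simp add: leavitt_path_algebra_def leavitt_cong_eq)

lemma null_cong_eq: "null_cong G = A.cong"
proof -
  have "(\<lambda>n. U (X n - Y n)) \<longlonglongrightarrow> 0 \<longleftrightarrow> X - Y \<in> null_sequences G"
    if "X \<in> cauchy_sequences G" "Y \<in> cauchy_sequences G" for X Y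
    using null_limit_iff[of "X - Y"] C.diff_closed[OF that] by (simp add: null_sequences_def)
  then show ?thesis
    by (auto simp: null_cong_def A.cong_def)
qed

lemma graph_cstar_algebra_eq: "graph_cstar_algebra G = A.Q"
  by (simp add: graph_cstar_algebra_def null_cong_eq)

text \<open>
  Equality in the Leavitt path algebra, expressed on representatives.
\<close>

definition eqJ :: "('a, 'b) ncpoly \<Rightarrow> ('a, 'b) ncpoly \<Rightarrow> bool" (infix \<open>\<simeq>\<close> 50) where
  "x \<simeq> y \<longleftrightarrow> x - y \<in> leavitt_ideal G"

lemma eqJ_refl [simp, intro]: "x \<simeq> x"
  by (simp add: eqJ_def L.ideal)

lemma eqJ_sym: "x \<simeq> y \<Longrightarrow> y \<simeq> x"
  using L.ideal_minus_commute by (simp add: eqJ_def)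

lemma eqJ_trans [trans]: "x \<simeq> y \<Longrightarrow> y \<simeq> z \<Longrightarrow> x \<simeq> z"
  using L.ideal(3)[of "x - y" "y - z"] by (simp add: eqJ_def)

lemma eqJ_add: "x \<simeq> x' \<Longrightarrow> y \<simeq> y' \<Longrightarrow> x + y \<simeq> x' + y'"
  using L.ideal(3)[of "x - x'" "y - y'"] by (simp add: eqJ_def algebra_simps)

lemma eqJ_diff: "x \<simeq> x' \<Longrightarrow> y \<simeq> y' \<Longrightarrow> x - y \<simeq> x' - y'"
  using L.ideal_diff[of "x - x'" "y - y'"] by (simp add: eqJ_def algebra_simps)

lemma eqJ_sum: "(\<And>i. i \<in> I \<Longrightarrow> f i \<simeq> g i) \<Longrightarrow> sum f I \<simeq> sum g I"
  using L.ideal_sum[of I "\<lambda>i. f i - g i"] by (simp add: eqJ_def sum_subtractf)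

lemma eqJ_left: "a \<in> free_carrier G \<Longrightarrow> x \<simeq> y \<Longrightarrow> a * x \<simeq> a * y"
  using L.ideal(5)[of a "x - y"] by (simp add: eqJ_def right_diff_distrib)

lemma eqJ_right: "a \<in> free_carrier G \<Longrightarrow> x \<simeq> y \<Longrightarrow> x * a \<simeq> y * a"
  using L.ideal(6)[of a "x - y"] by (simp add: eqJ_def left_diff_distrib)

lemma eqJ_scalar: "x \<simeq> y \<Longrightarrow> scalar c * x \<simeq> scalar c * y"
  using L.ideal(4)[of "x - y" c] by (simp add: eqJ_def right_diff_distrib)

lemma eqJ_star: "x \<simeq> y \<Longrightarrow> poly_star x \<simeq> poly_star y"
  using L.ideal(7)[of "x - y"] by (simp add: eqJ_def)

lemma eqJ_zero_iff: "x \<simeq> 0 \<longleftrightarrow> x \<in> leavitt_ideal G"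
  by (simp add: eqJ_def)

lemma eqJ_relations:
  "v \<in> verts G \<Longrightarrow> vtx v * vtx v \<simeq> vtx v"
  "v \<in> verts G \<Longrightarrow> w \<in> verts G \<Longrightarrow> v \<noteq> w \<Longrightarrow> vtx v * vtx w \<simeq> 0"
  "e \<in> arcs G \<Longrightarrow> vtx (tail G e) * edg e \<simeq> edg e"
  "e \<in> arcs G \<Longrightarrow> edg e * vtx (head G e) \<simeq> edg e"
  "e \<in> arcs G \<Longrightarrow> vtx (head G e) * gst e \<simeq> gst e"
  "e \<in> arcs G \<Longrightarrow> gst e * vtx (tail G e) \<simeq> gst e"
  "e \<in> arcs G \<Longrightarrow> gst e * edg e \<simeq> vtx (head G e)"
  "e \<in> arcs G \<Longrightarrow> f \<in> arcs G \<Longrightarrow> e \<noteq> f \<Longrightarrow> gst e * edg f \<simeq> 0"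
  "v \<in> regular_verts G \<Longrightarrow> vtx v \<simeq> (\<Sum>e\<in>out_arcs G v. edg e * gst e)"
  by (simp_all add: eqJ_def leavitt_ideal.base leavitt_relatorsI)

primrec path_poly :: "'a \<Rightarrow> 'b list \<Rightarrow> ('a, 'b) ncpoly" where
  "path_poly u [] = vtx u"
| "path_poly u (e # p) = edg e * path_poly (head G e) p"

lemma path_poly_free: "awalk u p v \<Longrightarrow> path_poly u p \<in> free_carrier G"
  by (induction p arbitrary: u) (auto simp: awalk_simps)

lemma path_poly_left:
  assumes "awalk u p v"
  shows "vtx u * path_poly u p \<simeq> path_poly u p"
proof (cases p)
  case Nil
  then show ?thesis using assms by (auto simp: awalk_simps intro: eqJ_relations)
next
  case (Cons e q)
  with assms have e: "e \<in> arcs G" "u = tail G e" "awalk (head G e) q v"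
    by (auto simp: awalk_simps)
  have "vtx u * edg e * path_poly (head G e) q \<simeq> edg e * path_poly (head G e) q"
    using e eqJ_relations(3) by (auto intro: eqJ_right path_poly_free)
  then show ?thesis by (simp add: Cons mult.assoc)
qed

text \<open>
  The product collapses from the middle by \<open>e\<^sup>* e = r(e)\<close>.
\<close>

lemma path_poly_isometry: "awalk u p v \<Longrightarrow> poly_star (path_poly u p) * path_poly u p \<simeq> vtx v"
proof (induction p arbitrary: u)
  case Nil
  then show ?case by (auto simp: awalk_simps intro: eqJ_relations)
next
  case (Cons e p)
  then have e: "e \<in> arcs G" "u = tail G e" "awalk (head G e) p v"
    by (auto simp: awalk_simps)
  let ?x = "path_poly (head G e) p"
  have x: "?x \<in> free_carrier G" using path_poly_free[OF e(3)] .
  have "poly_star (path_poly u (e # p)) * path_poly u (e # p) = poly_star ?x * (gst e * edg e * ?x)"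
    by (simp add: mult.assoc)
  also have "\<dots> \<simeq> poly_star ?x * (vtx (head G e) * ?x)"
    using x e by (intro eqJ_left eqJ_right eqJ_relations) auto
  also have "\<dots> \<simeq> poly_star ?x * ?x"
    using x by (intro eqJ_left path_poly_left[OF e(3)]) auto
  also have "\<dots> \<simeq> vtx v"
    by (rule Cons.IH[OF e(3)])
  finally show ?case .
qed

section \<open>Series in the graph C*-algebra\<close>

text \<open>
  The weights \<open>2\<^sup>-\<^sup>n\<close> are summable and the terms bounded, so completeness provides a sum.
\<close>

lemma geometric_series:
  assumes Y: "\<And>n. Y n \<in> cauchy_sequences G" "\<And>n. seq_norm G (Y n) \<le> 1"
  obtains B where "B \<in> cauchy_sequences G"
    "(\<lambda>N. seq_norm G (B - (\<Sum>n<N. seq_scalar (1 / 2 ^ n) * Y n))) \<longlonglongrightarrow> 0"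
proof -
  let ?S = "\<lambda>N. \<Sum>n<N. seq_scalar (1 / 2 ^ n) * Y n"
  have S: "?S N \<in> cauchy_sequences G" for N
    by (intro C.all_closed Y)
  have le: "seq_norm G (?S M - ?S N) \<le> (\<Sum>n\<in>{N..<M}. (1 / 2) ^ n)" if "N \<le> M" for M N
  proof -
    have diff: "?S M - ?S N = (\<Sum>n\<in>{N..<M}. seq_scalar (1 / 2 ^ n) * Y n)"
      using sum_diff_nat_ivl[of 0 N M "\<lambda>n. seq_scalar (1 / 2 ^ n) * Y n"] that
      by (simp only: lessThan_atLeast0)
    have "seq_norm G (?S M - ?S N) \<le> (\<Sum>n\<in>{N..<M}. seq_norm G (seq_scalar (1 / 2 ^ n) * Y n))"
      unfolding diff by (intro C.norm_sum C.all_closed Y)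
    also have "\<dots> \<le> (\<Sum>n\<in>{N..<M}. (1 / 2) ^ n)"
    proof (rule sum_mono)
      fix n
      have "seq_norm G (seq_scalar (1 / 2 ^ n) * Y n) = (1 / 2) ^ n * seq_norm G (Y n)"
        using C.scale[OF Y(1)] by (simp add: norm_divide norm_power power_divide)
      also have "\<dots> \<le> (1 / 2) ^ n * 1"
        by (intro mult_left_mono Y) auto
      finally show "seq_norm G (seq_scalar (1 / 2 ^ n) * Y n) \<le> (1 / 2) ^ n" by simp
    qed
    finally show ?thesis .
  qed
  have geometric: "summable (\<lambda>n. (1 / 2 :: real) ^ n)"
    by (rule summable_geometric) simp
  show ?thesis
  proof (rule cauchy_complete[of ?S])
    fix e :: real assume "0 < e"
    then obtain K where K: "\<And>m n. m \<ge> K \<Longrightarrow> norm (\<Sum>i\<in>{m..<n}. (1 / 2 :: real) ^ i) < e"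
      using geometric unfolding summable_Cauchy by metis
    have *: "seq_norm G (?S M - ?S N) < e" if "N \<ge> K" "N \<le> M" for M N
      using le[OF that(2)] K[OF that(1), of M] by simp
    have "seq_norm G (?S M - ?S N) < e" if "M \<ge> K" "N \<ge> K" for M N
    proof (cases "N \<le> M")
      case False
      then show ?thesis
        using *[of M N] that C.norm_minus_commute[OF S S, of M N] by simp
    qed (use * that in auto)
    then show "\<exists>K. \<forall>M\<ge>K. \<forall>N\<ge>K. seq_norm G (?S M - ?S N) < e" by blast
  qed (use S that in auto)
qed

lemma null_by_limit:
  assumes "X \<in> cauchy_sequences G" "\<And>N. N > k \<Longrightarrow> seq_norm G X \<le> f N" "f \<longlonglongrightarrow> 0"
  shows "X \<in> null_sequences G"
proof -
  have "seq_norm G X \<le> 0"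
    by (rule LIMSEQ_le_const[OF assms(3)]) (use assms(2) in \<open>auto intro!: exI[of _ "Suc k"]\<close>)
  then show ?thesis
    using C.nonneg[OF assms(1)] assms(1) by (simp add: null_sequences_def)
qed

lemma orthogonal_series:
  assumes Y: "\<And>n. Y n \<in> cauchy_sequences G" "\<And>n. seq_norm G (Y n) \<le> 1"
    and B: "B \<in> cauchy_sequences G"
      "(\<lambda>N. seq_norm G (B - (\<Sum>n<N. seq_scalar (1 / 2 ^ n) * Y n))) \<longlonglongrightarrow> 0"
    and orth: "\<And>n k. n \<noteq> k \<Longrightarrow> Y n * Y k \<in> null_sequences G"
    and idem: "\<And>k. Y k * Y k - Y k \<in> null_sequences G"
  shows "B * Y k - seq_scalar (1 / 2 ^ k) * Y k \<in> null_sequences G"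
proof (rule null_by_limit[OF _ _ B(2)])
  show "B * Y k - seq_scalar (1 / 2 ^ k) * Y k \<in> cauchy_sequences G"
    by (intro C.all_closed B Y)
  fix N assume "k < N"
  define S where "S = (\<Sum>n<N. seq_scalar (1 / 2 ^ n) * Y n)"
  have S: "S \<in> cauchy_sequences G" unfolding S_def by (intro C.all_closed Y)
  have "S * Y k - seq_scalar (1 / 2 ^ k) * Y k =
      (\<Sum>n<N. seq_scalar (1 / 2 ^ n) * (Y n * Y k)) -
      (\<Sum>n<N. if n = k then seq_scalar (1 / 2 ^ n) * Y n else 0)"
    using \<open>k < N\<close> by (simp add: S_def sum_distrib_right mult.assoc)
  also have "\<dots> = (\<Sum>n<N. seq_scalar (1 / 2 ^ n) * (Y n * Y k - (if n = k then Y n else 0)))"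
    unfolding sum_subtractf[symmetric] by (intro sum.cong) (simp_all add: right_diff_distrib)
  also have "\<dots> \<in> null_sequences G"
    by (intro A.ideal_sum A.ideal(4)) (use orth idem in auto)
  finally have null: "S * Y k - seq_scalar (1 / 2 ^ k) * Y k \<in> null_sequences G" .
  have eq: "B * Y k - seq_scalar (1 / 2 ^ k) * Y k =
      (B - S) * Y k + (S * Y k - seq_scalar (1 / 2 ^ k) * Y k)"
    by (simp add: algebra_simps)
  have "seq_norm G (B * Y k - seq_scalar (1 / 2 ^ k) * Y k) \<le> seq_norm G ((B - S) * Y k) +
      seq_norm G (S * Y k - seq_scalar (1 / 2 ^ k) * Y k)"
    unfolding eq by (intro C.triangle C.all_closed S B Y)
  also have "\<dots> = seq_norm G ((B - S) * Y k)"
    using null by (simp add: null_sequences_def)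
  also have "\<dots> \<le> seq_norm G (B - S) * seq_norm G (Y k)"
    by (intro C.submult C.all_closed S B Y)
  also have "\<dots> \<le> seq_norm G (B - S) * 1"
    by (intro mult_left_mono Y C.nonneg C.all_closed S B)
  finally show "seq_norm G (B * Y k - seq_scalar (1 / 2 ^ k) * Y k) \<le>
      seq_norm G (B - (\<Sum>n<N. seq_scalar (1 / 2 ^ n) * Y n))"
    unfolding S_def by (simp only: mult_1_right)
qed

text \<open>
  The geometric series gives \<open>B (1 - D / 2) = V\<close>. The equation is doubled so that it contains no
  scalars and can be transported by additive maps.
\<close>

lemma neumann_series:
  assumes V: "V \<in> cauchy_sequences G" and D: "D \<in> cauchy_sequences G"
    and B: "B \<in> cauchy_sequences G"
      "(\<lambda>N. seq_norm G (B - (\<Sum>n<N. seq_scalar (1 / 2 ^ n) * (V * D ^ n)))) \<longlonglongrightarrow> 0"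
  shows "(B + B) - (B * D + (V + V)) \<in> null_sequences G"
proof (rule null_by_limit)
  define S where "S = (\<lambda>N. \<Sum>n<N. seq_scalar (1 / 2 ^ n) * (V * D ^ n))"
  have VD: "V * D ^ n \<in> cauchy_sequences G" for n
  proof (induction n)
    case (Suc n)
    then have "V * D ^ n * D \<in> cauchy_sequences G" using D by (rule C.closed(3))
    then show ?case by (simp only: power_Suc2 mult.assoc)
  qed (use V in simp)
  have S: "S N \<in> cauchy_sequences G" for N unfolding S_def by (intro C.all_closed VD)
  show "(B + B) - (B * D + (V + V)) \<in> cauchy_sequences G"
    by (intro C.all_closed B V D)
  have lim: "(\<lambda>N. seq_norm G (B - S N)) \<longlonglongrightarrow> 0"
    unfolding S_def by (rule B(2))
  let ?d = "\<lambda>N. seq_norm G (B - S N)"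
  show "(\<lambda>N. (?d (Suc N) + ?d (Suc N)) + ?d N * seq_norm G D) \<longlonglongrightarrow> 0"
    using tendsto_add[OF tendsto_add[OF LIMSEQ_Suc[OF lim] LIMSEQ_Suc[OF lim]]
        tendsto_mult_right[OF lim, of "seq_norm G D"]] by simp
  fix N :: nat
  assume "0 < N"
  have "(seq_scalar (1 / 2 ^ Suc n) :: nat \<Rightarrow> ('a, 'b) ncpoly) + seq_scalar (1 / 2 ^ Suc n) = seq_scalar (1 / 2 ^ n)" for n
    by (auto simp: fun_eq_iff simp flip: single_add)
  then have half: "seq_scalar (1 / 2 ^ Suc n) * X + seq_scalar (1 / 2 ^ Suc n) * X = seq_scalar (1 / 2 ^ n) * X"
    for n and X :: "nat \<Rightarrow> ('a, 'b) ncpoly"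
    by (simp only: distrib_right[symmetric])
  have "S (Suc N) + S (Suc N) = (V + V) + S N * D"
  proof -
    have S_Suc: "S (Suc N) = V + (\<Sum>n<N. seq_scalar (1 / 2 ^ Suc n) * (V * D ^ Suc n))"
      unfolding S_def by (simp only: sum.lessThan_Suc_shift) (simp add: fun_eq_iff)
    have "(\<Sum>n<N. seq_scalar (1 / 2 ^ Suc n) * (V * D ^ Suc n)) +
        (\<Sum>n<N. seq_scalar (1 / 2 ^ Suc n) * (V * D ^ Suc n)) = S N * D"
      unfolding S_def sum.distrib[symmetric] half sum_distrib_right
      by (simp only: mult.assoc power_Suc2)
    then show ?thesis
      unfolding S_Suc by (simp only: add_ac)
  qed
  then have eq: "(B + B) - (B * D + (V + V)) =
      ((B - S (Suc N)) + (B - S (Suc N))) - (B - S N) * D"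
    by (simp add: algebra_simps)
  have "seq_norm G ((B + B) - (B * D + (V + V))) \<le> seq_norm G ((B - S (Suc N)) + (B - S (Suc N))) +
      seq_norm G ((B - S N) * D)"
    unfolding eq by (intro C.norm_diff C.all_closed S B D)
  also have "\<dots> \<le> (?d (Suc N) + ?d (Suc N)) + ?d N * seq_norm G D"
    by (intro add_mono[OF C.triangle C.submult] C.all_closed S B D)
  finally show "seq_norm G ((B + B) - (B * D + (V + V))) \<le>
      (?d (Suc N) + ?d (Suc N)) + ?d N * seq_norm G D" .
qed

end

section \<open>Independent elements of the Leavitt path algebra\<close>

context graph_rep
begin

notation eqJ (infix \<open>\<simeq>\<close> 50)

lemma act_eqJ: "\<mu> \<noteq> 0 \<Longrightarrow> x \<simeq> y \<Longrightarrow> act \<mu> x h = act \<mu> y h"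
  using act_cong by (simp add: eqJ_def)

lemma act_adjoint_path:
  "awalk u p v \<Longrightarrow> act \<mu> (poly_star (path_poly u p)) (indicator_at u) =
    (\<lambda>x. \<mu> ^ length p * indicator_at v x)"
proof (induction p arbitrary: u)
  case Nil
  then show ?case
    by (auto simp: act_generators awalk_Nil_iff indicator_at_def fun_eq_iff)
next
  case (Cons e p)
  from Cons.prems have e: "u = tail E e" "awalk (head E e) p v"
    by (auto simp: awalk_Cons_iff)
  have "act \<mu> (gst e) (indicator_at u) = (\<lambda>x. \<mu> * indicator_at (head E e) x + 0 * 0)"
    by (auto simp: fun_eq_iff e indicator_at_def act_generators)
  then show ?case
    using Cons.IH[OF e(2)]
      act_linear[of \<mu> "poly_star (path_poly (head E e) p)" \<mu> "indicator_at (head E e)" 0 "\<lambda>x. 0"]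
    by (simp add: act_mult mult.assoc)
qed

lemma act_adjoint_path_power:
  assumes "awalk v p v"
  shows "act \<mu> (poly_star (path_poly v p) ^ k) (indicator_at v) =
    (\<lambda>x. (\<mu> ^ length p) ^ k * indicator_at v x)"
proof (induction k)
  case 0
  then show ?case
    using act_scalar[of \<mu> 1] by simp
next
  case (Suc k)
  let ?d = "poly_star (path_poly v p)"
  have "act \<mu> (?d ^ Suc k) (indicator_at v) = act \<mu> ?d (act \<mu> (?d ^ k) (indicator_at v))"
    by (simp add: act_mult)
  also have "\<dots> = (\<lambda>x. (\<mu> ^ length p) ^ Suc k * indicator_at v x)"
    unfolding Suc
    using act_linear[of \<mu> ?d "(\<mu> ^ length p) ^ k" "indicator_at v" 0 "\<lambda>x. 0"]
    by (simp add: act_adjoint_path[OF assms] mult_ac)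
  finally show ?case .
qed

text \<open>
  The last two conditions on each member refer to the action on the constant function 1: the result
  takes only the values 0 and 1, and does take the value 1, so that the member is nonzero in the
  Leavitt path algebra.
\<close>

definition orthogonal_family :: "(nat \<Rightarrow> ('v, 'e) ncpoly) \<Rightarrow> bool" where
  "orthogonal_family p \<longleftrightarrow>
    (\<forall>k. p k \<in> free_carrier E \<and> poly_star (p k) = p k \<and> p k * p k \<simeq> p k \<and>
       range (act 1 (p k) (\<lambda>_. 1)) \<subseteq> {0, 1} \<and> (\<exists>x. act 1 (p k) (\<lambda>_. 1) x = 1)) \<and>
    (\<forall>n k. n \<noteq> k \<longrightarrow> p n * p k \<simeq> 0)"

lemma orthogonal_familyD:
  assumes "orthogonal_family p"
  shows "p k \<in> free_carrier E" "poly_star (p k) = p k" "p k * p k \<simeq> p k"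
    "range (act 1 (p k) (\<lambda>_. 1)) \<subseteq> {0, 1}" "\<exists>x. act 1 (p k) (\<lambda>_. 1) x = 1"
    "n \<noteq> k \<Longrightarrow> p n * p k \<simeq> 0"
  using assms by (auto simp: orthogonal_family_def)

text \<open>
  Infinitely many vertices, or infinitely many range projections \<open>e e\<^sup>*\<close> of edges.
\<close>

lemma orthogonal_family_exists:
  assumes "\<not> finite_graph E"
  shows "\<exists>p. orthogonal_family p"
proof (cases "finite (verts E)")
  case False
  then obtain f :: "nat \<Rightarrow> 'v" where f: "inj f" "range f \<subseteq> verts E"
    using infinite_countable_subset by blast
  then have v: "f k \<in> verts E" for k by auto
  have "act 1 (vtx (f k)) (\<lambda>_. 1) (f k, 0) = 1" for k
    by (simp add: act_generators)
  moreover have "range (act 1 (vtx (f k)) (\<lambda>_. 1)) \<subseteq> {0, 1}" for k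
    by (auto simp: act_generators split: if_splits)
  moreover have "f n \<noteq> f k" if "n \<noteq> k" for n k
    using f(1) that by (simp add: inj_eq)
  ultimately have "orthogonal_family (\<lambda>k. vtx (f k))"
    using v unfolding orthogonal_family_def by (auto intro: eqJ_relations)
  then show ?thesis by blast
next
  case True
  with assms have "infinite (arcs E)" by (simp add: finite_graph_def)
  then obtain f :: "nat \<Rightarrow> 'e" where f: "inj f" "range f \<subseteq> arcs E"
    using infinite_countable_subset by blast
  then have e: "f k \<in> arcs E" for k by auto
  have act_p: "act 1 (edg (f k) * gst (f k)) (\<lambda>_. 1) =
      (\<lambda>(u, m). if u = tail E (f k) \<and> m \<in> range (embed (f k)) then 1 else 0)" for k
    unfolding act_mult act_generators by (subst letter_act_edg_gst) simp_all
  have one: "act 1 (edg (f k) * gst (f k)) (\<lambda>_. 1) (tail E (f k), embed (f k) 0) = 1" for k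
    unfolding act_p by simp
  have range: "range (act 1 (edg (f k) * gst (f k)) (\<lambda>_. 1)) \<subseteq> {0, 1}" for k
    unfolding act_p by (auto split: if_splits)
  have prod: "edg (f n) * gst (f n) * (edg (f k) * gst (f k)) =
      edg (f n) * (gst (f n) * edg (f k)) * gst (f k)" for n k
    by (simp add: mult.assoc)
  have idem: "edg (f k) * gst (f k) * (edg (f k) * gst (f k)) \<simeq> edg (f k) * gst (f k)" for k
  proof -
    have "edg (f k) * gst (f k) * (edg (f k) * gst (f k)) \<simeq> edg (f k) * vtx (head E (f k)) * gst (f k)"
      unfolding prod using e by (intro eqJ_left eqJ_right eqJ_relations) auto
    also have "\<dots> \<simeq> edg (f k) * gst (f k)"
      using e by (intro eqJ_left eqJ_right eqJ_relations) auto
    finally show ?thesis .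
  qed
  have orth: "edg (f n) * gst (f n) * (edg (f k) * gst (f k)) \<simeq> 0" if "n \<noteq> k" for n k
  proof -
    have "edg (f n) * (gst (f n) * edg (f k)) * gst (f k) \<simeq> edg (f n) * 0 * gst (f k)"
      using e f(1) that by (intro eqJ_left eqJ_right eqJ_relations) (auto simp: inj_eq)
    then show ?thesis unfolding prod by simp
  qed
  have "orthogonal_family (\<lambda>k. edg (f k) * gst (f k))"
    unfolding orthogonal_family_def using e one range idem orth
    by (intro conjI allI impI) (auto simp del: times_fun_apply)
  then show ?thesis by blast
qed

lemma orthogonal_independent:
  assumes p: "orthogonal_family p" and zero: "(\<Sum>k\<le>m. scalar (c k) * p k) \<in> leavitt_ideal E"
    and "j \<le> m"
  shows "c j = 0"
proof -
  note p = orthogonal_familyD[OF p]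
  have "(\<Sum>k\<le>m. scalar (c k) * p k) * p j \<simeq> 0"
    using L.ideal(6)[of "p j", OF _ zero] p by (simp add: eqJ_zero_iff)
  moreover have "(\<Sum>k\<le>m. scalar (c k) * p k) * p j \<simeq> scalar (c j) * p j"
  proof -
    have "(\<Sum>k\<le>m. scalar (c k) * p k) * p j = (\<Sum>k\<le>m. scalar (c k) * (p k * p j))"
      by (simp add: sum_distrib_right mult.assoc)
    also have "\<dots> \<simeq> (\<Sum>k\<le>m. scalar (c k) * (if k = j then p j else 0))"
      by (intro eqJ_sum eqJ_scalar) (auto intro: p)
    also have "\<dots> = (\<Sum>k\<le>m. if k = j then scalar (c j) * p j else 0)"
      by (intro sum.cong) auto
    also have "\<dots> = scalar (c j) * p j"
      using \<open>j \<le> m\<close> by simp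
    finally show ?thesis .
  qed
  ultimately have "scalar (c j) * p j \<simeq> 0"
    using eqJ_trans eqJ_sym by blast
  then have "act 1 (scalar (c j) * p j) (\<lambda>_. 1) = (\<lambda>_. 0)"
    by (subst act_eqJ[of 1]) auto
  then have "c j * act 1 (p j) (\<lambda>_. 1) x = 0" for x
    by (metis act_mult act_scalar)
  then show ?thesis using p(5)[of j] by (metis mult_1_right)
qed

text \<open>
  Acting on the indicator function of v, a vanishing linear combination of powers of the adjoint
  cycle yields a polynomial that vanishes at \<open>\<mu>\<close> to the length of the cycle for every
  \<open>\<mu> \<noteq> 0\<close>, in particular at all positive reals.
\<close>

lemma cycle_independent:
  assumes p: "awalk v p v" "p \<noteq> []"
    and zero: "(\<Sum>k\<le>m. scalar (c k) * (vtx v * poly_star (path_poly v p) ^ k)) \<in> leavitt_ideal E"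
    and "j \<le> m"
  shows "c j = 0"
proof -
  let ?l = "length p" and ?d = "poly_star (path_poly v p)"
  have vanish: "(\<Sum>k\<le>m. c k * (\<mu> ^ ?l) ^ k) = 0" if "\<mu> \<noteq> 0" for \<mu>
  proof -
    have "act \<mu> (\<Sum>k\<le>m. scalar (c k) * (vtx v * ?d ^ k)) (indicator_at v) (v, 0) = 0"
      using act_ideal[OF that zero, of "indicator_at v"] by simp
    then have "(\<Sum>k\<le>m. c k * ((\<mu> ^ ?l) ^ k * indicator_at v (v, 0))) = 0"
      by (simp add: act_sum act_mult act_scalar act_adjoint_path_power[OF p(1)] act_generators)
    then show ?thesis
      by (simp add: indicator_at_def)
  qed
  have "complex_of_real ` {0<..} \<subseteq> {z. (\<Sum>k\<le>m. c k * z ^ k) = 0}"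
  proof (clarsimp)
    fix r :: real assume "0 < r"
    define \<mu> where "\<mu> = complex_of_real (root ?l r)"
    have "\<mu> \<noteq> 0" "\<mu> ^ ?l = complex_of_real r"
      using \<open>0 < r\<close> p(2) by (simp_all add: \<mu>_def flip: of_real_power)
    with vanish[of \<mu>] show "(\<Sum>k\<le>m. c k * complex_of_real r ^ k) = 0" by simp
  qed
  moreover have "infinite (complex_of_real ` {0<..})"
    by (subst finite_image_iff) (auto simp: inj_on_def infinite_Ioi)
  ultimately have "infinite {z. (\<Sum>k\<le>m. c k * z ^ k) = 0}"
    using finite_subset by blast
  then show ?thesis
    using polyfun_finite_roots[of c m] \<open>j \<le> m\<close> by blast
qed

lemma closed_walk_exists:
  assumes "\<not> acyclic_graph E"
  obtains v p where "awalk v p v" "p \<noteq> []" "v \<in> verts E"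
  using assms by (auto simp: acyclic_graph_def cycle_def dest: awalk_hd_in_verts)

lemma independent_sequence_exists:
  assumes "\<not> (finite_graph E \<and> acyclic_graph E)"
  shows "\<exists>x :: nat \<Rightarrow> ('v, 'e) ncpoly. (\<forall>k. x k \<in> free_carrier E) \<and>
    (\<forall>m c. (\<Sum>k\<le>m. scalar (c k) * x k) \<in> leavitt_ideal E \<longrightarrow> (\<forall>k\<le>m. c k = 0))"
proof (cases "finite_graph E")
  case False
  then obtain p where p: "orthogonal_family p"
    using orthogonal_family_exists by blast
  then show ?thesis
    using orthogonal_independent[OF p] orthogonal_familyD(1)[OF p] by (intro exI[of _ p]) simp
next
  case True
  with assms obtain v p where p: "awalk v p v" "p \<noteq> []" "v \<in> verts E"
    using closed_walk_exists by blast
  let ?x = "\<lambda>k. vtx v * poly_star (path_poly v p) ^ k"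
  have "?x k \<in> free_carrier E" for k
  proof (induction k)
    case (Suc k)
    have "vtx v * poly_star (path_poly v p) ^ k * poly_star (path_poly v p) \<in> free_carrier E"
      using Suc path_poly_free[OF p(1)] by auto
    then show ?case by (simp only: power_Suc2 mult.assoc)
  qed (use p in simp)
  then show ?thesis
    using cycle_independent[OF p(1,2)] by (intro exI[of _ ?x]) simp
qed

lemma finite_dimensional_leavitt_imp:
  assumes "finite_dimensional (leavitt_path_algebra E)"
  shows "finite_graph E \<and> acyclic_graph E"
proof (rule ccontr)
  assume "\<not> ?thesis"
  from independent_sequence_exists[OF this] obtain x :: "nat \<Rightarrow> ('v, 'e) ncpoly"
    where x: "\<forall>k. x k \<in> free_carrier E"
      "\<forall>m c. (\<Sum>k\<le>m. scalar (c k) * x k) \<in> leavitt_ideal E \<longrightarrow> (\<forall>k\<le>m. c k = 0)"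
    by blast
  obtain m c where "\<exists>k\<le>m. c k \<noteq> 0" "(\<Sum>k\<le>m. scalar (c k) * x k) \<in> leavitt_ideal E"
    using L.finite_dimensional_dependent[of x] assms x(1) unfolding leavitt_path_algebra_eq by auto
  then show False using x(2) by blast
qed

end

section \<open>Isomorphisms of star-rings\<close>

context wf_digraph
begin

lemma star_ring_hom_cl:
  assumes "star_ring_hom (leavitt_path_algebra G) (graph_cstar_algebra G) \<phi>"
    and "x \<in> free_carrier G" "y \<in> free_carrier G"
  shows "\<phi> (L.cl (x + y)) = sa_add A.Q (\<phi> (L.cl x)) (\<phi> (L.cl y))"
    "\<phi> (L.cl (x * y)) = sa_mult A.Q (\<phi> (L.cl x)) (\<phi> (L.cl y))"
    "\<phi> (L.cl (poly_star x)) = sa_star A.Q (\<phi> (L.cl x))"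
proof -
  have cl: "L.cl x \<in> carrier L.Q" "L.cl y \<in> carrier L.Q"
    using assms by (auto simp: L.carrier_Q)
  note h = assms(1)[unfolded star_ring_hom_def leavitt_path_algebra_eq graph_cstar_algebra_eq]
  show "\<phi> (L.cl (x + y)) = sa_add A.Q (\<phi> (L.cl x)) (\<phi> (L.cl y))"
    using h cl assms by (metis L.add_Q free_star_algebra_simps(1))
  show "\<phi> (L.cl (x * y)) = sa_mult A.Q (\<phi> (L.cl x)) (\<phi> (L.cl y))"
    using h cl assms by (metis L.mult_Q free_star_algebra_simps(1))
  show "\<phi> (L.cl (poly_star x)) = sa_star A.Q (\<phi> (L.cl x))"
    using h cl assms by (metis L.star_Q free_star_algebra_simps)
qed

end

locale star_ring_iso = graph_rep +
  fixes \<phi> :: "('a, 'b) ncpoly set \<Rightarrow> (nat \<Rightarrow> ('a, 'b) ncpoly) set"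
  assumes hom: "star_ring_hom (leavitt_path_algebra E) (graph_cstar_algebra E) \<phi>"
    and bij: "bij_betw \<phi> (carrier (leavitt_path_algebra E)) (carrier (graph_cstar_algebra E))"
begin

notation eqJ (infix \<open>\<simeq>\<close> 50)

text \<open>
  A map between the quotients becomes a relation between representatives, which respects sums,
  products and adjoints. This avoids choosing representatives of the values of \<open>\<phi>\<close>.
\<close>

definition represents :: "('a, 'b) ncpoly \<Rightarrow> (nat \<Rightarrow> ('a, 'b) ncpoly) \<Rightarrow> bool" where
  "represents x X \<longleftrightarrow> x \<in> free_carrier E \<and> X \<in> cauchy_sequences E \<and> \<phi> (L.cl x) = A.cl X"

lemma represents_closed: "represents x X \<Longrightarrow> x \<in> free_carrier E" "represents x X \<Longrightarrow> X \<in> cauchy_sequences E"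
  by (simp_all add: represents_def)

lemmas hom_rules = star_ring_hom_cl[OF hom]

lemma represents_add: "represents x X \<Longrightarrow> represents y Y \<Longrightarrow> represents (x + y) (X + Y)"
  by (auto simp: represents_def hom_rules A.add_Q C.closed)

lemma represents_mult: "represents x X \<Longrightarrow> represents y Y \<Longrightarrow> represents (x * y) (X * Y)"
  by (auto simp: represents_def hom_rules A.mult_Q C.closed)

lemma represents_star: "represents x X \<Longrightarrow> represents (poly_star x) (seq_star X)"
  by (auto simp: represents_def hom_rules A.star_Q C.closed)

lemma represents_exists:
  assumes "x \<in> free_carrier E"
  obtains X where "represents x X"
proof -
  have "\<phi> (L.cl x) \<in> carrier A.Q"
    using bij assms by (auto simp: bij_betw_def leavitt_path_algebra_eq graph_cstar_algebra_eq L.carrier_Q)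
  then show ?thesis
    using that assms by (auto simp: A.carrier_Q represents_def)
qed

lemma represents_surj:
  assumes "X \<in> cauchy_sequences E"
  obtains x where "represents x X"
proof -
  have "A.cl X \<in> \<phi> ` carrier L.Q"
    using bij assms by (auto simp: bij_betw_def leavitt_path_algebra_eq graph_cstar_algebra_eq A.carrier_Q)
  then obtain x where "x \<in> free_carrier E" "A.cl X = \<phi> (L.cl x)"
    by (auto simp: L.carrier_Q)
  then show ?thesis
    using that assms by (auto simp: represents_def)
qed

lemma represents_eq_iff:
  assumes "represents x X" "represents y Y"
  shows "X - Y \<in> null_sequences E \<longleftrightarrow> x \<simeq> y"
proof -
  have "inj_on \<phi> (L.cl ` free_carrier E)"
    using bij by (simp add: bij_betw_def leavitt_path_algebra_eq L.carrier_Q)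
  then have "\<phi> (L.cl x) = \<phi> (L.cl y) \<longleftrightarrow> L.cl x = L.cl y"
    using assms by (intro inj_on_eq_iff[of \<phi>]) (auto simp: represents_def)
  then show ?thesis
    using assms L.cl_eq_iff[of x y] A.cl_eq_iff[of X Y] by (simp add: represents_def eqJ_def)
qed

lemma represents_zero: "represents 0 0"
proof -
  obtain X where X: "represents 0 X"
    by (rule represents_exists[of 0]) simp_all
  from represents_eq_iff[OF represents_add[OF X X] X] have "X \<in> null_sequences E" by simp
  then have "A.cl X = A.cl 0"
    using represents_closed(2)[OF X] C.closed(1) by (subst A.cl_eq_iff) auto
  then show ?thesis
    using X by (simp add: represents_def C.closed)
qed

text \<open>
  An additive map commutes with multiplication by natural numbers, whereas nothing is known about
  its behaviour under complex scalars.
\<close>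

lemma represents_of_nat: "represents x X \<Longrightarrow> represents (of_nat n * x) (of_nat n * X)"
proof (induction n)
  case 0
  show ?case unfolding of_nat_0 mult_zero_left by (rule represents_zero)
next
  case (Suc n)
  from represents_add[OF Suc.prems Suc.IH[OF Suc.prems]] show ?case
    by (simp only: of_nat_Suc distrib_right mult_1_left)
qed

text \<open>
  In a C*-seminorm, a projection has norm 0 or 1, and the C*-identity extends the bound 1 to
  partial isometries.
\<close>

lemma represents_isometry_norm:
  assumes "represents x X" "represents p P" "poly_star x * x \<simeq> p" "poly_star p * p \<simeq> p"
  shows "seq_norm E X \<le> 1"
proof (rule C.partial_isometry_norm)
  show "X \<in> cauchy_sequences E" "P \<in> cauchy_sequences E"
    using assms represents_closed by auto
  show "seq_norm E (seq_star X * X - P) = 0"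
    using represents_eq_iff[OF represents_mult[OF represents_star[OF assms(1)] assms(1)] assms(2)] assms(3)
    by (simp add: null_sequences_def)
  show "seq_norm E (seq_star P * P - P) = 0"
    using represents_eq_iff[OF represents_mult[OF represents_star[OF assms(2)] assms(2)] assms(2)] assms(4)
    by (simp add: null_sequences_def)
qed

text \<open>
  The sum of the \<open>2\<^sup>-\<^sup>k \<phi>(p\<^sub>k)\<close> pulls back to an element b with \<open>2\<^sup>k b p\<^sub>k = p\<^sub>k\<close>. Applied to the
  constant function 1, this makes b take the value \<open>2\<^sup>-\<^sup>k\<close> on a function with values 0 and 1, for
  every k, contrary to \<open>act_finite_values\<close>.
\<close>

lemma graph_finite: "finite_graph E"
proof (rule ccontr)
  assume "\<not> finite_graph E"
  then obtain p where p: "orthogonal_family p"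
    using orthogonal_family_exists by blast
  note pD = orthogonal_familyD[OF p]
  have "\<forall>k. \<exists>X. represents (p k) X"
    using represents_exists[OF pD(1)] by blast
  then obtain P where "\<forall>k. represents (p k) (P k)" by metis
  then have P: "represents (p k) (P k)" for k by simp
  have P_in: "P k \<in> cauchy_sequences E" for k
    using represents_closed(2)[OF P] .
  have P_norm: "seq_norm E (P k) \<le> 1" for k
    by (rule represents_isometry_norm[OF P[of k] P[of k]]) (simp_all add: pD(2,3))
  obtain B where B: "B \<in> cauchy_sequences E"
      "(\<lambda>N. seq_norm E (B - (\<Sum>n<N. seq_scalar (1 / 2 ^ n) * P n))) \<longlonglongrightarrow> 0"
    by (rule geometric_series[of P, OF P_in P_norm])
  obtain b where b: "represents b B" using represents_surj[OF B(1)] .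
  have "of_nat (2 ^ k) * (b * p k) \<simeq> p k" for k
  proof -
    have orth: "P n * P k \<in> null_sequences E" if "n \<noteq> k" for n k
      using represents_eq_iff[OF represents_mult[OF P P] represents_zero] pD(6)[OF that] by simp
    have idem: "P k * P k - P k \<in> null_sequences E" for k
      using represents_eq_iff[OF represents_mult[OF P P] P] pD(3) by simp
    have "B * P k - seq_scalar (1 / 2 ^ k) * P k \<in> null_sequences E"
      by (rule orthogonal_series[OF P_in P_norm B orth idem])
    then have null: "seq_scalar (2 ^ k) * (B * P k - seq_scalar (1 / 2 ^ k) * P k) \<in> null_sequences E"
      by (rule A.ideal(4))
    have "(seq_scalar (2 ^ k) :: nat \<Rightarrow> ('a, 'b) ncpoly) * seq_scalar (1 / 2 ^ k) = 1"
      by (simp add: fun_eq_iff mult_single)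
    moreover have "(of_nat (2 ^ k) :: nat \<Rightarrow> ('a, 'b) ncpoly) = seq_scalar (2 ^ k)"
      unfolding fun_eq_iff of_nat_fun_apply
      by (metis of_nat_numeral of_nat_power single_of_nat)
    ultimately have "of_nat (2 ^ k) * (B * P k) - P k \<in> null_sequences E"
      using null by (simp only: right_diff_distrib mult.assoc[symmetric] mult_1_left)
    then show ?thesis
      using represents_eq_iff[OF represents_of_nat[OF represents_mult[OF b P]] P] by blast
  qed
  obtain S where S: "finite S" "\<And>h. range h \<subseteq> {0, 1} \<Longrightarrow> range (act 1 b h) \<subseteq> S"
    by (rule act_finite_values[of b]) blast
  have "1 / 2 ^ k \<in> S" for k :: nat
  proof -
    let ?h = "act 1 (p k) (\<lambda>_. 1)"
    obtain x where x: "?h x = 1" using pD(5) by blast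
    have "(of_nat (2 ^ k) :: ('a, 'b) ncpoly) = scalar (of_nat (2 ^ k))"
      by (simp only: single_of_nat)
    then have "act 1 (scalar (of_nat (2 ^ k)) * (b * p k)) (\<lambda>_. 1) x = 1"
      using act_eqJ[OF _ \<open>of_nat (2 ^ k) * (b * p k) \<simeq> p k\<close>, of 1 "\<lambda>_. 1"] x by simp
    then have "2 ^ k * act 1 b ?h x = 1"
      by (simp add: act_mult act_scalar)
    then have "act 1 b ?h x = 1 / 2 ^ k"
      by (simp add: field_simps)
    then show ?thesis using S(2)[OF pD(4)[of k]] by (metis rangeI subsetD)
  qed
  then have "finite (range (\<lambda>k::nat. (1 / 2 ^ k :: complex)))"
    using S(1) by (meson finite_subset image_subsetI)
  moreover have "inj (\<lambda>k::nat. (1 / 2 ^ k :: complex))"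
  proof (rule injI)
    fix i j :: nat
    assume "1 / 2 ^ i = (1 / 2 ^ j :: complex)"
    then have "(2::complex) ^ i = 2 ^ j" by (simp add: field_simps)
    then have "cmod (2 ^ i) = cmod (2 ^ j)" by simp
    then show "i = j" by (simp add: norm_power)
  qed
  ultimately show False
    using finite_imageD by blast
qed

text \<open>
  With d the adjoint of the cycle, the Neumann series pulls back to b with \<open>2 b = b d + 2 v\<close>. If
  \<open>\<mu>\<close> to the length of the cycle is 2, then d acts as 2 on the indicator function of v, which
  leaves \<open>0 = 2 v\<close> there.
\<close>

lemma graph_acyclic: "acyclic_graph E"
proof (rule ccontr)
  assume "\<not> acyclic_graph E"
  then obtain v p where p: "awalk v p v" "p \<noteq> []" "v \<in> verts E"
    by (rule closed_walk_exists)
  define d where "d = poly_star (path_poly v p)"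
  have d_in: "d \<in> free_carrier E"
    unfolding d_def using path_poly_free[OF p(1)] by auto
  obtain V where V: "represents (vtx v) V"
    by (rule represents_exists[of "vtx v"]) (use p in auto)
  obtain D where D: "represents d D" using represents_exists[OF d_in] .
  have proj: "poly_star (vtx v) * vtx v \<simeq> vtx v"
    using eqJ_relations(1)[OF p(3)] by simp
  have V_norm: "seq_norm E V \<le> 1"
    using represents_isometry_norm[OF V V] proj by simp
  have "seq_norm E (seq_star D) \<le> 1"
    by (rule represents_isometry_norm[OF represents_star[OF D] V _ proj])
      (use path_poly_isometry[OF p(1)] in \<open>simp add: d_def\<close>)
  then have D_norm: "seq_norm E D \<le> 1"
    using C.norm_star[OF represents_closed(2)[OF D]] by simp
  have VD: "V * D ^ n \<in> cauchy_sequences E \<and> seq_norm E (V * D ^ n) \<le> 1" for n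
  proof (induction n)
    case 0
    then show ?case using represents_closed(2)[OF V] V_norm by simp
  next
    case (Suc n)
    note IH = conjunct1[OF Suc] conjunct2[OF Suc]
    have "seq_norm E (V * D ^ n * D) \<le> seq_norm E (V * D ^ n) * seq_norm E D"
      by (rule C.submult[OF IH(1) represents_closed(2)[OF D]])
    also have "\<dots> \<le> 1 * 1"
      by (rule mult_mono[OF IH(2) D_norm _ C.nonneg[OF represents_closed(2)[OF D]]]) simp
    finally have "seq_norm E (V * D ^ n * D) \<le> 1" by (simp only: mult_1_left)
    moreover have "V * D ^ n * D \<in> cauchy_sequences E"
      by (rule C.closed(3)[OF IH(1) represents_closed(2)[OF D]])
    ultimately show ?case by (simp only: power_Suc2 mult.assoc)
  qed
  obtain B where B: "B \<in> cauchy_sequences E"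
      "(\<lambda>N. seq_norm E (B - (\<Sum>n<N. seq_scalar (1 / 2 ^ n) * (V * D ^ n)))) \<longlonglongrightarrow> 0"
    by (rule geometric_series[of "\<lambda>n. V * D ^ n"]) (use VD in auto)
  obtain b where b: "represents b B" using represents_surj[OF B(1)] .
  have "(B + B) - (B * D + (V + V)) \<in> null_sequences E"
    by (rule neumann_series[OF represents_closed(2)[OF V] represents_closed(2)[OF D] B])
  then have eq: "b + b \<simeq> b * d + (vtx v + vtx v)"
    using represents_eq_iff[OF represents_add[OF b b] represents_add[OF represents_mult[OF b D] represents_add[OF V V]]] by simp
  \<comment> \<open>Chosen so that the adjoint of the cycle has eigenvalue 2.\<close>
  define \<mu> where "\<mu> = complex_of_real (root (length p) 2)"
  have \<mu>: "\<mu> \<noteq> 0" "\<mu> ^ length p = 2"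
    using p(2) by (simp_all add: \<mu>_def flip: of_real_power)
  let ?h = "indicator_at v"
  have "act \<mu> (b * d) ?h = (\<lambda>x. 2 * act \<mu> b ?h x)"
    using act_linear[of \<mu> b 2 ?h 0 "\<lambda>_. 0"]
    by (simp add: act_mult d_def act_adjoint_path[OF p(1)] \<mu>(2))
  with fun_cong[OF act_eqJ[OF \<mu>(1) eq, of ?h], of "(v, 0)"] show False
    by (simp add: act_add act_generators indicator_at_def)
qed

end

section \<open>The canonical map\<close>

locale canonical_map = graph_rep +
  fixes \<iota> :: "('a, 'b) ncpoly set \<Rightarrow> (nat \<Rightarrow> ('a, 'b) ncpoly) set"
  assumes hom: "star_algebra_hom (leavitt_path_algebra E) (graph_cstar_algebra E) \<iota>"
    and inj: "inj_on \<iota> (carrier (leavitt_path_algebra E))"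
    and vertex: "\<And>v. v \<in> verts E \<Longrightarrow> \<iota> (leavitt_vertex E v) = cstar_vertex E v"
    and edge: "\<And>e. e \<in> arcs E \<Longrightarrow> \<iota> (leavitt_edge E e) = cstar_edge E e"
begin

lemma ring_hom: "star_ring_hom (leavitt_path_algebra E) (graph_cstar_algebra E) \<iota>"
  using hom by (simp add: star_algebra_hom_def)

lemma hom_scalar:
  assumes "x \<in> free_carrier E"
  shows "\<iota> (L.cl (scalar c * x)) = sa_scale A.Q c (\<iota> (L.cl x))"
proof -
  have cl: "L.cl x \<in> carrier L.Q" using assms by (auto simp: L.carrier_Q)
  note h = hom[unfolded star_algebra_hom_def leavitt_path_algebra_eq graph_cstar_algebra_eq]
  show ?thesis
    using conjunct2[OF h, rule_format, OF cl, of c] L.scale_Q[of x c] assms by simp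
qed

text \<open>
  The values at vertices and edges determine \<open>\<iota>\<close>, as these generate the Leavitt path algebra as a
  star-algebra.
\<close>

lemma iota_cl: "x \<in> free_carrier E \<Longrightarrow> \<iota> (L.cl x) = A.cl (\<lambda>n. x)"
proof (induction rule: free_carrier_induct)
  case (vtx v)
  then show ?case
    using vertex[of v]
    by (simp add: leavitt_vertex_def cstar_vertex_def L.cl_def A.cl_def leavitt_cong_eq null_cong_eq)
next
  case (edg e)
  then show ?case
    using edge[of e]
    by (simp add: leavitt_edge_def cstar_edge_def L.cl_def A.cl_def leavitt_cong_eq null_cong_eq)
next
  case (gst e)
  have "\<iota> (L.cl (edg e)) = A.cl (\<lambda>n. edg e)"
    using edge[of e] gst
    by (simp add: leavitt_edge_def cstar_edge_def L.cl_def A.cl_def leavitt_cong_eq null_cong_eq)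
  then show ?case
    using star_ring_hom_cl(3)[OF ring_hom, of "edg e" "edg e"] A.star_Q[of "\<lambda>n. edg e"] gst
    by (simp add: cauchy_const)
next
  case (mult f g)
  then show ?case
    using A.mult_Q[of "\<lambda>n. f" "\<lambda>n. g"]
    by (simp add: star_ring_hom_cl(2)[OF ring_hom] cauchy_const times_fun_def)
next
  case (scalar c f)
  then show ?case
    using A.scale_Q[of "\<lambda>n. f" c] by (simp add: hom_scalar cauchy_const times_fun_def)
next
  case zero
  have "\<iota> (L.cl 0) \<in> carrier A.Q"
    using ring_hom unfolding star_ring_hom_def leavitt_path_algebra_eq graph_cstar_algebra_eq
    by (auto simp: L.carrier_Q)
  then obtain X where X: "X \<in> cauchy_sequences E" "\<iota> (L.cl 0) = A.cl X"
    by (auto simp: A.carrier_Q)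
  have "\<iota> (L.cl (scalar 0 * 0)) = A.cl (seq_scalar 0 * X)"
    using hom_scalar[of 0 0] A.scale_Q[of X 0] X by simp
  then show ?case by (simp add: times_fun_def)
next
  case (add f g)
  then show ?case
    using A.add_Q[of "\<lambda>n. f" "\<lambda>n. g"]
    by (simp add: star_ring_hom_cl(1)[OF ring_hom] cauchy_const plus_fun_def)
qed

text \<open>
  Well-definedness of \<open>\<iota>\<close> is one direction, injectivity the other.
\<close>

lemma universal_seminorm_eq_zero_iff:
  assumes "x \<in> free_carrier E"
  shows "universal_seminorm E x = 0 \<longleftrightarrow> x \<in> leavitt_ideal E"
proof -
  have "x \<in> leavitt_ideal E \<longleftrightarrow> L.cl x = L.cl 0"
    using assms L.cl_eq_iff[of x 0] by simp
  also have "\<dots> \<longleftrightarrow> \<iota> (L.cl x) = \<iota> (L.cl 0)"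
    using assms inj
    by (intro inj_on_eq_iff[symmetric, of \<iota>]) (auto simp: leavitt_path_algebra_eq L.carrier_Q)
  also have "\<dots> \<longleftrightarrow> A.cl (\<lambda>n. x) = A.cl (\<lambda>n. 0)"
    using assms by (simp add: iota_cl)
  also have "\<dots> \<longleftrightarrow> (\<lambda>n. x) - (\<lambda>n. 0) \<in> null_sequences E"
    using assms by (intro A.cl_eq_iff) (simp_all add: cauchy_const)
  also have "\<dots> \<longleftrightarrow> universal_seminorm E x = 0"
    using assms by (simp add: null_sequences_def fun_diff_def cauchy_const seq_norm_const)
  finally show ?thesis by simp
qed

lemma finite_dimensional_cstar_imp:
  assumes "finite_dimensional (graph_cstar_algebra E)"
  shows "finite_graph E \<and> acyclic_graph E"
proof (rule ccontr)
  assume "\<not> ?thesis"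
  from independent_sequence_exists[OF this] obtain x :: "nat \<Rightarrow> ('a, 'b) ncpoly"
    where x: "\<forall>k. x k \<in> free_carrier E"
      "\<forall>m c. (\<Sum>k\<le>m. scalar (c k) * x k) \<in> leavitt_ideal E \<longrightarrow> (\<forall>k\<le>m. c k = 0)"
    by blast
  have const_in: "(\<lambda>n. x k) \<in> carrier (cauchy_star_algebra E)" for k
    using x(1) by (simp add: cauchy_const)
  from A.finite_dimensional_dependent[of "\<lambda>k n. x k",
      OF assms[unfolded graph_cstar_algebra_eq] const_in]
  obtain m :: nat and c where c: "(\<exists>k\<le>m. c k \<noteq> 0) \<and>
      (\<Sum>k\<le>m. seq_scalar (c k) * (\<lambda>n. x k)) \<in> null_sequences E"
    by (elim exE)
  have sum_free: "(\<Sum>k\<le>m. scalar (c k) * x k) \<in> free_carrier E"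
    using x(1) by auto
  have const: "(\<Sum>k\<le>m. seq_scalar (c k) * (\<lambda>n. x k)) = (\<lambda>n. \<Sum>k\<le>m. scalar (c k) * x k)"
    by (induction m) (simp_all add: fun_eq_iff)
  have "universal_seminorm E (\<Sum>k\<le>m. scalar (c k) * x k) = 0"
    using conjunct2[OF c] seq_norm_const[OF sum_free] unfolding const by (simp add: null_sequences_def)
  then have "(\<Sum>k\<le>m. scalar (c k) * x k) \<in> leavitt_ideal E"
    using universal_seminorm_eq_zero_iff[OF sum_free] by simp
  then show False using x(2) conjunct1[OF c] by blast
qed

end

section \<open>Matrix units of a finite acyclic graph\<close>

context wf_digraph
begin

lemma path_poly_right: "awalk u p v \<Longrightarrow> path_poly u p * vtx v \<simeq> path_poly u p"
proof (induction p arbitrary: u)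
  case Nil
  then show ?case by (auto simp: awalk_simps intro: eqJ_relations)
next
  case (Cons e p)
  then have e: "e \<in> arcs G" "awalk (head G e) p v" by (auto simp: awalk_simps)
  have "edg e * (path_poly (head G e) p * vtx v) \<simeq> edg e * path_poly (head G e) p"
    using e Cons.IH by (intro eqJ_left) auto
  then show ?case by (simp add: mult.assoc)
qed

lemma path_poly_other:
  assumes "awalk u p v" "w \<in> verts G" "w \<noteq> u"
  shows "vtx w * path_poly u p \<simeq> 0"
proof -
  note [simp] = path_poly_free[OF assms(1)] awalk_hd_in_verts[OF assms(1)]
  have "vtx w * path_poly u p \<simeq> vtx w * (vtx u * path_poly u p)"
    using assms by (intro eqJ_left eqJ_sym[OF path_poly_left]) auto
  also have "\<dots> = vtx w * vtx u * path_poly u p" by (simp add: mult.assoc)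
  also have "\<dots> \<simeq> 0 * path_poly u p"
    using assms by (intro eqJ_right eqJ_relations) auto
  finally show ?thesis by simp
qed

text \<open>
  Cancelling common initial edges leaves two distinct first edges, two distinct vertices, or a sink
  against a nontrivial path; the latter starts at another vertex because a sink emits no edge.
\<close>

lemma path_poly_orthogonal:
  assumes "awalk u p v" "awalk w q x" "v \<in> sinks G" "x \<in> sinks G" "(u, p) \<noteq> (w, q)"
  shows "poly_star (path_poly u p) * path_poly w q \<simeq> 0"
  using assms
proof (induction p arbitrary: u w q)
  case Nil
  then have u: "u = v" "v \<in> verts G" by (auto simp: awalk_simps)
  have "u \<noteq> w"
  proof
    assume "u = w"
    with Nil have "q \<noteq> []" by auto
    with Nil u \<open>u = w\<close> show False
      by (cases q) (auto simp: awalk_simps sinks_def out_arcs_def)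
  qed
  then show ?case
    using path_poly_other[OF Nil.prems(2), of u] u by simp
next
  case (Cons e p)
  from Cons.prems have e: "e \<in> arcs G" "u = tail G e" "awalk (head G e) p v"
    by (auto simp: awalk_simps)
  have u: "u \<in> verts G" using e by auto
  show ?case
  proof (cases q)
    case Nil
    then have w: "w = x" "x \<in> verts G" using Cons.prems by (auto simp: awalk_simps)
    have "w \<noteq> u" using w e Cons.prems(4) by (auto simp: sinks_def out_arcs_def)
    then have "poly_star (vtx w * path_poly u (e # p)) \<simeq> poly_star 0"
      using path_poly_other[OF Cons.prems(1), of w] w by (intro eqJ_star) auto
    then show ?thesis using Nil by (simp add: mult.assoc)
  next
    case (Cons f q')
    with Cons.prems have f: "f \<in> arcs G" "w = tail G f" "awalk (head G f) q' x"
      by (auto simp: awalk_simps)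
    note free = path_poly_free[OF e(3)] path_poly_free[OF f(3)]
    have prod: "poly_star (path_poly u (e # p)) * path_poly w q =
        poly_star (path_poly (head G e) p) * (gst e * edg f * path_poly (head G f) q')"
      by (simp add: Cons mult.assoc)
    show ?thesis
    proof (cases "e = f")
      case False
      have "poly_star (path_poly (head G e) p) * (gst e * edg f * path_poly (head G f) q') \<simeq>
          poly_star (path_poly (head G e) p) * (0 * path_poly (head G f) q')"
        using e f free False by (intro eqJ_left eqJ_right eqJ_relations) auto
      then show ?thesis unfolding prod by simp
    next
      case True
      with e f Cons.prems Cons have ne: "(head G e, p) \<noteq> (head G f, q')" by auto
      have "poly_star (path_poly (head G e) p) * (gst e * edg f * path_poly (head G f) q') \<simeq>
          poly_star (path_poly (head G e) p) * (vtx (head G f) * path_poly (head G f) q')"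
        using e f free True by (intro eqJ_left eqJ_right) (auto intro: eqJ_relations)
      also have "\<dots> \<simeq> poly_star (path_poly (head G e) p) * path_poly (head G f) q'"
        using free by (intro eqJ_left path_poly_left[OF f(3)]) auto
      also have "\<dots> \<simeq> 0"
        by (rule Cons.IH[OF e(3) f(3) Cons.prems(3,4) ne])
      finally show ?thesis unfolding prod .
    qed
  qed
qed

text \<open>
  Left multiplication by a generator extends or shortens a path to a sink or kills it. An adjoint
  edge kills the trivial path at a sink, since the edge cannot start there.
\<close>

lemma letter_path_poly:
  assumes "awalk u p v" "v \<in> sinks G"
  shows "w \<in> verts G \<Longrightarrow> vtx w * path_poly u p \<simeq> 0 \<or> vtx w * path_poly u p \<simeq> path_poly u p"
    "e \<in> arcs G \<Longrightarrow> edg e * path_poly u p \<simeq> 0 \<or>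
      awalk (tail G e) (e # p) v \<and> edg e * path_poly u p = path_poly (tail G e) (e # p)"
    "e \<in> arcs G \<Longrightarrow> gst e * path_poly u p \<simeq> 0 \<or>
      (\<exists>q. awalk (head G e) q v \<and> gst e * path_poly u p \<simeq> path_poly (head G e) q)"
proof -
  note free = path_poly_free[OF assms(1)]
  show "vtx w * path_poly u p \<simeq> 0 \<or> vtx w * path_poly u p \<simeq> path_poly u p" if "w \<in> verts G"
    using path_poly_left[OF assms(1)] path_poly_other[OF assms(1) that] by (cases "w = u") auto
  show "edg e * path_poly u p \<simeq> 0 \<or>
      awalk (tail G e) (e # p) v \<and> edg e * path_poly u p = path_poly (tail G e) (e # p)"
    if e: "e \<in> arcs G"
  proof (cases "head G e = u")
    case True
    then show ?thesis using e assms by (auto simp: awalk_simps)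
  next
    case False
    have "edg e * path_poly u p \<simeq> edg e * vtx (head G e) * path_poly u p"
      using e free by (intro eqJ_right eqJ_sym[OF eqJ_relations(4)]) auto
    also have "\<dots> = edg e * (vtx (head G e) * path_poly u p)" by (simp add: mult.assoc)
    also have "\<dots> \<simeq> edg e * 0"
      using e False by (intro eqJ_left path_poly_other[OF assms(1)]) auto
    finally show ?thesis by simp
  qed
  show "gst e * path_poly u p \<simeq> 0 \<or>
      (\<exists>q. awalk (head G e) q v \<and> gst e * path_poly u p \<simeq> path_poly (head G e) q)"
    if e: "e \<in> arcs G"
  proof (cases p)
    case Nil
    then have u: "u = v" "v \<in> verts G" using assms by (auto simp: awalk_simps)
    then have "tail G e \<noteq> u" using e assms(2) by (auto simp: sinks_def out_arcs_def)
    have "gst e * vtx u \<simeq> gst e * vtx (tail G e) * vtx u"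
      using e u by (intro eqJ_right eqJ_sym[OF eqJ_relations(6)]) auto
    also have "\<dots> = gst e * (vtx (tail G e) * vtx u)" by (simp add: mult.assoc)
    also have "\<dots> \<simeq> gst e * 0"
      using e u \<open>tail G e \<noteq> u\<close> by (intro eqJ_left eqJ_relations) auto
    finally show ?thesis using Nil by simp
  next
    case (Cons f q)
    with assms have f: "f \<in> arcs G" "awalk (head G f) q v" by (auto simp: awalk_simps)
    note free = path_poly_free[OF f(2)]
    show ?thesis
    proof (cases "e = f")
      case True
      have "gst e * edg f * path_poly (head G f) q \<simeq> vtx (head G f) * path_poly (head G f) q"
        using e True free by (intro eqJ_right) (auto intro: eqJ_relations)
      also have "\<dots> \<simeq> path_poly (head G f) q"
        by (rule path_poly_left[OF f(2)])
      finally show ?thesis using Cons True f by (auto simp: mult.assoc)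
    next
      case False
      have "gst e * edg f * path_poly (head G f) q \<simeq> 0 * path_poly (head G f) q"
        using e f False free by (intro eqJ_right eqJ_relations) auto
      then show ?thesis using Cons by (simp add: mult.assoc)
    qed
  qed
qed

end

locale finite_acyclic_rep = graph_rep +
  assumes fin: "finite_graph E" and acyc: "acyclic_graph E"
begin

notation eqJ (infix \<open>\<simeq>\<close> 50)

lemma acyclic_awalk: "awalk u p u \<Longrightarrow> p = []"
  using acyc closed_w_imp_cycle[of p] by (auto simp: acyclic_graph_def closed_w_def)

text \<open>
  A repeated vertex would split off a closed walk.
\<close>

lemma acyclic_awalk_distinct:
  assumes "awalk u p v"
  shows "distinct (awalk_verts u p)"
proof (rule ccontr)
  assume "\<not> ?thesis"
  from awalk_not_distinct_decomp[OF assms this] obtain r w where "awalk w r w" "r \<noteq> []"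
    by (metis closed_w_def length_greater_0_conv)
  then show False using acyclic_awalk by blast
qed

lemma finite_paths_to: "finite (paths_to E v)"
proof -
  have "paths_to E v \<subseteq> verts E \<times> {p. set p \<subseteq> arcs E \<and> length p \<le> card (verts E)}"
  proof (clarsimp simp: paths_to_def)
    fix u p assume p: "awalk u p v"
    have "card (set (awalk_verts u p)) \<le> card (verts E)"
      using fin p by (intro card_mono) (auto simp: finite_graph_def awalk_def intro: awalk_verts_in_verts)
    then have "length p \<le> card (verts E)"
      using distinct_card[OF acyclic_awalk_distinct[OF p]] by (simp add: length_awalk_verts)
    then show "u \<in> verts E \<and> set p \<subseteq> arcs E \<and> length p \<le> card (verts E)"
      using p by (auto simp: awalk_def)
  qed
  then show ?thesis
    using fin finite_lists_length_le[of "arcs E"] by (auto simp: finite_graph_def intro: finite_subset)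
qed

lemma finite_sinks: "finite (sinks E)"
  using fin by (auto simp: finite_graph_def sinks_def)

abbreviation path_count :: "'a \<Rightarrow> nat" where
  "path_count v \<equiv> card (paths_to E v)"

definition path_nth :: "'a \<Rightarrow> nat \<Rightarrow> 'a \<times> 'b list" where
  "path_nth v = (SOME h. bij_betw h {0..<card (paths_to E v)} (paths_to E v))"

lemma path_nth: "bij_betw (path_nth v) {0..<path_count v} (paths_to E v)"
  unfolding path_nth_def using ex_bij_betw_nat_finite[OF finite_paths_to] by (rule someI_ex)

lemma path_nth_awalk:
  assumes "i < path_count v" "path_nth v i = (u, p)"
  shows "awalk u p v"
proof -
  have "path_nth v i \<in> paths_to E v"
    using path_nth[of v] assms(1) by (auto simp: bij_betw_def)
  then show ?thesis using assms(2) by (simp add: paths_to_def)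
qed

lemma path_nth_surj:
  assumes "awalk u p v"
  obtains i where "i < path_count v" "path_nth v i = (u, p)"
proof -
  have "(u, p) \<in> path_nth v ` {0..<path_count v}"
    using path_nth[of v] assms by (simp add: bij_betw_def paths_to_def)
  then show ?thesis using that by auto
qed

lemma path_nth_eq_iff:
  assumes "i < path_count v" "j < path_count w"
  shows "path_nth v i = path_nth w j \<longleftrightarrow> v = w \<and> i = j"
proof
  assume eq: "path_nth v i = path_nth w j"
  obtain u p where up: "path_nth v i = (u, p)" by (cases "path_nth v i")
  have "awalk u p v" "awalk u p w"
    using path_nth_awalk assms up eq by auto
  then have "v = w" by (metis awlast_if_cas awalk_def)
  then show "v = w \<and> i = j"
    using eq assms path_nth[of v] by (auto simp: bij_betw_def inj_on_def)
qed auto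

definition sink_path :: "'a \<Rightarrow> nat \<Rightarrow> ('a, 'b) ncpoly" where
  "sink_path v i = case_prod path_poly (path_nth v i)"

definition matrix_unit :: "'a \<Rightarrow> nat \<Rightarrow> nat \<Rightarrow> ('a, 'b) ncpoly" where
  "matrix_unit v i j = sink_path v i * poly_star (sink_path v j)"

lemma sink_path_free: "i < path_count v \<Longrightarrow> sink_path v i \<in> free_carrier E"
  using path_nth_awalk[of i v] path_poly_free
  by (cases "path_nth v i") (auto simp: sink_path_def)

lemma matrix_unit_free: "i < path_count v \<Longrightarrow> j < path_count v \<Longrightarrow> matrix_unit v i j \<in> free_carrier E"
  by (simp add: matrix_unit_def sink_path_free)

lemma matrix_unit_star: "poly_star (matrix_unit v i j) = matrix_unit v j i"
  by (simp add: matrix_unit_def)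

lemma sink_path_isometry:
  "i < path_count v \<Longrightarrow> poly_star (sink_path v i) * sink_path v i \<simeq> vtx v"
  using path_nth_awalk[of i v] path_poly_isometry
  by (cases "path_nth v i") (auto simp: sink_path_def)

lemma sink_path_orthogonal:
  assumes "v \<in> sinks E" "w \<in> sinks E" "i < path_count v" "j < path_count w" "\<not> (v = w \<and> i = j)"
  shows "poly_star (sink_path v i) * sink_path w j \<simeq> 0"
proof -
  obtain u p x q where eq: "path_nth v i = (u, p)" "path_nth w j = (x, q)"
    by (cases "path_nth v i"; cases "path_nth w j")
  then have "(u, p) \<noteq> (x, q)"
    using path_nth_eq_iff[OF assms(3,4)] assms(5) by auto
  then show ?thesis
    using path_poly_orthogonal[of u p v x q w] path_nth_awalk assms eq by (simp add: sink_path_def)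
qed

lemma sink_path_right: "i < path_count v \<Longrightarrow> sink_path v i * vtx v \<simeq> sink_path v i"
  using path_nth_awalk[of i v] path_poly_right
  by (cases "path_nth v i") (auto simp: sink_path_def)

lemma matrix_unit_mult:
  assumes "v \<in> sinks E" "w \<in> sinks E" "i < path_count v" "j < path_count v"
    "k < path_count w" "l < path_count w"
  shows "matrix_unit v i j * matrix_unit w k l \<simeq> (if v = w \<and> j = k then matrix_unit v i l else 0)"
proof (cases "v = w \<and> j = k")
  case True
  have v: "v \<in> verts E" using assms(1) by (simp add: sinks_def)
  have "matrix_unit v i j * matrix_unit w k l = sink_path v i * (poly_star (sink_path v j) * sink_path v j) * poly_star (sink_path v l)"
    using True by (simp add: matrix_unit_def mult.assoc)
  also have "\<dots> \<simeq> sink_path v i * vtx v * poly_star (sink_path v l)"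
    using assms True by (intro eqJ_left eqJ_right sink_path_isometry) (auto intro: sink_path_free)
  also have "\<dots> \<simeq> sink_path v i * poly_star (sink_path v l)"
    using assms True by (intro eqJ_right sink_path_right) (auto intro: sink_path_free)
  finally show ?thesis using True by (simp add: matrix_unit_def)
next
  case False
  have "matrix_unit v i j * matrix_unit w k l = sink_path v i * (poly_star (sink_path v j) * sink_path w k) * poly_star (sink_path w l)"
    by (simp add: matrix_unit_def mult.assoc)
  also have "\<dots> \<simeq> sink_path v i * 0 * poly_star (sink_path w l)"
    using assms False by (intro eqJ_left eqJ_right sink_path_orthogonal) (auto intro: sink_path_free)
  finally show ?thesis using False by auto
qed

text \<open>
  Multiplying \<open>\<alpha> \<alpha>\<^sup>*\<close> by \<open>\<alpha>\<^sup>*\<close> on the left and \<open>\<alpha>\<close> on the right returns the sink, which does not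
  vanish.
\<close>

lemma matrix_unit_notin_ideal:
  assumes "v \<in> sinks E" "i < path_count v"
  shows "matrix_unit v i i \<notin> leavitt_ideal E"
proof
  assume "matrix_unit v i i \<in> leavitt_ideal E"
  then have zero: "matrix_unit v i i \<simeq> 0" by (simp add: eqJ_zero_iff)
  note free = sink_path_free[OF assms(2)]
  have v: "v \<in> verts E" using assms(1) by (simp add: sinks_def)
  have "vtx v \<simeq> vtx v * vtx v"
    by (rule eqJ_sym, rule eqJ_relations(1)[OF v])
  also have "\<dots> \<simeq> poly_star (sink_path v i) * sink_path v i * vtx v"
    using assms v by (intro eqJ_right eqJ_sym[OF sink_path_isometry]) auto
  also have "\<dots> \<simeq> poly_star (sink_path v i) * sink_path v i * (poly_star (sink_path v i) * sink_path v i)"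
    using assms free by (intro eqJ_left eqJ_sym[OF sink_path_isometry]) auto
  also have "\<dots> = poly_star (sink_path v i) * matrix_unit v i i * sink_path v i"
    by (simp add: matrix_unit_def mult.assoc)
  also have "\<dots> \<simeq> poly_star (sink_path v i) * 0 * sink_path v i"
    using free zero by (intro eqJ_left eqJ_right) auto
  finally show False using vtx_notin_ideal by (simp add: eqJ_zero_iff)
qed

definition combination :: "('a \<Rightarrow> nat \<Rightarrow> nat \<Rightarrow> complex) \<Rightarrow> ('a, 'b) ncpoly" where
  "combination a = (\<Sum>v\<in>sinks E. \<Sum>i<path_count v. \<Sum>j<path_count v. scalar (a v i j) * matrix_unit v i j)"

lemma combination_free: "combination a \<in> free_carrier E"
  unfolding combination_def by (intro free_carrier_sum free_carrier_scalar matrix_unit_free) auto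

lemma combination_cong:
  "(\<And>v i j. v \<in> sinks E \<Longrightarrow> i < path_count v \<Longrightarrow> j < path_count v \<Longrightarrow> a v i j = b v i j) \<Longrightarrow>
    combination a = combination b"
  unfolding combination_def by (intro sum.cong) auto

lemma combination_zero: "combination (\<lambda>v i j. 0) = 0"
  by (simp add: combination_def)

lemma combination_add: "combination a + combination b = combination (\<lambda>v i j. a v i j + b v i j)"
  by (simp add: combination_def single_add distrib_right sum.distrib)

lemma combination_scalar: "scalar c * combination a = combination (\<lambda>v i j. c * a v i j)"
  by (simp add: combination_def sum_distrib_left scalar_mult mult.assoc)

lemma combination_diff: "combination a - combination b = combination (\<lambda>v i j. a v i j - b v i j)"
  by (simp add: combination_def single_diff left_diff_distrib sum_subtractf)

lemma combination_star: "poly_star (combination a) = combination (\<lambda>v i j. cnj (a v j i))"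
proof -
  have "poly_star (combination a) =
      (\<Sum>v\<in>sinks E. \<Sum>i<path_count v. \<Sum>j<path_count v. scalar (cnj (a v i j)) * matrix_unit v j i)"
    by (simp add: combination_def matrix_unit_star scalar_central)
  also have "\<dots> = combination (\<lambda>v i j. cnj (a v j i))"
    unfolding combination_def by (intro sum.cong[OF refl] sum.swap)
  finally show ?thesis .
qed

lemma scalar_left_commute: "x * (scalar c * y) = scalar c * (x * (y :: ('a, 'b) ncpoly))"
  by (simp only: mult.assoc[symmetric] scalar_central)

lemma matrix_unit_combination:
  assumes "v \<in> sinks E" "i < path_count v" "j < path_count v"
  shows "matrix_unit v i j * combination b \<simeq> (\<Sum>l<path_count v. scalar (b v j l) * matrix_unit v i l)"
proof -
  have "matrix_unit v i j * combination b =
      (\<Sum>w\<in>sinks E. \<Sum>k<path_count w. \<Sum>l<path_count w. scalar (b w k l) * (matrix_unit v i j * matrix_unit w k l))"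
    by (simp only: combination_def sum_distrib_left scalar_left_commute)
  also have "\<dots> \<simeq> (\<Sum>w\<in>sinks E. \<Sum>k<path_count w. \<Sum>l<path_count w.
      scalar (b w k l) * (if v = w \<and> j = k then matrix_unit v i l else 0))"
    using assms by (intro eqJ_sum eqJ_scalar matrix_unit_mult) auto
  also have "\<dots> = (\<Sum>w\<in>sinks E. if w = v then \<Sum>k<path_count v. if k = j then
      \<Sum>l<path_count v. scalar (b v j l) * matrix_unit v i l else 0 else 0)"
  proof (rule sum.cong[OF refl])
    fix w
    have inner: "(\<Sum>l<path_count v. scalar (b v k l) * (if v = v \<and> j = k then matrix_unit v i l else 0)) =
        (if k = j then \<Sum>l<path_count v. scalar (b v j l) * matrix_unit v i l else 0)" for k
      by (cases "k = j") auto
    show "(\<Sum>k<path_count w. \<Sum>l<path_count w.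
          scalar (b w k l) * (if v = w \<and> j = k then matrix_unit v i l else 0)) =
        (if w = v then \<Sum>k<path_count v. if k = j then
          \<Sum>l<path_count v. scalar (b v j l) * matrix_unit v i l else 0 else 0)"
    proof (cases "w = v")
      case True
      show ?thesis unfolding True inner by simp
    qed simp
  qed
  also have "\<dots> = (\<Sum>l<path_count v. scalar (b v j l) * matrix_unit v i l)"
    using assms finite_sinks by simp
  finally show ?thesis .
qed

lemma combination_mult: "combination a * combination b \<simeq> combination (\<lambda>v i j. \<Sum>l<path_count v. a v i l * b v l j)"
proof -
  have "combination a * combination b =
      (\<Sum>v\<in>sinks E. \<Sum>i<path_count v. \<Sum>l<path_count v. scalar (a v i l) * (matrix_unit v i l * combination b))"
    by (simp add: combination_def[of a] sum_distrib_right mult.assoc)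
  also have "\<dots> \<simeq> (\<Sum>v\<in>sinks E. \<Sum>i<path_count v. \<Sum>l<path_count v.
      scalar (a v i l) * (\<Sum>j<path_count v. scalar (b v l j) * matrix_unit v i j))"
    by (intro eqJ_sum eqJ_scalar matrix_unit_combination) auto
  also have "\<dots> = combination (\<lambda>v i j. \<Sum>l<path_count v. a v i l * b v l j)"
    unfolding combination_def L.kappa_sum scalar_mult sum_distrib_left sum_distrib_right mult.assoc
    by (intro sum.cong[OF refl] sum.swap)
  finally show ?thesis .
qed

text \<open>
  Compression by diagonal matrix units isolates one coefficient.
\<close>

lemma combination_coefficient:
  assumes "v \<in> sinks E" "i < path_count v" "j < path_count v"
  shows "matrix_unit v i i * combination a * matrix_unit v j j \<simeq> scalar (a v i j) * matrix_unit v i j"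
proof -
  have "matrix_unit v i i * combination a * matrix_unit v j j \<simeq> (\<Sum>l<path_count v. scalar (a v i l) * matrix_unit v i l) * matrix_unit v j j"
    using assms by (intro eqJ_right matrix_unit_combination matrix_unit_free) auto
  also have "\<dots> = (\<Sum>l<path_count v. scalar (a v i l) * (matrix_unit v i l * matrix_unit v j j))"
    by (simp add: sum_distrib_right mult.assoc)
  also have "\<dots> \<simeq> (\<Sum>l<path_count v. scalar (a v i l) * (if v = v \<and> l = j then matrix_unit v i j else 0))"
    using assms by (intro eqJ_sum eqJ_scalar matrix_unit_mult) auto
  also have "\<dots> = (\<Sum>l<path_count v. if l = j then scalar (a v i j) * matrix_unit v i j else 0)"
    by (intro sum.cong) auto
  also have "\<dots> = scalar (a v i j) * matrix_unit v i j"
    using assms by simp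
  finally show ?thesis .
qed

lemma combination_independent:
  assumes "combination a \<simeq> 0" "v \<in> sinks E" "i < path_count v" "j < path_count v"
  shows "a v i j = 0"
proof (rule ccontr)
  assume nz: "a v i j \<noteq> 0"
  note free = matrix_unit_free[of _ v]
  have "scalar (a v i j) * matrix_unit v i j \<simeq> matrix_unit v i i * combination a * matrix_unit v j j"
    using assms by (intro eqJ_sym[OF combination_coefficient]) auto
  also have "\<dots> \<simeq> matrix_unit v i i * 0 * matrix_unit v j j"
    using assms by (intro eqJ_left eqJ_right free) auto
  finally have "scalar (1 / a v i j) * (scalar (a v i j) * matrix_unit v i j) \<simeq> scalar (1 / a v i j) * 0"
    by (intro eqJ_scalar) simp
  then have "matrix_unit v i j \<simeq> 0"
    using nz by (simp add: mult_single flip: mult.assoc)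
  then have "matrix_unit v i j * matrix_unit v j i \<simeq> 0 * matrix_unit v j i"
    using assms by (intro eqJ_right free) auto
  moreover have "matrix_unit v i i \<simeq> matrix_unit v i j * matrix_unit v j i"
    using eqJ_sym[OF matrix_unit_mult[OF assms(2,2,3,4,4,3)]] by simp
  ultimately have "matrix_unit v i i \<simeq> 0 * matrix_unit v j i"
    using eqJ_trans by blast
  then show False
    using matrix_unit_notin_ideal[OF assms(2,3)] by (simp add: eqJ_zero_iff)
qed

definition spanned :: "('a, 'b) ncpoly \<Rightarrow> bool" where
  "spanned x \<longleftrightarrow> (\<exists>a. x \<simeq> combination a)"

lemma spannedI: "x \<simeq> combination a \<Longrightarrow> spanned x"
  by (auto simp: spanned_def)

lemma spannedE:
  assumes "spanned x"
  obtains a where "x \<simeq> combination a"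
  using assms by (auto simp: spanned_def)

lemma spanned_cong: "x \<simeq> y \<Longrightarrow> spanned y \<Longrightarrow> spanned x"
  using eqJ_trans by (auto simp: spanned_def)

lemma spanned_zero: "spanned 0"
  unfolding spanned_def by (rule exI[of _ "\<lambda>v i j. 0"]) (simp add: combination_zero)

lemma spanned_add: "spanned x \<Longrightarrow> spanned y \<Longrightarrow> spanned (x + y)"
  by (elim spannedE, rule spannedI, drule (1) eqJ_add) (simp only: combination_add)

lemma spanned_scalar: "spanned x \<Longrightarrow> spanned (scalar c * x)"
  by (elim spannedE, rule spannedI, drule eqJ_scalar) (simp only: combination_scalar)

lemma spanned_star: "spanned x \<Longrightarrow> spanned (poly_star x)"
  by (elim spannedE, rule spannedI, drule eqJ_star) (simp only: combination_star)

lemma spanned_sum: "(\<And>i. i \<in> I \<Longrightarrow> spanned (f i)) \<Longrightarrow> spanned (sum f I)"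
  by (induction I rule: infinite_finite_induct) (auto intro: spanned_zero spanned_add)

lemma spanned_unit:
  assumes "v \<in> sinks E" "i < path_count v" "j < path_count v"
  shows "spanned (matrix_unit v i j)"
proof -
  have "combination (\<lambda>w k l. if w = v then if k = i then if l = j then 1 else 0 else 0 else 0) =
      (\<Sum>w\<in>sinks E. if w = v then \<Sum>k<path_count v. if k = i then
        \<Sum>l<path_count v. if l = j then matrix_unit v i j else 0 else 0 else 0)"
    unfolding combination_def
  proof (rule sum.cong[OF refl])
    fix w
    have inner: "(\<Sum>l<path_count v. scalar (if v = v then if k = i then if l = j then 1 else 0 else 0 else 0) *
        matrix_unit v k l) = (if k = i then \<Sum>l<path_count v. if l = j then matrix_unit v i j else 0 else 0)" for k
      by (cases "k = i") (auto intro!: sum.cong simp del: sum.delta sum.delta')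
    show "(\<Sum>k<path_count w. \<Sum>l<path_count w.
          scalar (if w = v then if k = i then if l = j then 1 else 0 else 0 else 0) * matrix_unit w k l) =
        (if w = v then \<Sum>k<path_count v. if k = i then
          \<Sum>l<path_count v. if l = j then matrix_unit v i j else 0 else 0 else 0)"
    proof (cases "w = v")
      case True
      show ?thesis unfolding True inner by simp
    qed simp
  qed
  also have "\<dots> = matrix_unit v i j"
    using assms finite_sinks by simp
  finally show ?thesis
    using eqJ_refl[of "matrix_unit v i j"] spannedI by metis
qed

lemma spanned_paths:
  assumes "awalk u p v" "awalk w q v" "v \<in> sinks E"
  shows "spanned (path_poly u p * poly_star (path_poly w q))"
proof -
  obtain i j where "i < path_count v" "path_nth v i = (u, p)" "j < path_count v" "path_nth v j = (w, q)"
    using path_nth_surj assms(1,2) by metis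
  then show ?thesis
    using spanned_unit[of v i j] assms(3) by (simp add: matrix_unit_def sink_path_def)
qed

lemma spanned_letter_unit:
  assumes "l \<in> vtx ` verts E \<union> edg ` arcs E \<union> gst ` arcs E"
    and v: "v \<in> sinks E" "i < path_count v" "j < path_count v"
  shows "spanned (l * matrix_unit v i j)"
proof -
  obtain u p w q where eq: "path_nth v i = (u, p)" "path_nth v j = (w, q)"
    by (cases "path_nth v i"; cases "path_nth v j")
  then have walks: "awalk u p v" "awalk w q v"
    using path_nth_awalk v by auto
  have free: "poly_star (path_poly w q) \<in> free_carrier E"
    using path_poly_free[OF walks(2)] by auto
  have matrix_unit: "matrix_unit v i j = path_poly u p * poly_star (path_poly w q)"
    by (simp add: matrix_unit_def sink_path_def eq)
  have "l * path_poly u p \<simeq> 0 \<or> (\<exists>u' p'. awalk u' p' v \<and> l * path_poly u p \<simeq> path_poly u' p')"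
    using assms(1) letter_path_poly[OF walks(1) v(1)] walks(1) eqJ_refl by (elim UnE imageE) metis+
  then show ?thesis
  proof (elim disjE exE conjE)
    assume "l * path_poly u p \<simeq> 0"
    then have "l * path_poly u p * poly_star (path_poly w q) \<simeq> 0 * poly_star (path_poly w q)"
      by (rule eqJ_right[OF free])
    then show ?thesis
      unfolding matrix_unit by (intro spanned_cong[OF _ spanned_zero]) (simp add: mult.assoc)
  next
    fix u' p' assume *: "awalk u' p' v" "l * path_poly u p \<simeq> path_poly u' p'"
    then have "l * path_poly u p * poly_star (path_poly w q) \<simeq> path_poly u' p' * poly_star (path_poly w q)"
      by (intro eqJ_right[OF free])
    then show ?thesis
      unfolding matrix_unit using spanned_paths[OF *(1) walks(2) v(1)]
      by (simp add: mult.assoc spanned_cong)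
  qed
qed

lemma spanned_letter:
  assumes l: "l \<in> vtx ` verts E \<union> edg ` arcs E \<union> gst ` arcs E" and "spanned x"
  shows "spanned (l * x)"
proof -
  obtain a where a: "x \<simeq> combination a" using assms(2) by (auto simp: spanned_def)
  have "l * combination a =
      (\<Sum>v\<in>sinks E. \<Sum>i<path_count v. \<Sum>j<path_count v. scalar (a v i j) * (l * matrix_unit v i j))"
    by (simp only: combination_def sum_distrib_left scalar_left_commute)
  moreover have "spanned \<dots>"
    by (intro spanned_sum spanned_scalar spanned_letter_unit l) auto
  ultimately have "spanned (l * combination a)" by simp
  moreover have "l * x \<simeq> l * combination a"
    using l a by (intro eqJ_left) auto
  ultimately show ?thesis by (rule spanned_cong[rotated])
qed

lemma spanned_left: "y \<in> free_carrier E \<Longrightarrow> spanned x \<Longrightarrow> spanned (y * x)"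
proof (induction arbitrary: x rule: free_carrier_induct)
  case (mult f g)
  then show ?case by (simp add: mult.assoc)
next
  case (scalar c f)
  then show ?case by (simp add: mult.assoc spanned_scalar)
next
  case (add f g)
  then show ?case by (simp add: distrib_right spanned_add)
qed (auto intro: spanned_letter spanned_zero)

lemma spanned_right:
  assumes "y \<in> free_carrier E" "spanned x"
  shows "spanned (x * y)"
  using spanned_star[OF spanned_left[of "poly_star y" "poly_star x"]] assms
  by (simp add: spanned_star)

text \<open>
  By the relation at regular vertices, \<open>v = \<Sum> e r(e) e\<^sup>*\<close>. The induction is on the number of
  vertices that can be reached: in an acyclic graph, v itself cannot be reached from \<open>r(e)\<close>.
\<close>

lemma spanned_vtx: "v \<in> verts E \<Longrightarrow> spanned (vtx v)"
proof (induction "card {w. \<exists>p. awalk v p w}" arbitrary: v rule: less_induct)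
  case less
  show ?case
  proof (cases "v \<in> sinks E")
    case True
    have "awalk v [] v" using less.prems by (simp add: awalk_simps)
    from spanned_paths[OF this this True] show ?thesis
      using spanned_cong[OF eqJ_sym[OF eqJ_relations(1)[OF less.prems]]] by simp
  next
    case False
    then have reg: "v \<in> regular_verts E"
      using less.prems fin by (auto simp: sinks_def regular_verts_def finite_graph_def
          intro: finite_subset[of _ "arcs E"])
    have "spanned (edg e * gst e)" if "e \<in> out_arcs E v" for e
    proof -
      have e: "e \<in> arcs E" "tail E e = v" using that by auto
      let ?R = "\<lambda>v. {w. \<exists>p. awalk v p w}"
      have fin_R: "finite (?R v)"
        using fin by (intro finite_subset[of "?R v" "verts E"]) (auto simp: finite_graph_def)
      have "?R (head E e) \<subseteq> ?R v"
        using e by (auto intro: exI[of _ "e # _"] simp: awalk_simps)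
      moreover have "v \<in> ?R v"
        using less.prems by (auto intro: exI[of _ "[]"] simp: awalk_simps)
      moreover have "v \<notin> ?R (head E e)"
      proof
        assume "v \<in> ?R (head E e)"
        then obtain p where "awalk (head E e) p v" by auto
        then have "awalk v (e # p) v" using e by (simp add: awalk_simps)
        then show False using acyclic_awalk by blast
      qed
      ultimately have "card (?R (head E e)) < card (?R v)"
        using fin_R by (intro psubset_card_mono) auto
      then have "spanned (vtx (head E e))"
        using less.hyps e by auto
      then have "spanned (edg e * vtx (head E e) * gst e)"
        using e by (intro spanned_right spanned_left) auto
      moreover have "edg e * gst e \<simeq> edg e * vtx (head E e) * gst e"
        using e by (intro eqJ_right eqJ_sym[OF eqJ_relations(4)]) auto
      ultimately show ?thesis by (rule spanned_cong[rotated])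
    qed
    then show ?thesis
      by (intro spanned_cong[OF eqJ_relations(9)[OF reg]] spanned_sum)
  qed
qed

text \<open>
  The span is a two-sided ideal containing all vertices, hence local units for all generators.
\<close>

lemma spanned_free: "x \<in> free_carrier E \<Longrightarrow> spanned x"
proof (induction rule: free_carrier_induct)
  case (edg e)
  then have "spanned (edg e * vtx (head E e))" by (intro spanned_left spanned_vtx) auto
  then show ?case using spanned_cong[OF eqJ_sym[OF eqJ_relations(4)[OF edg]]] by simp
next
  case (gst e)
  then have "spanned (gst e * vtx (tail E e))" by (intro spanned_left spanned_vtx) auto
  then show ?case using spanned_cong[OF eqJ_sym[OF eqJ_relations(6)[OF gst]]] by simp
qed (auto intro: spanned_vtx spanned_left spanned_scalar spanned_zero spanned_add)

end

section \<open>Isomorphisms with direct sums of matrix algebras\<close>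

lemma star_algebra_isomorphic_trans:
  assumes "star_algebra_isomorphic A B" "star_algebra_isomorphic B C"
  shows "star_algebra_isomorphic A C"
proof -
  obtain \<phi> \<psi> where \<phi>: "star_algebra_hom A B \<phi>" "bij_betw \<phi> (carrier A) (carrier B)"
    and \<psi>: "star_algebra_hom B C \<psi>" "bij_betw \<psi> (carrier B) (carrier C)"
    using assms by (auto simp: star_algebra_isomorphic_def)
  have "star_algebra_hom A C (\<psi> \<circ> \<phi>)"
    using \<phi>(1) \<psi>(1) by (simp add: star_algebra_hom_def star_ring_hom_def)
  moreover have "bij_betw (\<psi> \<circ> \<phi>) (carrier A) (carrier C)"
    using \<phi>(2) \<psi>(2) by (rule bij_betw_trans)
  ultimately show ?thesis by (auto simp: star_algebra_isomorphic_def)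
qed

lemma star_algebra_isomorphic_sym:
  assumes iso: "star_algebra_isomorphic A B"
    and add: "\<And>x y. x \<in> carrier A \<Longrightarrow> y \<in> carrier A \<Longrightarrow> sa_add A x y \<in> carrier A"
    and mult: "\<And>x y. x \<in> carrier A \<Longrightarrow> y \<in> carrier A \<Longrightarrow> sa_mult A x y \<in> carrier A"
    and star: "\<And>x. x \<in> carrier A \<Longrightarrow> sa_star A x \<in> carrier A"
    and scale: "\<And>c x. x \<in> carrier A \<Longrightarrow> sa_scale A c x \<in> carrier A"
  shows "star_algebra_isomorphic B A"
proof -
  obtain \<phi> where hom: "star_algebra_hom A B \<phi>" and bij: "bij_betw \<phi> (carrier A) (carrier B)"
    using iso by (auto simp: star_algebra_isomorphic_def)
  define \<psi> where "\<psi> = the_inv_into (carrier A) \<phi>"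
  have inj: "inj_on \<phi> (carrier A)" and range: "\<phi> ` carrier A = carrier B"
    using bij by (auto simp: bij_betw_def)
  have \<psi>_\<phi>: "\<psi> (\<phi> x) = x" if "x \<in> carrier A" for x
    using inj that by (simp add: \<psi>_def the_inv_into_f_f)
  have h: "\<phi> (sa_add A x y) = sa_add B (\<phi> x) (\<phi> y)" "\<phi> (sa_mult A x y) = sa_mult B (\<phi> x) (\<phi> y)"
    "\<phi> (sa_star A x) = sa_star B (\<phi> x)" "\<phi> (sa_scale A c x) = sa_scale B c (\<phi> x)"
    if "x \<in> carrier A" "y \<in> carrier A" for x y c
    using hom that by (simp_all add: star_algebra_hom_def star_ring_hom_def)
  have "star_algebra_hom B A \<psi>"
    unfolding star_algebra_hom_def star_ring_hom_def range[symmetric]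
    by (auto simp: \<psi>_\<phi> add mult star scale simp flip: h)
  moreover have "bij_betw \<psi> (carrier B) (carrier A)"
    unfolding \<psi>_def by (rule bij_betw_the_inv_into[OF bij])
  ultimately show ?thesis by (auto simp: star_algebra_isomorphic_def)
qed

lemma finite_dimensional_image:
  assumes hom: "star_algebra_hom A B \<phi>" and surj: "\<phi> ` carrier A = carrier B"
    and zero: "\<phi> (sa_zero A) = sa_zero B" and fin: "finite_dimensional A"
  shows "finite_dimensional B"
proof -
  obtain S where S: "finite S" "S \<subseteq> carrier A" "linear_span A S = carrier A"
    using fin by (auto simp: finite_dimensional_def)
  have h: "\<phi> (sa_add A x y) = sa_add B (\<phi> x) (\<phi> y)" "\<phi> (sa_scale A c x) = sa_scale B c (\<phi> x)"
    if "x \<in> carrier A" "y \<in> carrier A" for x y c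
    using hom that by (simp_all add: star_algebra_hom_def star_ring_hom_def)
  have *: "\<phi> x \<in> linear_span B (\<phi> ` S)" if "x \<in> linear_span A S" for x
    using that
  proof induction
    case zero
    show ?case unfolding \<open>\<phi> (sa_zero A) = sa_zero B\<close> by (rule linear_span.zero)
  next
    case (base x)
    then show ?case by (intro linear_span.base) auto
  next
    case (add x y)
    then show ?case using S(3) h by (auto intro: linear_span.add)
  next
    case (scale x c)
    then show ?case using S(3) h(2)[of x x c] by (auto intro: linear_span.scale)
  qed
  have "y \<in> \<phi> ` carrier A" if "y \<in> linear_span B (\<phi> ` S)" for y
    using that
  proof induction
    case zero
    have "sa_zero A \<in> carrier A" using linear_span.zero[of A S] S(3) by simp
    then show ?case using \<open>\<phi> (sa_zero A) = sa_zero B\<close> by (metis imageI)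
  next
    case (base x)
    then show ?case using S(2) by auto
  next
    case (add x y)
    then obtain x' y' where "x = \<phi> x'" "y = \<phi> y'" "x' \<in> carrier A" "y' \<in> carrier A" by auto
    then show ?case
      using h(1)[of x' y'] linear_span.add[of x' A S y'] S(3) by (metis imageI)
  next
    case (scale x c)
    then obtain x' where "x = \<phi> x'" "x' \<in> carrier A" by auto
    then show ?case
      using h(2)[of x' x' c] linear_span.scale[of x' A S c] S(3) by (metis imageI)
  qed
  with * have "linear_span B (\<phi> ` S) = \<phi> ` carrier A" unfolding S(3) by blast
  then have "linear_span B (\<phi> ` S) = carrier B" by (simp only: surj)
  then show ?thesis
    unfolding finite_dimensional_def using S(1,2) surj by (intro exI[of _ "\<phi> ` S"]) blast
qed

lemma mat_adjoint_carrier: "A \<in> carrier_mat n n \<Longrightarrow> mat_adjoint A \<in> carrier_mat n n"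
  by (auto simp: mat_adjoint_def)

lemma mat_adjoint_index:
  "A \<in> carrier_mat n n \<Longrightarrow> i < n \<Longrightarrow> j < n \<Longrightarrow> mat_adjoint A $$ (i, j) = cnj (A $$ (j, i))"
  for A :: "complex mat"
  by (simp add: mat_adjoint_def mat_of_rows_def)

context finite_acyclic_rep
begin

abbreviation "matrix_algebra \<equiv> matrix_direct_sum (sinks E) path_count"

lemma matrix_algebra_closed:
  "x \<in> carrier matrix_algebra \<Longrightarrow> y \<in> carrier matrix_algebra \<Longrightarrow>
    sa_add matrix_algebra x y \<in> carrier matrix_algebra"
  "x \<in> carrier matrix_algebra \<Longrightarrow> y \<in> carrier matrix_algebra \<Longrightarrow>
    sa_mult matrix_algebra x y \<in> carrier matrix_algebra"
  "x \<in> carrier matrix_algebra \<Longrightarrow> sa_star matrix_algebra x \<in> carrier matrix_algebra"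
  "x \<in> carrier matrix_algebra \<Longrightarrow> sa_scale matrix_algebra c x \<in> carrier matrix_algebra"
  by (auto simp: matrix_direct_sum_def PiE_iff intro!: mat_adjoint_carrier)

text \<open>
  Sends a family of matrices to the combination of matrix units with these coefficients; injective
  by independence and onto because the matrix units span.
\<close>

lemma matrix_algebra_isomorphic: "star_algebra_isomorphic matrix_algebra (leavitt_path_algebra E)"
proof -
  define \<psi> where "\<psi> A = combination (\<lambda>v i j. A v $$ (i, j))" for A :: "'a \<Rightarrow> complex mat"
  have in_carrier: "A v \<in> carrier_mat (path_count v) (path_count v)"
    if "A \<in> carrier matrix_algebra" "v \<in> sinks E" for A v
    using that by (auto simp: matrix_direct_sum_def)
  have cl_eq: "L.cl x = L.cl y \<longleftrightarrow> x \<simeq> y" if "x \<in> free_carrier E" "y \<in> free_carrier E" for x y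
    using L.cl_eq_iff[of x y] that by (simp add: eqJ_def)
  have free: "\<psi> A \<in> free_carrier E" for A
    by (simp add: \<psi>_def combination_free)
  have add: "\<psi> (sa_add matrix_algebra A B) = \<psi> A + \<psi> B"
    if "A \<in> carrier matrix_algebra" "B \<in> carrier matrix_algebra" for A B
    unfolding \<psi>_def combination_add
  proof (rule combination_cong)
    fix v i j assume "v \<in> sinks E" "i < path_count v" "j < path_count v"
    then show "sa_add matrix_algebra A B v $$ (i, j) = A v $$ (i, j) + B v $$ (i, j)"
      using in_carrier[OF that(1), of v] in_carrier[OF that(2), of v]
      by (auto simp: matrix_direct_sum_def)
  qed
  have scale: "\<psi> (sa_scale matrix_algebra c A) = scalar c * \<psi> A"
    if "A \<in> carrier matrix_algebra" for c A
    unfolding \<psi>_def combination_scalar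
  proof (rule combination_cong)
    fix v i j assume "v \<in> sinks E" "i < path_count v" "j < path_count v"
    then show "sa_scale matrix_algebra c A v $$ (i, j) = c * A v $$ (i, j)"
      using in_carrier[OF that, of v] by (auto simp: matrix_direct_sum_def)
  qed
  have star: "\<psi> (sa_star matrix_algebra A) = poly_star (\<psi> A)"
    if "A \<in> carrier matrix_algebra" for A
    unfolding \<psi>_def combination_star
  proof (rule combination_cong)
    fix v i j assume "v \<in> sinks E" "i < path_count v" "j < path_count v"
    then show "sa_star matrix_algebra A v $$ (i, j) = cnj (A v $$ (j, i))"
      using in_carrier[OF that, of v] by (auto simp: matrix_direct_sum_def mat_adjoint_index)
  qed
  have mult: "\<psi> (sa_mult matrix_algebra A B) \<simeq> \<psi> A * \<psi> B"
    if "A \<in> carrier matrix_algebra" "B \<in> carrier matrix_algebra" for A B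
  proof -
    have "\<psi> (sa_mult matrix_algebra A B) =
        combination (\<lambda>v i j. \<Sum>l<path_count v. A v $$ (i, l) * B v $$ (l, j))"
      unfolding \<psi>_def
    proof (rule combination_cong)
      fix v i j assume v: "v \<in> sinks E" "i < path_count v" "j < path_count v"
      then show "sa_mult matrix_algebra A B v $$ (i, j) =
          (\<Sum>l<path_count v. A v $$ (i, l) * B v $$ (l, j))"
        using in_carrier[OF that(1) v(1)] in_carrier[OF that(2) v(1)]
        by (auto simp: matrix_direct_sum_def scalar_prod_def atLeast0LessThan)
    qed
    then show ?thesis
      unfolding \<psi>_def by (simp add: eqJ_sym[OF combination_mult])
  qed
  have "star_algebra_hom matrix_algebra L.Q (\<lambda>A. L.cl (\<psi> A))"
    unfolding star_algebra_hom_def star_ring_hom_def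
    by (auto simp: L.carrier_Q L.add_Q L.mult_Q L.star_Q L.scale_Q free add scale star
        matrix_algebra_closed cl_eq mult)
  moreover have "inj_on (\<lambda>A. L.cl (\<psi> A)) (carrier matrix_algebra)"
  proof (rule inj_onI)
    fix A B assume AB: "A \<in> carrier matrix_algebra" "B \<in> carrier matrix_algebra" "L.cl (\<psi> A) = L.cl (\<psi> B)"
    then have "\<psi> A - \<psi> B \<simeq> 0"
      using cl_eq[OF free free] by (simp add: eqJ_def)
    then have zero: "combination (\<lambda>v i j. A v $$ (i, j) - B v $$ (i, j)) \<simeq> 0"
      by (simp only: \<psi>_def combination_diff)
    have "A v = B v" if v: "v \<in> sinks E" for v
      using in_carrier[OF AB(1) v] in_carrier[OF AB(2) v] combination_independent[OF zero v]
      by (intro eq_matI) auto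
    then show "A = B"
      using AB(1,2) by (intro PiE_ext[of A "sinks E"]) (auto simp: matrix_direct_sum_def)
  qed
  moreover have "(\<lambda>A. L.cl (\<psi> A)) ` carrier matrix_algebra = carrier L.Q"
  proof
    show "(\<lambda>A. L.cl (\<psi> A)) ` carrier matrix_algebra \<subseteq> carrier L.Q"
      by (auto simp: L.carrier_Q free)
    show "carrier L.Q \<subseteq> (\<lambda>A. L.cl (\<psi> A)) ` carrier matrix_algebra"
    proof
      fix X assume "X \<in> carrier L.Q"
      then obtain x where x: "x \<in> free_carrier E" "X = L.cl x" by (auto simp: L.carrier_Q)
      obtain a where a: "x \<simeq> combination a" using spanned_free[OF x(1)] by (rule spannedE)
      define A where "A = (\<lambda>v\<in>sinks E. mat (path_count v) (path_count v) (\<lambda>(i, j). a v i j))"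
      have "\<psi> A = combination a"
        unfolding \<psi>_def by (rule combination_cong) (simp add: A_def)
      then have "X = L.cl (\<psi> A)"
        unfolding x(2) cl_eq[OF x(1) free] by (simp only: a)
      moreover have "A \<in> carrier matrix_algebra"
        by (auto simp: A_def matrix_direct_sum_def)
      ultimately show "X \<in> (\<lambda>A. L.cl (\<psi> A)) ` carrier matrix_algebra" by blast
    qed
  qed
  ultimately show ?thesis
    unfolding star_algebra_isomorphic_def leavitt_path_algebra_eq bij_betw_def by blast
qed

lemma finite_dimensional_leavitt: "finite_dimensional (leavitt_path_algebra E)"
proof -
  define S where "S = (\<Union>v\<in>sinks E. \<Union>i\<in>{..<path_count v}. (\<lambda>j. L.cl (matrix_unit v i j)) ` {..<path_count v})"
  have fin: "finite S" using finite_sinks by (simp add: S_def)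
  have S: "S \<subseteq> carrier L.Q"
    by (auto simp: S_def L.carrier_Q matrix_unit_free)
  have sum: "L.cl (\<Sum>i\<in>I. f i) \<in> linear_span L.Q S"
    if "\<And>i. i \<in> I \<Longrightarrow> f i \<in> free_carrier E" "\<And>i. i \<in> I \<Longrightarrow> L.cl (f i) \<in> linear_span L.Q S"
    for I and f :: "'i \<Rightarrow> ('a, 'b) ncpoly"
    using that
  proof (induction I rule: infinite_finite_induct)
    case (insert i I)
    then have "sa_add L.Q (L.cl (f i)) (L.cl (sum f I)) \<in> linear_span L.Q S"
      by (intro linear_span.add) auto
    then show ?case using insert by (simp add: L.add_Q)
  qed (simp_all add: linear_span.zero flip: L.zero_Q)
  have "L.cl (combination a) \<in> linear_span L.Q S" for a
    unfolding combination_def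
  proof (intro sum free_carrier_sum free_carrier_scalar matrix_unit_free)
    fix v i j assume v: "v \<in> sinks E" "i \<in> {..<path_count v}" "j \<in> {..<path_count v}"
    then have "L.cl (matrix_unit v i j) \<in> linear_span L.Q S"
      by (intro linear_span.base) (auto simp: S_def)
    then have "sa_scale L.Q (a v i j) (L.cl (matrix_unit v i j)) \<in> linear_span L.Q S"
      by (rule linear_span.scale)
    then show "L.cl (scalar (a v i j) * matrix_unit v i j) \<in> linear_span L.Q S"
      using v by (simp add: L.scale_Q matrix_unit_free)
  qed auto
  moreover have "\<exists>a. L.cl x = L.cl (combination a)" if "x \<in> free_carrier E" for x
    using spanned_free[OF that] L.cl_eq_iff[of x] combination_free that by (auto simp: spanned_def eqJ_def)
  ultimately have "carrier L.Q \<subseteq> linear_span L.Q S"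
    by (auto simp: L.carrier_Q) metis
  moreover have "X \<in> carrier L.Q" if "X \<in> linear_span L.Q S" for X
    using that
    by induction (use S in \<open>auto simp: L.carrier_Q L.zero_Q L.add_Q L.scale_Q\<close>)
  ultimately show ?thesis
    unfolding finite_dimensional_def leavitt_path_algebra_eq using fin S by blast
qed

end

section \<open>Completeness of finite-dimensional Leavitt path algebras\<close>

locale finite_acyclic_canonical = canonical_map + finite_acyclic_rep
begin

text \<open>
  By the C*-identity the norm squared is that of a diagonal matrix unit, a projection, whose norm is
  0 or 1. It is not 0, because the universal seminorm vanishes only on the Leavitt ideal.
\<close>

lemma matrix_unit_norm:
  assumes "v \<in> sinks E" "i < path_count v" "j < path_count v"
  shows "U (matrix_unit v i j) = 1"
proof -
  have null: "U (x - y) = 0" if "x \<simeq> y" "x \<in> free_carrier E" "y \<in> free_carrier E" for x y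
    using universal_seminorm_eq_zero_iff[of "x - y"] that by (simp add: eqJ_def)
  have diag: "U (matrix_unit v i i) = 1" if i: "i < path_count v" for i
  proof -
    have "U (poly_star (matrix_unit v i i) * matrix_unit v i i - matrix_unit v i i) = 0"
      using matrix_unit_mult[OF assms(1,1) i i i i] i by (intro null) (auto simp: matrix_unit_star matrix_unit_free)
    then have "U (matrix_unit v i i) = 0 \<or> U (matrix_unit v i i) = 1"
      by (intro U.projection_norm matrix_unit_free i)
    then show ?thesis
      using universal_seminorm_eq_zero_iff[OF matrix_unit_free[OF i i]] matrix_unit_notin_ideal[OF assms(1) i] by auto
  qed
  have "U (poly_star (matrix_unit v i j) * matrix_unit v i j - matrix_unit v j j) = 0"
    using matrix_unit_mult[OF assms(1,1,3,2,2,3)] assms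
    by (intro null) (auto simp: matrix_unit_star matrix_unit_free)
  then have "U (poly_star (matrix_unit v i j) * matrix_unit v i j) = U (matrix_unit v j j)"
    using assms by (intro U.norm_cong) (auto simp: matrix_unit_star matrix_unit_free)
  then have "(U (matrix_unit v i j))\<^sup>2 = 1"
    using diag[OF assms(3)] U.cstar[of "matrix_unit v i j"] assms by (simp add: matrix_unit_free)
  moreover have "0 \<le> U (matrix_unit v i j)"
    using assms by (intro U.nonneg matrix_unit_free)
  ultimately show ?thesis by (simp add: power2_eq_1_iff)
qed

lemma coefficient_bound:
  assumes v: "v \<in> sinks E" "i < path_count v" "j < path_count v"
  shows "cmod (a v i j) \<le> U (combination a)"
proof -
  note [simp] = matrix_unit_free[OF v(2,2)] matrix_unit_free[OF v(2,3)] matrix_unit_free[OF v(3,3)] combination_free[of a]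
  have "U (matrix_unit v i i * combination a * matrix_unit v j j - scalar (a v i j) * matrix_unit v i j) = 0"
    using universal_seminorm_eq_zero_iff combination_coefficient[OF v, of a] by (simp add: eqJ_def)
  then have "U (scalar (a v i j) * matrix_unit v i j) = U (matrix_unit v i i * combination a * matrix_unit v j j)"
    by (intro U.norm_cong[symmetric]) auto
  then have "cmod (a v i j) = U (matrix_unit v i i * combination a * matrix_unit v j j)"
    using matrix_unit_norm[OF v] by (simp add: U.scale)
  also have "\<dots> \<le> U (matrix_unit v i i * combination a) * U (matrix_unit v j j)"
    by (intro U.submult) auto
  also have "\<dots> \<le> U (matrix_unit v i i) * U (combination a) * U (matrix_unit v j j)"
    by (intro mult_right_mono U.submult U.nonneg) auto
  also have "\<dots> = U (combination a)"
    using matrix_unit_norm[OF v(1)] v by simp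
  finally show ?thesis .
qed

lemma combination_norm_le:
  "U (combination a) \<le> (\<Sum>v\<in>sinks E. \<Sum>i<path_count v. \<Sum>j<path_count v. cmod (a v i j))"
proof -
  have "U (combination a) \<le> (\<Sum>v\<in>sinks E. U (\<Sum>i<path_count v. \<Sum>j<path_count v. scalar (a v i j) * matrix_unit v i j))"
    unfolding combination_def by (intro U.norm_sum free_carrier_sum free_carrier_scalar matrix_unit_free) auto
  also have "\<dots> \<le> (\<Sum>v\<in>sinks E. \<Sum>i<path_count v. U (\<Sum>j<path_count v. scalar (a v i j) * matrix_unit v i j))"
    by (intro sum_mono U.norm_sum free_carrier_sum free_carrier_scalar matrix_unit_free) auto
  also have "\<dots> \<le> (\<Sum>v\<in>sinks E. \<Sum>i<path_count v. \<Sum>j<path_count v. U (scalar (a v i j) * matrix_unit v i j))"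
    by (intro sum_mono U.norm_sum free_carrier_sum free_carrier_scalar matrix_unit_free) auto
  also have "\<dots> = (\<Sum>v\<in>sinks E. \<Sum>i<path_count v. \<Sum>j<path_count v. cmod (a v i j))"
    by (intro sum.cong) (auto simp: U.scale matrix_unit_free matrix_unit_norm)
  finally show ?thesis .
qed

text \<open>
  A Cauchy sequence has Cauchy coefficients. Their limits define an element of the Leavitt path
  algebra, to which the sequence converges since the norm is dominated by the sum of the absolute
  values of the coefficients.
\<close>

lemma iota_surj: "\<iota> ` carrier (leavitt_path_algebra E) = carrier (graph_cstar_algebra E)"
proof
  show "\<iota> ` carrier (leavitt_path_algebra E) \<subseteq> carrier (graph_cstar_algebra E)"
    using ring_hom by (auto simp: star_ring_hom_def)
  show "carrier (graph_cstar_algebra E) \<subseteq> \<iota> ` carrier (leavitt_path_algebra E)"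
  proof
    fix Y assume "Y \<in> carrier (graph_cstar_algebra E)"
    then obtain X where X: "X \<in> cauchy_sequences E" "Y = A.cl X"
      by (auto simp: graph_cstar_algebra_eq A.carrier_Q)
    note X_free = cauchy_free[OF X(1)]
    have "\<forall>n. \<exists>a. X n \<simeq> combination a"
      using spanned_free[OF X_free] by (simp add: spanned_def)
    then obtain a where a: "\<forall>n. X n \<simeq> combination (a n)" by metis
    have U_cong: "U x = U y" if "x \<simeq> y" "x \<in> free_carrier E" "y \<in> free_carrier E" for x y
      using U.norm_cong[of x y] universal_seminorm_eq_zero_iff[of "x - y"] that by (simp add: eqJ_def)
    have "convergent (\<lambda>n. a n v i j)" if v: "v \<in> sinks E" "i < path_count v" "j < path_count v" for v i j
    proof -
      have bound: "cmod (a m v i j - a n v i j) \<le> U (X m - X n)" for m n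
      proof -
        have "cmod (a m v i j - a n v i j) \<le> U (combination (\<lambda>v i j. a m v i j - a n v i j))"
          by (rule coefficient_bound[OF v, of "\<lambda>v i j. a m v i j - a n v i j"])
        also have "\<dots> = U (X m - X n)"
          unfolding combination_diff[symmetric] using a X_free combination_free
          by (intro U_cong eqJ_sym[OF eqJ_diff]) auto
        finally show ?thesis .
      qed
      have "Cauchy (\<lambda>n. a n v i j)"
      proof (rule metric_CauchyI)
        fix e :: real assume "0 < e"
        from cauchy_sequencesD[OF X(1) this] obtain M where
          M: "\<forall>m\<ge>M. \<forall>n\<ge>M. U (X m - X n) < e" ..
        have "dist (a m v i j) (a n v i j) < e" if "m \<ge> M" "n \<ge> M" for m n
          using bound[of m n] M[rule_format, OF that] by (simp add: dist_norm)
        then show "\<exists>M. \<forall>m\<ge>M. \<forall>n\<ge>M. dist (a m v i j) (a n v i j) < e" by blast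
      qed
      then show ?thesis by (simp add: Cauchy_convergent_iff)
    qed
    then have lim: "(\<lambda>n. a n v i j) \<longlonglongrightarrow> lim (\<lambda>n. a n v i j)"
      if "v \<in> sinks E" "i < path_count v" "j < path_count v" for v i j
      using that by (simp add: convergent_LIMSEQ_iff)
    define b where "b v i j = lim (\<lambda>n. a n v i j)" for v i j
    have upper: "(\<lambda>n. \<Sum>v\<in>sinks E. \<Sum>i<path_count v. \<Sum>j<path_count v. cmod (a n v i j - b v i j))
        \<longlonglongrightarrow> (\<Sum>v\<in>sinks E. \<Sum>i<path_count v. \<Sum>j<path_count v. 0)"
      unfolding b_def
      by (intro tendsto_sum tendsto_norm_zero LIM_zero lim) auto
    have le: "U (X n - combination b) \<le>
        (\<Sum>v\<in>sinks E. \<Sum>i<path_count v. \<Sum>j<path_count v. cmod (a n v i j - b v i j))" for n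
    proof -
      have "U (X n - combination b) = U (combination (\<lambda>v i j. a n v i j - b v i j))"
        unfolding combination_diff[symmetric] using a X_free combination_free
        by (intro U_cong eqJ_diff) auto
      then show ?thesis
        using combination_norm_le[of "\<lambda>v i j. a n v i j - b v i j"] by simp
    qed
    have const: "(\<lambda>n. combination b) \<in> cauchy_sequences E"
      by (intro cauchy_const combination_free)
    have "(\<lambda>n. U ((X - (\<lambda>n. combination b)) n)) \<longlonglongrightarrow> 0"
    proof (rule tendsto_sandwich[OF _ _ tendsto_const])
      show "\<forall>\<^sub>F n in sequentially. 0 \<le> U ((X - (\<lambda>n. combination b)) n)"
        using X_free combination_free by (auto intro!: always_eventually U.nonneg)
      show "\<forall>\<^sub>F n in sequentially. U ((X - (\<lambda>n. combination b)) n) \<le>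
          (\<Sum>v\<in>sinks E. \<Sum>i<path_count v. \<Sum>j<path_count v. cmod (a n v i j - b v i j))"
        using le by (auto intro!: always_eventually)
      show "(\<lambda>n. \<Sum>v\<in>sinks E. \<Sum>i<path_count v. \<Sum>j<path_count v. cmod (a n v i j - b v i j)) \<longlonglongrightarrow> 0"
        using upper by simp
    qed
    moreover have "X - (\<lambda>n. combination b) \<in> cauchy_sequences E"
      by (rule C.diff_closed[OF X(1) const])
    ultimately have "X - (\<lambda>n. combination b) \<in> null_sequences E"
      using null_limit_iff[of "X - (\<lambda>n. combination b)"] unfolding null_sequences_def by blast
    then have "Y = A.cl (\<lambda>n. combination b)"
      using X const A.cl_eq_iff[of X "\<lambda>n. combination b"] by simp
    also have "\<dots> = \<iota> (L.cl (combination b))"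
      by (simp add: iota_cl combination_free)
    finally show "Y \<in> \<iota> ` carrier (leavitt_path_algebra E)"
      by (auto simp: leavitt_path_algebra_eq L.carrier_Q combination_free)
  qed
qed

lemma finite_dimensional_cstar: "finite_dimensional (graph_cstar_algebra E)"
proof (rule finite_dimensional_image[OF hom iota_surj _ finite_dimensional_leavitt])
  show "\<iota> (sa_zero (leavitt_path_algebra E)) = sa_zero (graph_cstar_algebra E)"
    using iota_cl[of 0]
    by (simp add: leavitt_path_algebra_eq graph_cstar_algebra_eq L.zero_Q A.zero_Q zero_fun_def)
qed

end

theorem proposition3p4:
  fixes E :: "('v, 'e) pre_digraph"
    and \<iota> :: "('v, 'e) ncpoly set \<Rightarrow> (nat \<Rightarrow> ('v, 'e) ncpoly) set"
  assumes graph: "countable_graph E"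
    and hom: "star_algebra_hom (leavitt_path_algebra E) (graph_cstar_algebra E) \<iota>"
    and inj: "inj_on \<iota> (carrier (leavitt_path_algebra E))"
    and vertex: "\<And>v. v \<in> verts E \<Longrightarrow> \<iota> (leavitt_vertex E v) = cstar_vertex E v"
    and edge: "\<And>e. e \<in> arcs E \<Longrightarrow> \<iota> (leavitt_edge E e) = cstar_edge E e"
  shows
    "(\<iota> ` carrier (leavitt_path_algebra E) = carrier (graph_cstar_algebra E)
        \<longleftrightarrow> star_algebra_isomorphic (leavitt_path_algebra E) (graph_cstar_algebra E)) \<and>
     (star_algebra_isomorphic (leavitt_path_algebra E) (graph_cstar_algebra E)
        \<longleftrightarrow> star_ring_isomorphic (leavitt_path_algebra E) (graph_cstar_algebra E)) \<and>
     (star_ring_isomorphic (leavitt_path_algebra E) (graph_cstar_algebra E)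
        \<longleftrightarrow> finite_graph E \<and> acyclic_graph E) \<and>
     (finite_graph E \<and> acyclic_graph E
        \<longleftrightarrow> finite_dimensional (leavitt_path_algebra E)) \<and>
     (finite_dimensional (leavitt_path_algebra E)
        \<longleftrightarrow> finite_dimensional (graph_cstar_algebra E)) \<and>
     (finite_graph E \<and> acyclic_graph E \<longrightarrow>
        star_algebra_isomorphic (leavitt_path_algebra E)
          (matrix_direct_sum (sinks E) (\<lambda>v. card (paths_to E v))) \<and>
        star_algebra_isomorphic (graph_cstar_algebra E)
          (matrix_direct_sum (sinks E) (\<lambda>v. card (paths_to E v))))"
proof -
  let ?L = "leavitt_path_algebra E" and ?A = "graph_cstar_algebra E"
  let ?M = "matrix_direct_sum (sinks E) (\<lambda>v. card (paths_to E v))"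
  let ?four = "finite_graph E \<and> acyclic_graph E"
  have rep: "graph_rep E"
    using graph by (simp add: countable_graph_def graph_rep_def graph_rep_axioms_def)
  then interpret canonical_map E \<iota>
    using hom inj vertex edge by (simp add: canonical_map_def canonical_map_axioms_def)
  have 12: "star_algebra_isomorphic ?L ?A" if "\<iota> ` carrier ?L = carrier ?A"
    using hom inj that by (auto simp: star_algebra_isomorphic_def bij_betw_def)
  have 23: "star_ring_isomorphic ?L ?A" if "star_algebra_isomorphic ?L ?A"
    using that by (auto simp: star_algebra_isomorphic_def star_ring_isomorphic_def star_algebra_hom_def)
  have 34: "?four" if iso: "star_ring_isomorphic ?L ?A"
  proof -
    obtain \<phi> where "star_ring_hom ?L ?A \<phi>" "bij_betw \<phi> (carrier ?L) (carrier ?A)"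
      using iso by (auto simp: star_ring_isomorphic_def)
    with rep interpret star_ring_iso E \<phi>
      by (simp add: star_ring_iso_def star_ring_iso_axioms_def)
    show ?thesis using graph_finite graph_acyclic by blast
  qed
  have four: "\<iota> ` carrier ?L = carrier ?A \<and> finite_dimensional ?L \<and> finite_dimensional ?A \<and>
      star_algebra_isomorphic ?L ?M \<and> star_algebra_isomorphic ?A ?M" if ?four
  proof -
    interpret finite_acyclic_canonical E \<iota>
      using that by unfold_locales auto
    have isoL: "star_algebra_isomorphic ?M ?L" by (rule matrix_algebra_isomorphic)
    have isoA: "star_algebra_isomorphic ?M ?A"
      by (rule star_algebra_isomorphic_trans[OF isoL 12[OF iota_surj]])
    show ?thesis
      using iota_surj finite_dimensional_leavitt finite_dimensional_cstar
        star_algebra_isomorphic_sym[OF isoL matrix_algebra_closed]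
        star_algebra_isomorphic_sym[OF isoA matrix_algebra_closed] by blast
  qed
  have 54: "?four" if "finite_dimensional ?L"
    using that by (rule finite_dimensional_leavitt_imp)
  have 64: "?four" if "finite_dimensional ?A"
    using that by (rule finite_dimensional_cstar_imp)
  show ?thesis
    using 12 23 34 four 54 64 by blast
qed

end
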